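(* Let $q$ be a real-valued, $1$-periodic function with $q\in L_1[0,1]$ and $\int_0^1 q(x)\,dx=0$. Let $\varepsilon>0$ be fixed, let $N$ be a sufficiently large positive integer, and let $\mathbb N_3(\varepsilon)$ be the set of all $n\in\mathbb N$ with $n>N$ and $$|q_{2n}-S_{2n}+2Q_0Q_{2n}|\ge\frac{\varepsilon}{n^2}.$$ Then the periodic eigenvalues $\lambda_{n,j}$ for $n\in\mathbb N_3(\varepsilon)$ and $j=1,2$ are simple and satisfy $$\lambda_{n,j}=(2\pi n)^2+A_2((2\pi n)^2)+(-1)^j|q_{2n}-S_{2n}+2Q_0Q_{2n}|+o(n^{-2})$$ as $n\to\infty$, $n\in\mathbb N_3(\varepsilon)$.
   Context: $L_0(q)$ is the operator in $L_2[0,1]$ generated by $-y''+qy$ with periodic boundary conditions $y(1)=y(0)$, $y'(1)=y'(0)$. Its large eigenvalues, counted with multiplicity, form two sequences $\lambda_{n,1}\le\lambda_{n,2}$ ($n\ge N_0$, $N_0$ a sufficiently large integer) with $\lambda_{n,j}=(2\pi n)^2+O(n^{1/2})$. For a function $f$ put $f_k=\int_0^1f(x)e^{-2\pi ikx}dx$; this gives $q_k,Q_k,S_k$, where $Q(x)=\int_0^xq(t)\,dt$ and $S(x)=Q(x)^2$. Further $A_2((2\pi n)^2)=a_1((2\pi n)^2)+a_2((2\pi n)^2)$, where $$a_1((2\pi n)^2)=\sum_{k\ne0,2n}\frac{|q_k|^2}{(2\pi n)^2-(2\pi(n-k))^2},$$ $$a_2((2\pi n)^2)=\sum_{k,l}\frac{q_kq_lq_{-k-l}}{[(2\pi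 n)^2-(2\pi(n-k))^2][(2\pi n)^2-(2\pi(n-k-l))^2]},$$ the last sum being over integers $k,l$ with $l\neq 0$, $k\ne0,2n$ and $k+l\neq0,2n$. How large $N$ must be may depend on $q$ and $\varepsilon$. *)

theory Defs
  imports
    "HOL-Analysis.Analysis"
    "HOL-Library.Function_Algebras"
    "HOL-Library.Landau_Symbols"
begin

definition fourier_coeff :: "(real \<Rightarrow> real) \<Rightarrow> int \<Rightarrow> complex" where
  "fourier_coeff f k =
     (LINT x:{0..1}|lebesgue. complex_of_real (f x) * exp (- 2 * of_real pi * \<i> * of_int k * of_real x))"

definition primitive :: "(real \<Rightarrow> real) \<Rightarrow> real \<Rightarrow> real" where
  "primitive q x = (LINT t:{0..x}|lebesgue. q t)"

definition primitive_sq :: "(real \<Rightarrow> real) \<Rightarrow> real \<Rightarrow> real" where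
  "primitive_sq q x = (primitive q x)\<^sup>2"

definition splitting :: "(real \<Rightarrow> real) \<Rightarrow> nat \<Rightarrow> real" where
  "splitting q n =
     cmod (fourier_coeff q (2 * int n) - fourier_coeff (primitive_sq q) (2 * int n)
           + 2 * fourier_coeff (primitive q) 0 * fourier_coeff (primitive q) (2 * int n))"

definition N3 :: "(real \<Rightarrow> real) \<Rightarrow> real \<Rightarrow> nat \<Rightarrow> nat set" where
  "N3 q \<epsilon> N = {n. n > N \<and> splitting q n \<ge> \<epsilon> / (real n)\<^sup>2}"

definition denom :: "nat \<Rightarrow> int \<Rightarrow> real" where
  "denom n k = (2 * pi * real n)\<^sup>2 - (2 * pi * (real n - of_int k))\<^sup>2"

text \<open>
  Both series below converge absolutely when \<open>q\<close> is integrable on \<open>[0,1]\<close> and \<open>n > 0\<close>,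
  so that \<open>infsum\<close> does not take its default value 0. The second one is stated with
  complex values; its sum is in fact real.
\<close>

definition a1 :: "(real \<Rightarrow> real) \<Rightarrow> nat \<Rightarrow> real" where
  "a1 q n = (\<Sum>\<^sub>\<infinity>k\<in>{k::int. k \<noteq> 0 \<and> k \<noteq> 2 * int n}. (cmod (fourier_coeff q k))\<^sup>2 / denom n k)"

definition a2 :: "(real \<Rightarrow> real) \<Rightarrow> nat \<Rightarrow> complex" where
  "a2 q n =
     (\<Sum>\<^sub>\<infinity>(k, l)\<in>{(k::int, l::int). l \<noteq> 0 \<and> k \<noteq> 0 \<and> k \<noteq> 2 * int n \<and> k + l \<noteq> 0 \<and> k + l \<noteq> 2 * int n}.
        fourier_coeff q k * fourier_coeff q l * fourier_coeff q (- k - l)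
        / of_real (denom n k * denom n (k + l)))"

definition A2 :: "(real \<Rightarrow> real) \<Rightarrow> nat \<Rightarrow> complex" where
  "A2 q n = of_real (a1 q n) + a2 q n"

definition square_integrable :: "(real \<Rightarrow> complex) \<Rightarrow> bool" where
  "square_integrable f \<longleftrightarrow>
     f \<in> borel_measurable (lebesgue_on {0..1}) \<and>
     integrable (lebesgue_on {0..1}) (\<lambda>x. (cmod (f x))\<^sup>2)"

text \<open>
  \<open>hill_graph q y z\<close>: the function \<open>y\<close> lies in the domain of the operator generated in
  \<open>L\<^sub>2[0,1]\<close> by \<open>-y'' + q y\<close> and the periodic boundary conditions, and the operator maps \<open>y\<close>
  to \<open>z\<close>. Below, \<open>d\<close> is the derivative of \<open>y\<close> (one-sided at the end points); it is
  absolutely continuous, that is, an indefinite Lebesgue integral, with almost-everywhere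
  derivative \<open>d2\<close>. Only the values on \<open>[0,1]\<close> matter. Square integrability of \<open>y\<close> is
  automatic, because \<open>y\<close> is continuous on \<open>[0,1]\<close>.
\<close>

definition hill_graph :: "(real \<Rightarrow> real) \<Rightarrow> (real \<Rightarrow> complex) \<Rightarrow> (real \<Rightarrow> complex) \<Rightarrow> bool" where
  "hill_graph q y z \<longleftrightarrow>
     square_integrable z \<and>
     (\<exists>d d2.
        (\<forall>x\<in>{0..1}. (y has_vector_derivative d x) (at x within {0..1})) \<and>
        d2 absolutely_integrable_on {0..1} \<and>
        (\<forall>x\<in>{0..1}. d x = d 0 + (LINT t:{0..x}|lebesgue. d2 t)) \<and>
        y 1 = y 0 \<and> d 1 = d 0 \<and>
        (AE x in lebesgue_on {0..1}. z x = - d2 x + of_real (q x) * y x))"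

text \<open>
  An element of the domain is represented by its continuous representative on \<open>[0,1]\<close>,
  extended by 0 to the real line, so that equality of functions is equality in \<open>L\<^sub>2[0,1]\<close>.
\<close>

definition eigenspace :: "(real \<Rightarrow> real) \<Rightarrow> complex \<Rightarrow> (real \<Rightarrow> complex) set" where
  "eigenspace q \<mu> = {y. (\<forall>x. x \<notin> {0..1} \<longrightarrow> y x = 0) \<and> hill_graph q y (\<lambda>x. \<mu> * y x)}"

interpretation cfun: vector_space "\<lambda>(c::complex) (f::real \<Rightarrow> complex) x. c * f x"
  by unfold_locales (auto simp: fun_eq_iff algebra_simps)

text \<open>
  The operator is self-adjoint for real \<open>q\<close>, so algebraic and geometric multiplicities coincide.
  Eigenspaces have dimension at most 2, so the value of \<open>dim\<close> is the true dimension, and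
  it is positive exactly when \<open>\<mu>\<close> is an eigenvalue.
\<close>

definition multiplicity_of :: "(real \<Rightarrow> real) \<Rightarrow> complex \<Rightarrow> nat" where
  "multiplicity_of q \<mu> = cfun.dim (eigenspace q \<mu>)"

definition simple_eigenvalue :: "(real \<Rightarrow> real) \<Rightarrow> complex \<Rightarrow> bool" where
  "simple_eigenvalue q \<mu> \<longleftrightarrow> multiplicity_of q \<mu> = 1"

text \<open>
  The numbers \<open>lam n j\<close> with \<open>n \<ge> N0\<close> and \<open>j = 1, 2\<close> are exactly the large eigenvalues, each
  repeated according to its multiplicity, and they are labelled so that
  \<open>lam n 1 \<le> lam n 2\<close> and \<open>lam n j = (2 \<pi> n)\<^sup>2 + O(sqrt n)\<close>.
  This determines \<open>lam n j\<close> for all large \<open>n\<close>. The other values of \<open>lam\<close> are irrelevant.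
\<close>

definition large_eigenvalues :: "(real \<Rightarrow> real) \<Rightarrow> nat \<Rightarrow> (nat \<Rightarrow> nat \<Rightarrow> real) \<Rightarrow> bool" where
  "large_eigenvalues q N0 lam \<longleftrightarrow>
     (\<forall>n\<ge>N0. lam n 1 \<le> lam n 2) \<and>
     (\<forall>j\<in>{1, 2}. (\<lambda>n. lam n j - (2 * pi * real n)\<^sup>2) \<in> O(\<lambda>n. sqrt (real n))) \<and>
     (\<exists>R. (\<forall>n\<ge>N0. \<forall>j\<in>{1, 2}. lam n j > R) \<and>
          (\<forall>\<mu>. cmod \<mu> > R \<longrightarrow>
             multiplicity_of q \<mu> = card {(n, j). n \<ge> N0 \<and> j \<in> {1, 2} \<and> of_real (lam n j) = \<mu>}))"

end

theory Submission
  imports Defs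
begin

text \<open>
  Expanding an eigenfunction for an eigenvalue \<open>(2 \<pi> n)\<^sup>2 + \<nu>\<close> in a Fourier series turns the differential
  equation into an infinite linear system in which only the modes \<open>n\<close> and \<open>- n\<close> are resonant. The
  other modes are eliminated by iterating their equations twice; since
  \<open>\<Sum> 1 / |n\<^sup>2 - k\<^sup>2| = O(n powr (- 3/4))\<close>, the third iterate contributes \<open>o(n\<^sup>-\<^sup>2)\<close>. What is left is a
  Hermitian \<open>2 \<times> 2\<close> system with diagonal \<open>A2\<close> and off-diagonal entry \<open>q\<^sub>2\<^sub>n\<close> plus a first and a second
  order term. The first order term is \<open>- \<Sum> Q\<^sub>k Q\<^sub>2\<^sub>n\<^sub>-\<^sub>k\<close> over the nonresonant \<open>k\<close>, that is
  \<open>- S\<^sub>2\<^sub>n + 2 Q\<^sub>0 Q\<^sub>2\<^sub>n\<close>; the second order term is a trilinear form in \<open>q\<close>, which is \<open>o(n\<^sup>-\<^sup>2)\<close> by a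
  density argument of Riemann-Lebesgue type. Hence every eigenvalue in the window lies within
  \<open>o(n\<^sup>-\<^sup>2)\<close> of one of the two eigenvalues of the limit system, whose distance is at least
  \<open>2 \<epsilon> / n\<^sup>2\<close>. Multiplicity two would force it close to both, and two distinct eigenvalues
  close to the same one would contradict the orthogonality of their eigenfunctions.
\<close>

subsection \<open>Trigonometric polynomials and uniqueness of Fourier coefficients\<close>

text \<open>Absolute estimates are too weak for the off-diagonal entry: bounding its second order
  term by moduli gives the square of \<open>gap_sum\<close>, whose true size is about (log n)^2 /
  n^2, and this is not o(n^-2). The phases must be used. Summation over the nonresonant modes with
  weights \<open>1 / denom\<close> is convolution with an explicit kernel of sup norm at most 1 / n,
  which yields the bound ||q||^3 / n^2 without a logarithm; only then can density turn O into o. The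
  diagonal second order term needs no such care, since it is kept in \<open>A2\<close>. The
  remainder also contains |\<nu>| times \<open>gap_sq_sum\<close>, of order |\<nu>| / n^2. The
  assumed window O(sqrt n) for \<nu> is too wide for this, so a cruder elimination supplies |\<nu>|
  \<le> |q_2n| + O(\<open>gap_sum\<close>), which tends to 0 by Riemann-Lebesgue. Only the equation
  of one resonant mode is ever reduced: conjugating the eigenfunction exchanges the two modes and
  supplies the other equation.\<close>

definition chr :: "int \<Rightarrow> real \<Rightarrow> complex" where
  "chr k x = cis (2 * pi * of_int k * x)"

lemma norm_chr [simp]: "cmod (chr k x) = 1"
  by (simp add: chr_def)

lemma chr_add: "chr (j + k) x = chr j x * chr k x"
  by (simp add: chr_def cis_mult algebra_simps)

lemma chr_diff_arg: "chr k (x - t) = chr k x * chr (- k) t"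
  by (simp add: chr_def cis_mult algebra_simps)

lemma chr_0 [simp]: "chr 0 x = 1" "chr k 0 = 1"
  by (simp_all add: chr_def)

lemma chr_1 [simp]: "chr k 1 = 1"
  using cis_multiple_2pi [of "of_int k"] by (simp add: chr_def)

lemma cnj_chr: "cnj (chr k x) = chr (- k) x"
  by (simp add: chr_def cis_cnj)

lemma chr_eq_exp: "exp (- 2 * of_real pi * \<i> * of_int k * of_real x) = chr (- k) x"
  by (simp add: chr_def cis_conv_exp mult_ac)

lemma has_vector_derivative_chr:
  "(chr k has_vector_derivative (2 * pi * \<i> * of_int k) * chr k x) (at x within S)"
proof -
  have "((\<lambda>z. exp (2 * pi * \<i> * of_int k * z)) has_field_derivative
      (2 * pi * \<i> * of_int k) * exp (2 * pi * \<i> * of_int k * of_real x)) (at (of_real x))"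
    by (auto intro!: derivative_eq_intros)
  then have "((\<lambda>x. exp (2 * pi * \<i> * of_int k * of_real x)) has_vector_derivative
      (2 * pi * \<i> * of_int k) * exp (2 * pi * \<i> * of_int k * of_real x)) (at x)"
    by (rule has_vector_derivative_real_field)
  then show ?thesis
    by (simp add: chr_def [abs_def] cis_conv_exp mult_ac has_vector_derivative_at_within)
qed

lemma continuous_on_chr [continuous_intros]: "continuous_on S (chr k)"
  by (metis continuous_on_eq_continuous_within has_vector_derivative_chr has_vector_derivative_continuous)

section \<open>Integrals over the unit interval and Fourier coefficients of complex
  functions\<close>

abbreviation LI :: "real measure" where "LI \<equiv> lebesgue_on {0..1}"

lemma space_LI [simp]: "space LI = {0..1}"
  by (simp add: space_restrict_space)

lemma measure_LI: "measure LI {0..1} = 1" "emeasure LI {0..1} = 1"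
  by (simp_all add: measure_restrict_space emeasure_restrict_space)

lemma finite_measure_LI: "finite_measure LI"
  by (rule finite_measureI) (simp add: emeasure_restrict_space)

lemma LINT_set_eq: "set_lebesgue_integral lebesgue {0..1} f = integral\<^sup>L LI f"
  for f :: "real \<Rightarrow> 'a::{banach,second_countable_topology}"
  by (simp add: set_lebesgue_integral_def integral_restrict_space)

lemma set_integrable_eq_LI: "set_integrable lebesgue {0..1} f \<longleftrightarrow> integrable LI f"
  for f :: "real \<Rightarrow> 'a::{banach,second_countable_topology}"
  by (simp add: set_integrable_def integrable_restrict_space)

lemma integrable_LI_continuous:
  fixes f :: "real \<Rightarrow> 'a::euclidean_space"
  assumes "continuous_on {0..1} f"
  shows "integrable LI f"
  using absolutely_integrable_continuous_real [OF assms] by (simp add: set_integrable_eq_LI)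

lemma measurable_LI_continuous:
  fixes f :: "real \<Rightarrow> 'a::euclidean_space"
  assumes "continuous_on {0..1} f"
  shows "f \<in> borel_measurable LI"
  using integrable_LI_continuous [OF assms] by auto

lemma integral_LI_eq:
  fixes f :: "real \<Rightarrow> 'a::euclidean_space"
  assumes "integrable LI f"
  shows "integral\<^sup>L LI f = integral {0..1} f"
  using assms by (intro lebesgue_integral_eq_integral) auto

lemma integrable_LI_mult_bounded:
  fixes f g :: "real \<Rightarrow> complex"
  assumes f: "integrable LI f" and g: "g \<in> borel_measurable LI"
    and B: "\<And>x. x \<in> {0..1} \<Longrightarrow> cmod (g x) \<le> B"
  shows "integrable LI (\<lambda>x. f x * g x)"
proof (rule Bochner_Integration.integrable_bound)
  show "integrable LI (\<lambda>x. B *\<^sub>R f x)" using f by simp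
  show "(\<lambda>x. f x * g x) \<in> borel_measurable LI" using f g by measurable
  show "AE x in LI. cmod (f x * g x) \<le> cmod (B *\<^sub>R f x)"
  proof (rule AE_I2)
    fix x assume "x \<in> space LI"
    then have "cmod (g x) \<le> \<bar>B\<bar>" using B[of x] by auto
    then show "cmod (f x * g x) \<le> cmod (B *\<^sub>R f x)"
      by (simp add: norm_mult mult.commute [of "\<bar>B\<bar>"] mult_left_mono)
  qed
qed

lemma integral_LI_mult_bound:
  fixes f g :: "real \<Rightarrow> complex"
  assumes f: "integrable LI f" and g: "g \<in> borel_measurable LI"
    and B: "\<And>x. x \<in> {0..1} \<Longrightarrow> cmod (g x) \<le> B"
  shows "cmod (\<integral>x. f x * g x \<partial>LI) \<le> B * (\<integral>x. cmod (f x) \<partial>LI)"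
proof -
  have "cmod (\<integral>x. f x * g x \<partial>LI) \<le> (\<integral>x. cmod (f x * g x) \<partial>LI)"
    by (rule integral_norm_bound)
  also have "\<dots> \<le> (\<integral>x. B * cmod (f x) \<partial>LI)"
  proof (rule integral_mono)
    show "integrable LI (\<lambda>x. cmod (f x * g x))"
      using integrable_LI_mult_bounded [OF f g B] by simp
    show "integrable LI (\<lambda>x. B * cmod (f x))" using f by simp
    fix x assume "x \<in> space LI"
    then show "cmod (f x * g x) \<le> B * cmod (f x)"
      using B[of x] by (simp add: norm_mult mult.commute [of B] mult_left_mono)
  qed
  also have "\<dots> = B * (\<integral>x. cmod (f x) \<partial>LI)" by simp
  finally show ?thesis .
qed

lemma integrable_LI_mult_continuous:
  fixes f g :: "real \<Rightarrow> complex"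
  assumes f: "integrable LI f" and g: "continuous_on {0..1} g"
  shows "integrable LI (\<lambda>x. f x * g x)"
proof -
  have "compact (g ` {0..1})" using g by (intro compact_continuous_image) auto
  then obtain B where "\<forall>y\<in>g ` {0..1}. cmod y \<le> B"
    using compact_imp_bounded bounded_iff by metis
  then show ?thesis
    using f measurable_LI_continuous [OF g] by (intro integrable_LI_mult_bounded [where B=B]) auto
qed

definition fc :: "(real \<Rightarrow> complex) \<Rightarrow> int \<Rightarrow> complex" where
  "fc f k = (\<integral>x. f x * chr (- k) x \<partial>LI)"

lemma fourier_coeff_eq_fc: "fourier_coeff f k = fc (\<lambda>x. of_real (f x)) k"
  unfolding fourier_coeff_def LINT_set_eq fc_def by (simp only: chr_eq_exp)

lemma fc_bound: "integrable LI f \<Longrightarrow> cmod (fc f k) \<le> (\<integral>x. cmod (f x) \<partial>LI)"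
  using integral_LI_mult_bound [of f "chr (-k)" 1] measurable_LI_continuous [OF continuous_on_chr]
  by (simp add: fc_def)

lemma integrable_mult_chr: "integrable LI f \<Longrightarrow> integrable LI (\<lambda>x. f x * chr k x)"
  by (rule integrable_LI_mult_continuous) (auto intro: continuous_intros)

lemma fc_add: "integrable LI f \<Longrightarrow> integrable LI g \<Longrightarrow> fc (\<lambda>x. f x + g x) k = fc f k + fc g k"
  using integrable_mult_chr [of f "-k"] integrable_mult_chr [of g "-k"]
  by (simp add: fc_def distrib_right)

lemma fc_diff: "integrable LI f \<Longrightarrow> integrable LI g \<Longrightarrow> fc (\<lambda>x. f x - g x) k = fc f k - fc g k"
  using integrable_mult_chr [of f "-k"] integrable_mult_chr [of g "-k"]
  by (simp add: fc_def left_diff_distrib)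

lemma fc_cmult: "fc (\<lambda>x. c * f x) k = c * fc f k"
  by (simp add: fc_def mult.assoc)

lemma fc_mult_chr: "fc (\<lambda>x. f x * chr m x) k = fc f (k - m)"
  by (simp add: fc_def mult.assoc flip: chr_add)

lemma fc_cnj: "fc (\<lambda>x. cnj (f x)) k = cnj (fc f (- k))"
proof -
  have "cnj (fc f (- k)) = (\<integral>x. cnj (f x * chr (- (- k)) x) \<partial>LI)"
    unfolding fc_def by (rule Bochner_Integration.integral_cnj [symmetric])
  then show ?thesis by (simp add: fc_def cnj_chr)
qed

lemma fc_const: "fc (\<lambda>x. c) k = (if k = 0 then c else 0)"
proof (cases "k = 0")
  case True then show ?thesis by (simp add: fc_def measure_LI)
next
  case False
  define c where "c = 2 * pi * \<i> * of_int (-k)"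
  have "c \<noteq> 0" using False by (simp add: c_def)
  have "((\<lambda>x. c * chr (-k) x) has_integral chr (-k) 1 - chr (-k) 0) {0..1}" unfolding c_def
    by (intro fundamental_theorem_of_calculus has_vector_derivative_chr) auto
  from has_integral_mult_right [OF this, of "inverse c"]
  have "integral {0..1} (chr (-k)) = 0"
    using \<open>c \<noteq> 0\<close> by (simp add: integral_unique flip: mult.assoc)
  moreover have "integral\<^sup>L LI (chr (-k)) = integral {0..1} (chr (-k))"
    by (intro integral_LI_eq integrable_LI_continuous continuous_intros)
  ultimately show ?thesis using False by (simp add: fc_def)
qed

lemma fc_chr: "fc (chr m) k = (if k = m then 1 else 0)"
  using fc_mult_chr [of "\<lambda>x. 1" m k] by (simp add: fc_const)

section \<open>Uniform approximation by trigonometric polynomials and completeness\<close>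

inductive trig_poly :: "(real \<Rightarrow> complex) \<Rightarrow> bool" where
  monom: "trig_poly (\<lambda>x. c * chr k x)"
| add: "trig_poly f \<Longrightarrow> trig_poly g \<Longrightarrow> trig_poly (\<lambda>x. f x + g x)"

lemma trig_poly_continuous: "trig_poly p \<Longrightarrow> continuous_on S p"
  by (induction rule: trig_poly.induct) (auto intro!: continuous_intros)

lemma trig_poly_monom_mult: "trig_poly p \<Longrightarrow> trig_poly (\<lambda>x. (c * chr k x) * p x)"
proof (induction rule: trig_poly.induct)
  case (monom c' k')
  have eq: "c * chr k x * (c' * chr k' x) = (c * c') * chr (k + k') x" for x
    by (simp add: chr_add)
  show ?case unfolding eq by (rule trig_poly.monom)
next
  case (add f g)
  then show ?case using trig_poly.add [OF add.IH] by (simp only: distrib_left)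
qed

lemma trig_poly_mult:
  assumes "trig_poly f" "trig_poly g"
  shows "trig_poly (\<lambda>x. f x * g x)"
  using assms(1)
proof (induction rule: trig_poly.induct)
  case (monom c k)
  show ?case using assms(2) by (rule trig_poly_monom_mult)
next
  case (add f1 f2)
  show ?case using trig_poly.add [OF add.IH(1) add.IH(2)] by (simp only: distrib_right)
qed

lemma trig_poly_const: "trig_poly (\<lambda>x. c)"
  using trig_poly.monom [of c 0] by simp

text \<open>A real-linear functional on the complex plane is a combination of z and its conjugate,
  and on the unit circle conjugation turns \<open>chr 1\<close> into \<open>chr (-1)\<close>. Hence
  the real polynomials supplied by Stone-Weierstrass restrict to trigonometric polynomials.\<close>

lemma trig_poly_real_polynomial_function:
  "real_polynomial_function r \<Longrightarrow> trig_poly (\<lambda>x. of_real (r (chr 1 x)))"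
proof (induction rule: real_polynomial_function.induct)
  case (linear f)
  interpret bounded_linear f by fact
  have fz: "f z = Re z * f 1 + Im z * f \<i>" for z
  proof -
    have "z = Re z *\<^sub>R 1 + Im z *\<^sub>R \<i>" by (simp add: complex_eq_iff)
    then have "f z = f (Re z *\<^sub>R 1 + Im z *\<^sub>R \<i>)" by simp
    then show ?thesis by (simp only: add scaleR) simp
  qed
  have split: "of_real (Re z * a + Im z * b) = (a / 2 - \<i> * b / 2) * z + (a / 2 + \<i> * b / 2) * cnj z"
    for z a b
    by (simp add: complex_eq_iff field_simps)
  have eq: "complex_of_real (f (chr 1 x)) =
      (f 1 / 2 - \<i> * f \<i> / 2) * chr 1 x + (f 1 / 2 + \<i> * f \<i> / 2) * chr (-1) x" for x
    unfolding fz [of "chr 1 x"] split cnj_chr by simp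
  show ?case unfolding eq by (intro trig_poly.add trig_poly.monom)
next
  case (const c) then show ?case by (rule trig_poly_const)
next
  case (add f g) then show ?case unfolding of_real_add by (intro trig_poly.add)
next
  case (mult f g) then show ?case unfolding of_real_mult by (intro trig_poly_mult)
qed

text \<open>\<open>Arg2pi\<close> jumps at the point 1, so continuity there rests on f 1 = f 0. The
  fact about loops and circle maps is applied to the trivial homotopy from f to itself, merely to
  extract the continuity of the lifted map.\<close>

lemma continuous_on_circle_lift:
  fixes f :: "real \<Rightarrow> complex"
  assumes "continuous_on {0..1} f" "f 1 = f 0"
  shows "continuous_on (sphere 0 1) (\<lambda>z. f (Arg2pi z / (2 * pi)))"
proof -
  have "homotopic_loops UNIV f f"
    using assms by (simp add: homotopic_loops_refl path_def pathfinish_def pathstart_def)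
  then have "homotopic_with_canon (\<lambda>h. True) (sphere 0 1) UNIV
      (f \<circ> (\<lambda>z. Arg2pi z / (2 * pi))) (f \<circ> (\<lambda>z. Arg2pi z / (2 * pi)))"
    by (rule homotopic_loops_imp_homotopic_circlemaps)
  then show ?thesis
    using homotopic_with_imp_continuous by (fastforce simp: o_def)
qed

lemma trig_poly_approx:
  fixes f :: "real \<Rightarrow> complex"
  assumes f: "continuous_on {0..1} f" "f 1 = f 0" and "\<epsilon> > 0"
  obtains p where "trig_poly p" "\<And>x. x \<in> {0..1} \<Longrightarrow> cmod (f x - p x) < \<epsilon>"
proof -
  define F where "F = (\<lambda>z. f (Arg2pi z / (2 * pi)))"
  have cont: "continuous_on (sphere 0 1) F"
    unfolding F_def by (rule continuous_on_circle_lift [OF f])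
  have Ff: "F (chr 1 x) = f x" if "x \<in> {0..1}" for x
  proof (cases "x = 1")
    case True then show ?thesis using f(2) by (simp add: F_def Arg2pi_of_real [of 1, simplified])
  next
    case False
    then have "Arg2pi (chr 1 x) = 2 * pi * x"
      using that by (intro Arg2pi_unique [of 1]) (auto simp: chr_def cis_conv_exp mult_ac)
    then show ?thesis by (simp add: F_def)
  qed
  obtain r where r: "real_polynomial_function r" "\<And>z. z \<in> sphere 0 1 \<Longrightarrow> \<bar>Re (F z) - r z\<bar> < \<epsilon> / 2"
    using Stone_Weierstrass_real_polynomial_function [of "sphere 0 1" "\<lambda>z. Re (F z)" "\<epsilon>/2"] cont \<open>\<epsilon> > 0\<close>
    by (auto intro: continuous_intros)
  obtain s where s: "real_polynomial_function s" "\<And>z. z \<in> sphere 0 1 \<Longrightarrow> \<bar>Im (F z) - s z\<bar> < \<epsilon> / 2"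
    using Stone_Weierstrass_real_polynomial_function [of "sphere 0 1" "\<lambda>z. Im (F z)" "\<epsilon>/2"] cont \<open>\<epsilon> > 0\<close>
    by (auto intro: continuous_intros)
  define p where "p x = of_real (r (chr 1 x)) + \<i> * of_real (s (chr 1 x))" for x
  have "trig_poly p"
    unfolding p_def
    by (intro trig_poly.add trig_poly_mult trig_poly_const trig_poly_real_polynomial_function r s)
  moreover have "cmod (f x - p x) < \<epsilon>" if "x \<in> {0..1}" for x
  proof -
    have "chr 1 x \<in> sphere 0 1" by (simp add: dist_norm)
    then have "\<bar>Re (f x - p x)\<bar> < \<epsilon>/2" "\<bar>Im (f x - p x)\<bar> < \<epsilon>/2"
      using r(2) [of "chr 1 x"] s(2) [of "chr 1 x"] Ff [OF that] by (simp_all add: p_def)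
    then show ?thesis using cmod_le [of "f x - p x"] by linarith
  qed
  ultimately show ?thesis using that by blast
qed

lemma integral_mult_trig_poly_eq_0:
  assumes f: "integrable LI f" and 0: "\<And>k. fc f k = 0"
  shows "trig_poly p \<Longrightarrow> (\<integral>x. f x * p x \<partial>LI) = 0"
proof (induction rule: trig_poly.induct)
  case (monom c k)
  have "(\<integral>x. f x * (c * chr k x) \<partial>LI) = c * fc f (- k)"
    by (simp add: fc_def mult.left_commute)
  then show ?case using 0 by simp
next
  case (add g h)
  then show ?case
    using f integrable_LI_mult_continuous [OF f trig_poly_continuous]
    by (simp add: distrib_left)
qed

text \<open>Vanishing coefficients make the integral of f p zero for every trigonometric polynomial
  p. With p uniformly close to the conjugate of f, the integral of |f|^2 equals that of f (cnj f -
  p), which is at most \<epsilon> times the L1 norm of f. Continuity upgrades the vanishing integral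
  to vanishing at every point, so later identities between continuous periodic functions can be
  proved by comparing coefficients.\<close>

lemma fourier_unique_0:
  assumes f: "continuous_on {0..1} f" "f 1 = f 0" and 0: "\<And>k. fc f k = 0" and x: "x \<in> {0..1}"
  shows "f x = 0"
proof -
  have int: "integrable LI f" using f by (intro integrable_LI_continuous)
  define I where "I = (\<integral>x. (cmod (f x))\<^sup>2 \<partial>LI)"
  define J where "J = (\<integral>x. cmod (f x) \<partial>LI)"
  have "I \<ge> 0" "J \<ge> 0" by (simp_all add: I_def J_def)
  have IJ: "I \<le> \<epsilon> * J" if "\<epsilon> > 0" for \<epsilon>
  proof -
    obtain p where p: "trig_poly p" "\<And>x. x \<in> {0..1} \<Longrightarrow> cmod (cnj (f x) - p x) < \<epsilon>"
      using f \<open>\<epsilon> > 0\<close> by (auto intro: trig_poly_approx [of "\<lambda>x. cnj (f x)" \<epsilon>] continuous_intros)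
    have cc: "continuous_on {0..1} (\<lambda>x. cnj (f x))" using f by (auto intro: continuous_intros)
    have "complex_of_real I = (\<integral>x. f x * cnj (f x) \<partial>LI)"
      by (simp add: I_def complex_norm_square [symmetric] flip: integral_complex_of_real of_real_power)
    also have "\<dots> = (\<integral>x. f x * cnj (f x) - f x * p x \<partial>LI)"
      using integral_mult_trig_poly_eq_0 [OF int 0 p(1)] int
        integrable_LI_mult_continuous [OF int cc]
        integrable_LI_mult_continuous [OF int trig_poly_continuous [OF p(1)]]
      by simp
    also have "\<dots> = (\<integral>x. f x * (cnj (f x) - p x) \<partial>LI)" by (simp add: right_diff_distrib)
    finally have "I = cmod (\<integral>x. f x * (cnj (f x) - p x) \<partial>LI)"
      using \<open>I \<ge> 0\<close> by (metis norm_of_real abs_of_nonneg)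
    also have "\<dots> \<le> \<epsilon> * J"
      unfolding J_def using int p(2) cc f(1) trig_poly_continuous [OF p(1)]
      by (intro integral_LI_mult_bound measurable_LI_continuous continuous_intros) (auto intro: less_imp_le)
    finally show ?thesis .
  qed
  have "I \<le> 0 + e" if "e > 0" for e
  proof (cases "J = 0")
    case True then show ?thesis using IJ [OF that] that by simp
  next
    case False then show ?thesis using IJ [of "e / J"] that \<open>J \<ge> 0\<close> by simp
  qed
  then have "I = 0" using \<open>I \<ge> 0\<close> field_le_epsilon [of I 0] by auto
  have c2: "continuous_on {0..1} (\<lambda>x. (cmod (f x))\<^sup>2)" using f by (auto intro: continuous_intros)
  have "((\<lambda>x. (cmod (f x))\<^sup>2) has_integral 0) {0..1}"
    using \<open>I = 0\<close> integral_LI_eq [OF integrable_LI_continuous [OF c2]] integrable_continuous_real [OF c2]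
    by (metis I_def integrable_integral)
  then show ?thesis
    using has_integral_0_cbox_imp_0 [of 0 1 "\<lambda>x. (cmod (f x))\<^sup>2" x] c2 x by auto
qed

lemma fourier_unique:
  assumes "continuous_on {0..1} f" "f 1 = f 0" "continuous_on {0..1} g" "g 1 = g 0"
    and "\<And>k. fc f k = fc g k" and "x \<in> {0..1}"
  shows "f x = g x"
  using fourier_unique_0 [of "\<lambda>x. f x - g x" x] assms
  by (auto simp: fc_diff integrable_LI_continuous intro: continuous_intros)

subsection \<open>Density of trigonometric polynomials in \<open>L\<^sub>1\<close>\<close>

lemma trig_poly_fc_eventually_0:
  "trig_poly p \<Longrightarrow> \<exists>d::int. \<forall>k. \<bar>k\<bar> > d \<longrightarrow> fc p k = 0"
proof (induction rule: trig_poly.induct)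
  case (monom c k)
  then show ?case by (intro exI [of _ "\<bar>k\<bar>"]) (auto simp: fc_cmult fc_chr)
next
  case (add f g)
  then obtain d1 d2 where "\<forall>k. \<bar>k\<bar> > d1 \<longrightarrow> fc f k = 0" "\<forall>k. \<bar>k\<bar> > d2 \<longrightarrow> fc g k = 0" by blast
  then show ?case using add.hyps
    by (intro exI [of _ "max d1 d2"]) (simp add: fc_add integrable_LI_continuous trig_poly_continuous)
qed

lemma L1_approx_truncate:
  fixes q :: "real \<Rightarrow> real"
  assumes q: "integrable LI q" and "\<epsilon> > 0"
  obtains m :: nat where "(\<integral>x. \<bar>q x - max (- real m) (min (real m) (q x))\<bar> \<partial>LI) < \<epsilon>"
proof -
  let ?t = "\<lambda>m x. \<bar>q x - max (- real m) (min (real m) (q x))\<bar>"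
  have "(\<lambda>m. \<integral>x. ?t m x \<partial>LI) \<longlonglongrightarrow> (\<integral>x. 0 \<partial>LI)"
  proof (rule integral_dominated_convergence [where w = "\<lambda>x. \<bar>q x\<bar>"])
    show "AE x in LI. (\<lambda>m. ?t m x) \<longlonglongrightarrow> 0"
    proof (rule AE_I2, rule tendsto_eventually)
      fix x
      show "\<forall>\<^sub>F m in sequentially. ?t m x = 0"
        using eventually_ge_at_top [of "nat \<lceil>\<bar>q x\<bar>\<rceil>"]
      proof eventually_elim
        case (elim m)
        then have "\<bar>q x\<bar> \<le> real m" by linarith
        then show ?case by (auto simp: max_def min_def)
      qed
    qed
    show "AE x in LI. norm (?t m x) \<le> \<bar>q x\<bar>" for m
      by (rule AE_I2) (auto simp: max_def min_def)
  qed (use q in auto)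
  then have "\<forall>\<^sub>F m in sequentially. (\<integral>x. ?t m x \<partial>LI) < \<epsilon>"
    using \<open>\<epsilon> > 0\<close> order_tendstoD(2) by fastforce
  then show ?thesis using that eventually_happens'[OF sequentially_bot] by blast
qed

lemma L1_approx_continuous_bounded:
  fixes f :: "real \<Rightarrow> real"
  assumes f: "f \<in> borel_measurable LI" and B: "\<And>x. \<bar>f x\<bar> \<le> B" and "\<epsilon> > 0"
  obtains g where "continuous_on UNIV g" "g 0 = 0" "g 1 = 0" "(\<integral>x. \<bar>f x - g x\<bar> \<partial>LI) < \<epsilon>"
proof -
  have "f measurable_on {0..1}"
    using f by (subst measurable_on_iff_borel_measurable) auto
  then obtain N g where N: "negligible N" and g: "\<And>n. continuous_on UNIV (g n)"
    and lim: "\<And>x. x \<notin> N \<Longrightarrow> (\<lambda>n. g n x) \<longlonglongrightarrow> (if x \<in> {0..1} then f x else 0)"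
    unfolding measurable_on_def by blast
  \<comment> \<open>The approximants \<open>g n\<close> need be neither bounded nor periodic.
    Clamping to [-B, B] supplies the dominating function, and the trapezoidal factor, which tends to
    1 inside the interval, forces the value 0 at both end points.\<close>
  define h where "h n x = min (min 1 (real n * x)) (real n * (1 - x)) * max (- B) (min B (g n x))" for n x
  have hB: "\<bar>h n x\<bar> \<le> B" if "x \<in> {0..1}" for n x
  proof -
    have "B \<ge> 0" using B [of 0] by linarith
    then have "\<bar>max (- B) (min B (g n x))\<bar> \<le> B" by auto
    moreover have "\<bar>min (min 1 (real n * x)) (real n * (1 - x))\<bar> \<le> 1" using that by auto
    ultimately have "\<bar>h n x\<bar> \<le> 1 * B"
      unfolding h_def abs_mult by (intro mult_mono) auto
    then show ?thesis by simp
  qed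
  have hc: "continuous_on S (h n)" for n S
    unfolding h_def using g [of n] continuous_on_subset [OF _ subset_UNIV]
    by (intro continuous_intros) blast+
  have "(\<lambda>n. \<integral>x. \<bar>f x - h n x\<bar> \<partial>LI) \<longlonglongrightarrow> (\<integral>x. 0 \<partial>LI)"
  proof (rule integral_dominated_convergence [where w = "\<lambda>x. 2 * B"])
    show "AE x in LI. (\<lambda>n. \<bar>f x - h n x\<bar>) \<longlonglongrightarrow> 0"
    proof -
      have "AE x in lebesgue. x \<notin> N \<union> {0,1}"
        using N by (intro AE_not_in) (simp add: negligible_iff_null_sets [symmetric])
      then have "AE x in LI. x \<notin> N \<union> {0,1}"
        by (subst AE_restrict_space_iff) auto
      moreover have "AE x in LI. x \<in> {0..1}" by (rule AE_I2) auto
      ultimately show ?thesis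
      proof eventually_elim
        case (elim x)
        then have x: "0 < x" "x < 1" "x \<notin> N" by auto
        have "(\<lambda>n. max (- B) (min B (g n x))) \<longlonglongrightarrow> max (- B) (min B (f x))"
          using lim [of x] x by (intro tendsto_intros) auto
        also have "max (- B) (min B (f x)) = f x" using B [of x] by auto
        finally have a: "(\<lambda>n. max (- B) (min B (g n x))) \<longlonglongrightarrow> f x" .
        have b: "(\<lambda>n. min (min 1 (real n * x)) (real n * (1 - x))) \<longlonglongrightarrow> 1"
        proof (rule tendsto_eventually)
          show "\<forall>\<^sub>F n in sequentially. min (min 1 (real n * x)) (real n * (1 - x)) = 1"
            using eventually_ge_at_top [of "nat \<lceil>1 / x\<rceil>"] eventually_ge_at_top [of "nat \<lceil>1 / (1 - x)\<rceil>"]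
          proof eventually_elim
            case (elim n)
            then have "1 / x \<le> real n" "1 / (1 - x) \<le> real n" by linarith+
            then have "1 \<le> real n * x" "1 \<le> real n * (1 - x)"
              using x by (simp_all add: field_simps)
            then show ?case by simp
          qed
        qed
        show ?case
          using tendsto_rabs [OF tendsto_diff [OF tendsto_const tendsto_mult [OF b a], of "f x"]]
          by (simp add: h_def)
      qed
    qed
    show "AE x in LI. norm \<bar>f x - h n x\<bar> \<le> 2 * B" for n
    proof (rule AE_I2)
      fix x assume "x \<in> space LI"
      then show "norm \<bar>f x - h n x\<bar> \<le> 2 * B" using hB [of x n] B [of x] by auto
    qed
    show "integrable LI (\<lambda>x. 2 * B)" by (intro integrable_LI_continuous continuous_intros)
    show "(\<lambda>x. \<bar>f x - h n x\<bar>) \<in> borel_measurable LI" for n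
      using f measurable_LI_continuous [OF hc [of _ n]] by measurable
  qed auto
  then have "\<forall>\<^sub>F n in sequentially. (\<integral>x. \<bar>f x - h n x\<bar> \<partial>LI) < \<epsilon>"
    using \<open>\<epsilon> > 0\<close> order_tendstoD(2) by fastforce
  then obtain n where "(\<integral>x. \<bar>f x - h n x\<bar> \<partial>LI) < \<epsilon>"
    using eventually_happens'[OF sequentially_bot] by blast
  moreover have "h n 0 = 0" "h n 1 = 0" by (auto simp: h_def)
  ultimately show ?thesis using that hc by blast
qed

lemma L1_approx_trig_poly:
  fixes q :: "real \<Rightarrow> real"
  assumes q: "integrable LI q" and "\<epsilon> > 0"
  obtains p where "trig_poly p" "(\<integral>x. cmod (of_real (q x) - p x) \<partial>LI) < \<epsilon>"
proof -
  obtain m :: nat where m: "(\<integral>x. \<bar>q x - max (- real m) (min (real m) (q x))\<bar> \<partial>LI) < \<epsilon> / 3"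
    using L1_approx_truncate [OF q, of "\<epsilon>/3"] \<open>\<epsilon> > 0\<close> by auto
  define f where "f x = max (- real m) (min (real m) (q x))" for x
  have fm: "f \<in> borel_measurable LI" unfolding f_def using q by measurable
  have fb: "\<bar>f x\<bar> \<le> real m" for x by (auto simp: f_def)
  obtain g where g: "continuous_on UNIV g" "g 0 = 0" "g 1 = 0" and fg: "(\<integral>x. \<bar>f x - g x\<bar> \<partial>LI) < \<epsilon> / 3"
    using L1_approx_continuous_bounded [OF fm fb, of "\<epsilon>/3"] \<open>\<epsilon> > 0\<close> by auto
  have gc: "continuous_on {0..1} g" using g(1) continuous_on_subset by blast
  obtain p where p: "trig_poly p" "\<And>x. x \<in> {0..1} \<Longrightarrow> cmod (of_real (g x) - p x) < \<epsilon> / 3"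
  proof (rule trig_poly_approx)
    show "continuous_on {0..1} (\<lambda>x. complex_of_real (g x))" using gc by (intro continuous_intros)
    show "complex_of_real (g 1) = complex_of_real (g 0)" "\<epsilon> / 3 > 0" using g \<open>\<epsilon> > 0\<close> by auto
  qed blast
  have fi: "integrable LI f"
    by (rule finite_measure.integrable_const_bound [OF finite_measure_LI, of _ "real m"]) (use fm fb in auto)
  have gi: "integrable LI g" by (rule integrable_LI_continuous [OF gc])
  have gpi: "integrable LI (\<lambda>x. cmod (of_real (g x) - p x))"
    using gc trig_poly_continuous [OF p(1)] by (intro integrable_LI_continuous continuous_intros)
  have qpi: "integrable LI (\<lambda>x. complex_of_real (q x) - p x)"
    using q integrable_LI_continuous [OF trig_poly_continuous [OF p(1)]] by simp
  have gp: "(\<integral>x. cmod (of_real (g x) - p x) \<partial>LI) \<le> (\<integral>x. \<epsilon> / 3 \<partial>LI)"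
    using gpi by (rule integral_mono)
      (use p(2) in \<open>simp_all add: less_imp_le integrable_LI_continuous\<close>)
  also have "\<dots> = \<epsilon> / 3" by (simp add: measure_LI)
  finally have gp: "(\<integral>x. cmod (of_real (g x) - p x) \<partial>LI) \<le> \<epsilon> / 3" .
  have "(\<integral>x. cmod (of_real (q x) - p x) \<partial>LI)
      \<le> (\<integral>x. \<bar>q x - f x\<bar> + \<bar>f x - g x\<bar> + cmod (of_real (g x) - p x) \<partial>LI)"
  proof (rule integral_mono)
    show "integrable LI (\<lambda>x. cmod (complex_of_real (q x) - p x))" using qpi by simp
    show "integrable LI (\<lambda>x. \<bar>q x - f x\<bar> + \<bar>f x - g x\<bar> + cmod (of_real (g x) - p x))"
      using q fi gi gpi by simp
    fix x
    have "cmod (of_real (q x) - p x) = cmod (of_real (q x - f x) + of_real (f x - g x) + (of_real (g x) - p x))"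
      by simp
    also have "\<dots> \<le> \<bar>q x - f x\<bar> + \<bar>f x - g x\<bar> + cmod (of_real (g x) - p x)"
      by (intro norm_triangle_le add_mono) (auto simp del: of_real_diff)
    finally show "cmod (of_real (q x) - p x) \<le> \<bar>q x - f x\<bar> + \<bar>f x - g x\<bar> + cmod (of_real (g x) - p x)" .
  qed
  also have "\<dots> = (\<integral>x. \<bar>q x - f x\<bar> \<partial>LI) + (\<integral>x. \<bar>f x - g x\<bar> \<partial>LI) + (\<integral>x. cmod (of_real (g x) - p x) \<partial>LI)"
    using q fi gi gpi by simp
  also have "\<dots> < \<epsilon>" using m fg gp unfolding f_def by linarith
  finally show ?thesis using that p(1) by blast
qed

lemma Riemann_Lebesgue:
  fixes q :: "real \<Rightarrow> real"
  assumes q: "integrable LI q"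
  shows "(\<lambda>n. fc (\<lambda>x. of_real (q x)) (2 * int n)) \<longlonglongrightarrow> 0"
proof (rule tendstoI)
  fix e :: real assume "e > 0"
  obtain p where p: "trig_poly p" "(\<integral>x. cmod (of_real (q x) - p x) \<partial>LI) < e"
    using L1_approx_trig_poly [OF q \<open>e > 0\<close>] by blast
  obtain d where d: "\<And>k. \<bar>k\<bar> > d \<Longrightarrow> fc p k = 0" using trig_poly_fc_eventually_0 [OF p(1)] by blast
  have pi: "integrable LI p" by (intro integrable_LI_continuous trig_poly_continuous p)
  show "\<forall>\<^sub>F n in sequentially. dist (fc (\<lambda>x. of_real (q x)) (2 * int n)) 0 < e"
    using eventually_gt_at_top [of "nat d"]
  proof eventually_elim
    case (elim n)
    then have "fc p (2 * int n) = 0" by (intro d) auto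
    then have "fc (\<lambda>x. of_real (q x)) (2 * int n) = fc (\<lambda>x. of_real (q x) - p x) (2 * int n)"
      using q pi by (simp add: fc_diff)
    then show ?case using fc_bound [of "\<lambda>x. of_real (q x) - p x" "2 * int n"] q pi p(2) by simp
  qed
qed

subsection \<open>Integration by parts and termwise integration\<close>

lemma set_integral_initial_segment:
  fixes f :: "real \<Rightarrow> 'a::{banach,second_countable_topology}"
  assumes "x \<in> {0..1}"
  shows "set_lebesgue_integral lebesgue {0..x} f = (\<integral>t. of_bool (t \<le> x) *\<^sub>R f t \<partial>LI)"
proof -
  have "set_lebesgue_integral lebesgue {0..x} f
      = (\<integral>t. indicator {0..1} t *\<^sub>R (of_bool (t \<le> x) *\<^sub>R f t) \<partial>lebesgue)"
    unfolding set_lebesgue_integral_def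
    by (rule Bochner_Integration.integral_cong) (use assms in \<open>auto simp: indicator_def\<close>)
  also have "\<dots> = (\<integral>t. of_bool (t \<le> x) *\<^sub>R f t \<partial>LI)"
    by (simp add: integral_restrict_space)
  finally show ?thesis .
qed

lemma id_measurable_LI [measurable]: "(\<lambda>x. x) \<in> borel_measurable LI"
  by (intro measurable_LI_continuous continuous_intros)

lemma AE_LI_neq: "AE t in LI. t \<noteq> x"
proof -
  have "AE t in lebesgue. t \<notin> {x}"
    by (intro AE_not_in) auto
  then show ?thesis by (subst AE_restrict_space_iff) auto
qed

text \<open>Fubini for f(x) g(t) on the unit square: the two summands are the integrals over the
  triangles t \<le> x and x \<le> t, which cover the square and overlap in the null diagonal. This
  works for merely integrable f and g, whose antiderivatives may fail to be differentiable at some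
  points.\<close>

lemma integration_by_parts_L1:
  fixes f g :: "real \<Rightarrow> complex"
  assumes f: "integrable LI f" and g: "integrable LI g"
    and F: "\<And>x. x \<in> {0..1} \<Longrightarrow> F x = set_lebesgue_integral lebesgue {0..x} f"
    and G: "\<And>x. x \<in> {0..1} \<Longrightarrow> G x = set_lebesgue_integral lebesgue {0..x} g"
  shows "(\<integral>x. f x * G x \<partial>LI) + (\<integral>x. F x * g x \<partial>LI) = F 1 * G 1"
proof -
  interpret finite_measure LI by (rule finite_measure_LI)
  interpret P: pair_sigma_finite LI LI ..
  have [measurable]: "f \<in> borel_measurable LI" "g \<in> borel_measurable LI" using f g by auto
  have fg: "integrable (LI \<Otimes>\<^sub>M LI) (\<lambda>(x,t). f x * g t)"
  proof (rule P.Fubini_integrable)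
    show "integrable LI (\<lambda>x. LINT y|LI. norm (case (x, y) of (x, t) \<Rightarrow> f x * g t))"
      using f by (simp add: norm_mult)
  qed (use g in auto)
  have bnd: "integrable (LI \<Otimes>\<^sub>M LI) (\<lambda>(x,t). of_bool (P x t) * (f x * g t))"
    if [measurable]: "Measurable.pred (LI \<Otimes>\<^sub>M LI) (\<lambda>(x,t). P x t)" for P
  proof (rule Bochner_Integration.integrable_bound [OF fg])
    have *: "(\<lambda>(x, t). of_bool (P x t) * (f x * g t))
        = (\<lambda>z. if (case z of (x,t) \<Rightarrow> P x t) then f (fst z) * g (snd z) else 0)"
      by (auto simp: fun_eq_iff)
    show "(\<lambda>(x, t). of_bool (P x t) * (f x * g t)) \<in> borel_measurable (LI \<Otimes>\<^sub>M LI)"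
      unfolding * by measurable
  qed (auto intro!: AE_I2)
  have i1: "integrable (LI \<Otimes>\<^sub>M LI) (\<lambda>(x,t). of_bool (t \<le> x) * (f x * g t))"
    by (rule bnd) measurable
  have i2: "integrable (LI \<Otimes>\<^sub>M LI) (\<lambda>(x,t). of_bool (x \<le> t) * (f x * g t))"
    by (rule bnd) measurable
  have "(\<integral>x. f x * G x \<partial>LI) = (\<integral>x. (\<integral>t. of_bool (t \<le> x) * (f x * g t) \<partial>LI) \<partial>LI)"
  proof (rule Bochner_Integration.integral_cong)
    fix x assume "x \<in> space LI"
    then have "f x * G x = f x * (\<integral>t. of_bool (t \<le> x) *\<^sub>R g t \<partial>LI)"
      by (simp add: G set_integral_initial_segment)
    also have "\<dots> = (\<integral>t. f x * (of_bool (t \<le> x) *\<^sub>R g t) \<partial>LI)"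
      by (simp only: integral_mult_right_zero)
    also have "\<dots> = (\<integral>t. of_bool (t \<le> x) * (f x * g t) \<partial>LI)"
      by (rule Bochner_Integration.integral_cong) auto
    finally show "f x * G x = (\<integral>t. of_bool (t \<le> x) * (f x * g t) \<partial>LI)" .
  qed simp
  moreover have "(\<integral>t. F t * g t \<partial>LI) = (\<integral>t. (\<integral>x. of_bool (x \<le> t) * (f x * g t) \<partial>LI) \<partial>LI)"
  proof (rule Bochner_Integration.integral_cong)
    fix x assume "x \<in> space LI"
    then have "F x * g x = (\<integral>t. of_bool (t \<le> x) *\<^sub>R f t \<partial>LI) * g x"
      by (simp add: F set_integral_initial_segment)
    also have "\<dots> = (\<integral>t. (of_bool (t \<le> x) *\<^sub>R f t) * g x \<partial>LI)"
      by (simp only: integral_mult_left_zero)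
    also have "\<dots> = (\<integral>t. of_bool (t \<le> x) * (f t * g x) \<partial>LI)"
      by (rule Bochner_Integration.integral_cong) auto
    finally show "F x * g x = (\<integral>t. of_bool (t \<le> x) * (f t * g x) \<partial>LI)" .
  qed simp
  moreover have "(\<integral>t. (\<integral>x. of_bool (x \<le> t) * (f x * g t) \<partial>LI) \<partial>LI)
      = (\<integral>x. (\<integral>t. of_bool (x \<le> t) * (f x * g t) \<partial>LI) \<partial>LI)"
    by (rule P.Fubini_integral) (use i2 in simp)
  moreover have "(\<integral>x. (\<integral>t. of_bool (t \<le> x) * (f x * g t) \<partial>LI) \<partial>LI)
      + (\<integral>x. (\<integral>t. of_bool (x \<le> t) * (f x * g t) \<partial>LI) \<partial>LI)
      = (\<integral>x. (\<integral>t. of_bool (t \<le> x) * (f x * g t) \<partial>LI) + (\<integral>t. of_bool (x \<le> t) * (f x * g t) \<partial>LI) \<partial>LI)"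
    using P.integrable_fst [OF i1] P.integrable_fst [OF i2] by simp
  moreover have "\<dots> = (\<integral>x. f x * G 1 \<partial>LI)"
  proof (rule Bochner_Integration.integral_cong)
    fix x assume "x \<in> space LI"
    have "integrable LI (\<lambda>t. of_bool (P t) * (f x * g t))" if [measurable]: "Measurable.pred LI P" for P
    proof (rule Bochner_Integration.integrable_bound)
      show "integrable LI (\<lambda>t. f x * g t)" using g by simp
      have *: "(\<lambda>t. of_bool (P t) * (f x * g t)) = (\<lambda>t. if P t then f x * g t else 0)"
        by (auto simp: fun_eq_iff)
      show "(\<lambda>t. of_bool (P t) * (f x * g t)) \<in> borel_measurable LI"
        unfolding * by measurable
    qed (auto intro!: AE_I2)
    then have "(\<integral>t. of_bool (t \<le> x) * (f x * g t) \<partial>LI) + (\<integral>t. of_bool (x \<le> t) * (f x * g t) \<partial>LI)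
       = (\<integral>t. of_bool (t \<le> x) * (f x * g t) + of_bool (x \<le> t) * (f x * g t) \<partial>LI)"
      by simp
    also have "\<dots> = (\<integral>t. f x * g t \<partial>LI)"
    proof (rule integral_cong_AE)
      have *: "(\<lambda>t. of_bool (t \<le> x) * (f x * g t) + of_bool (x \<le> t) * (f x * g t))
          = (\<lambda>t. (if t \<le> x then f x * g t else 0) + (if x \<le> t then f x * g t else 0))"
        by (auto simp: fun_eq_iff)
      show "(\<lambda>t. of_bool (t \<le> x) * (f x * g t) + of_bool (x \<le> t) * (f x * g t)) \<in> borel_measurable LI"
        unfolding * by measurable
      show "AE t in LI. of_bool (t \<le> x) * (f x * g t) + of_bool (x \<le> t) * (f x * g t) = f x * g t"
        using AE_LI_neq [of x] by eventually_elim auto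
    qed simp
    also have "\<dots> = f x * G 1" by (simp add: G LINT_set_eq)
    finally show "(\<integral>t. of_bool (t \<le> x) * (f x * g t) \<partial>LI) + (\<integral>t. of_bool (x \<le> t) * (f x * g t) \<partial>LI)
       = f x * G 1" .
  qed simp
  moreover have "\<dots> = F 1 * G 1" by (simp add: F LINT_set_eq)
  ultimately show ?thesis by simp
qed

lemma continuous_on_primitive:
  fixes f :: "real \<Rightarrow> complex"
  assumes "integrable LI f"
  shows "continuous_on {0..1} (\<lambda>x. set_lebesgue_integral lebesgue {0..x} f)"
proof -
  have f: "set_integrable lebesgue {0..1} f" using assms by (simp add: set_integrable_eq_LI)
  have "continuous_on {0..1} (\<lambda>x. integral {0..x} f)"
    using set_lebesgue_integral_eq_integral(1) [OF f] by (rule indefinite_integral_continuous_1)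
  moreover have "set_lebesgue_integral lebesgue {0..x} f = integral {0..x} f" if "x \<in> {0..1}" for x
    using f by (intro set_lebesgue_integral_eq_integral) (rule set_integrable_subset, use that in auto)
  ultimately show ?thesis by (metis (mono_tags, lifting) continuous_on_eq)
qed

lemma set_integral_vector_derivative:
  fixes g :: "real \<Rightarrow> complex"
  assumes "\<And>x. x \<in> {0..1} \<Longrightarrow> (G has_vector_derivative g x) (at x within {0..1})"
    and "continuous_on {0..1} g" "x \<in> {0..1}"
  shows "set_lebesgue_integral lebesgue {0..x} g = G x - G 0"
proof -
  have "set_integrable lebesgue {0..x} g"
    using assms by (intro absolutely_integrable_continuous_real continuous_on_subset [OF assms(2)]) auto
  then have "set_lebesgue_integral lebesgue {0..x} g = integral {0..x} g"
    by (rule set_lebesgue_integral_eq_integral)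
  also have "\<dots> = G x - G 0"
  proof (intro integral_unique fundamental_theorem_of_calculus)
    fix t assume "t \<in> {0..x}"
    then show "(G has_vector_derivative g t) (at t within {0..x})"
      using assms(1) [of t] assms(3) by (auto intro: has_vector_derivative_within_subset)
  qed (use assms in auto)
  finally show ?thesis .
qed

lemma fc_primitive:
  fixes f :: "real \<Rightarrow> complex"
  assumes f: "integrable LI f" and 0: "integral\<^sup>L LI f = 0"
    and F: "\<And>x. x \<in> {0..1} \<Longrightarrow> F x = C + set_lebesgue_integral lebesgue {0..x} f"
  shows "fc f k = 2 * pi * \<i> * of_int k * fc F k"
proof (cases "k = 0")
  case True then show ?thesis using 0 by (simp add: fc_def)
next
  case False
  define g where "g x = (2 * pi * \<i> * of_int (-k)) * chr (-k) x" for x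
  define F0 where "F0 x = set_lebesgue_integral lebesgue {0..x} f" for x
  \<comment> \<open>Subtracting 1 gives the antiderivative that vanishes at 0, as integration by
    parts requires. It vanishes at 1 as well, so there is no boundary term, and the subtracted
    constant costs nothing because f has mean zero.\<close>
  define G where "G x = chr (-k) x - 1" for x
  have gc: "continuous_on {0..1} g" unfolding g_def by (intro continuous_intros)
  have G: "G x = set_lebesgue_integral lebesgue {0..x} g" if "x \<in> {0..1}" for x
    using set_integral_vector_derivative [OF has_vector_derivative_chr [of "-k", folded g_def] gc that]
    by (simp add: G_def)
  have "(\<integral>x. f x * G x \<partial>LI) + (\<integral>x. F0 x * g x \<partial>LI) = F0 1 * G 1"
    using f gc G by (intro integration_by_parts_L1) (auto simp: F0_def intro: integrable_LI_continuous)
  moreover have "G 1 = 0" by (simp add: G_def)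
  moreover have "(\<integral>x. f x * G x \<partial>LI) = fc f k"
    using f integrable_mult_chr [OF f, of "-k"] 0 by (simp add: G_def fc_def right_diff_distrib)
  moreover have "(\<integral>x. F0 x * g x \<partial>LI) = (2 * pi * \<i> * of_int (-k)) * fc F0 k"
  proof -
    have "(\<integral>x. F0 x * g x \<partial>LI) = (\<integral>x. (2 * pi * \<i> * of_int (-k)) * (F0 x * chr (-k) x) \<partial>LI)"
      by (simp add: g_def mult_ac)
    then show ?thesis unfolding fc_def by (simp only: integral_mult_right_zero)
  qed
  moreover have "fc F k = fc F0 k"
  proof -
    have "fc F k = fc (\<lambda>x. C + F0 x) k"
      unfolding fc_def by (rule Bochner_Integration.integral_cong) (auto simp: F F0_def)
    also have "\<dots> = fc (\<lambda>x. C) k + fc F0 k"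
      using continuous_on_primitive [OF f]
      by (intro fc_add integrable_LI_continuous) (auto simp: F0_def)
    finally show ?thesis using False by (simp add: fc_const)
  qed
  ultimately show ?thesis by simp
qed

section \<open>Termwise integration of uniformly convergent series\<close>

lemma continuous_on_infsum:
  fixes \<phi> :: "'a \<Rightarrow> real \<Rightarrow> complex"
  assumes s: "s summable_on A" and le: "\<And>a x. a \<in> A \<Longrightarrow> x \<in> S \<Longrightarrow> cmod (\<phi> a x) \<le> s a"
    and c: "\<And>a. a \<in> A \<Longrightarrow> continuous_on S (\<phi> a)"
  shows "continuous_on S (\<lambda>x. \<Sum>\<^sub>\<infinity>a\<in>A. \<phi> a x)"
proof (rule uniform_limit_theorem)
  show "uniform_limit S (\<lambda>X x. \<Sum>a\<in>X. \<phi> a x) (\<lambda>x. \<Sum>\<^sub>\<infinity>a\<in>A. \<phi> a x) (finite_subsets_at_top A)"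
    by (rule Weierstrass_m_test_general [OF le s])
  show "\<forall>\<^sub>F X in finite_subsets_at_top A. continuous_on S (\<lambda>x. \<Sum>a\<in>X. \<phi> a x)"
    by (rule eventually_finite_subsets_at_top_weakI) (auto intro!: continuous_on_sum c)
qed auto

text \<open>Uniform convergence is asked of the continuous factor only; integrated against f, a
  uniform error d contributes at most d times the L1 norm of f.\<close>

lemma has_sum_integral:
  fixes \<phi> :: "'a \<Rightarrow> real \<Rightarrow> complex"
  assumes f: "integrable LI f"
    and s: "s summable_on A" and le: "\<And>a x. a \<in> A \<Longrightarrow> x \<in> {0..1} \<Longrightarrow> cmod (\<phi> a x) \<le> s a"
    and c: "\<And>a. a \<in> A \<Longrightarrow> continuous_on {0..1} (\<phi> a)"
  shows "((\<lambda>a. \<integral>x. f x * \<phi> a x \<partial>LI) has_sum (\<integral>x. f x * (\<Sum>\<^sub>\<infinity>a\<in>A. \<phi> a x) \<partial>LI)) A"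
  unfolding has_sum_def
proof (rule tendstoI)
  fix e :: real assume "e > 0"
  define J where "J = (\<integral>x. cmod (f x) \<partial>LI)"
  have "J \<ge> 0" by (simp add: J_def)
  define d where "d = e / (J + 1)"
  have "d > 0" using \<open>e > 0\<close> \<open>J \<ge> 0\<close> by (simp add: d_def)
  have "uniform_limit {0..1} (\<lambda>X x. \<Sum>a\<in>X. \<phi> a x) (\<lambda>x. \<Sum>\<^sub>\<infinity>a\<in>A. \<phi> a x) (finite_subsets_at_top A)"
    by (rule Weierstrass_m_test_general [OF le s])
  then have "\<forall>\<^sub>F X in finite_subsets_at_top A. \<forall>x\<in>{0..1}. dist (\<Sum>a\<in>X. \<phi> a x) (\<Sum>\<^sub>\<infinity>a\<in>A. \<phi> a x) < d"
    using \<open>d > 0\<close> uniform_limitD by blast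
  moreover have "\<forall>\<^sub>F X in finite_subsets_at_top A. X \<subseteq> A \<and> finite X"
    by (rule eventually_finite_subsets_at_top_weakI) auto
  ultimately show "\<forall>\<^sub>F X in finite_subsets_at_top A.
      dist (\<Sum>a\<in>X. \<integral>x. f x * \<phi> a x \<partial>LI) (\<integral>x. f x * (\<Sum>\<^sub>\<infinity>a\<in>A. \<phi> a x) \<partial>LI) < e"
  proof eventually_elim
    case (elim X)
    have cX: "continuous_on {0..1} (\<lambda>x. \<Sum>a\<in>X. \<phi> a x)" using elim c by (intro continuous_on_sum) auto
    have cA: "continuous_on {0..1} (\<lambda>x. \<Sum>\<^sub>\<infinity>a\<in>A. \<phi> a x)" by (rule continuous_on_infsum [OF s le c])
    have "(\<Sum>a\<in>X. \<integral>x. f x * \<phi> a x \<partial>LI) = (\<integral>x. (\<Sum>a\<in>X. f x * \<phi> a x) \<partial>LI)"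
      using elim c f by (intro Bochner_Integration.integral_sum [symmetric] integrable_LI_mult_continuous) auto
    also have "\<dots> = (\<integral>x. f x * (\<Sum>a\<in>X. \<phi> a x) \<partial>LI)" by (simp add: sum_distrib_left)
    finally have "(\<Sum>a\<in>X. \<integral>x. f x * \<phi> a x \<partial>LI) - (\<integral>x. f x * (\<Sum>\<^sub>\<infinity>a\<in>A. \<phi> a x) \<partial>LI)
        = (\<integral>x. f x * ((\<Sum>a\<in>X. \<phi> a x) - (\<Sum>\<^sub>\<infinity>a\<in>A. \<phi> a x)) \<partial>LI)"
      using integrable_LI_mult_continuous [OF f cX] integrable_LI_mult_continuous [OF f cA]
      by (simp add: right_diff_distrib)
    also have "cmod \<dots> \<le> d * J"
      unfolding J_def using f cX cA elim
      by (intro integral_LI_mult_bound measurable_LI_continuous continuous_on_diff)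
        (auto simp: dist_norm intro: less_imp_le)
    also have "d * J < e" using \<open>J \<ge> 0\<close> \<open>e > 0\<close> by (simp add: d_def field_simps)
    finally show ?case by (simp add: dist_norm)
  qed
qed

subsection \<open>Sums over the nonresonant modes\<close>

lemma infsum_norm_bound:
  fixes f :: "'a \<Rightarrow> 'b::banach"
  assumes h: "h summable_on A" and le: "\<And>i. i \<in> A \<Longrightarrow> norm (f i) \<le> C * h i"
  shows "f summable_on A" "norm (infsum f A) \<le> C * infsum h A"
proof -
  have Ch: "(\<lambda>i. C * h i) summable_on A" using h by (rule summable_on_cmult_right)
  show f: "f summable_on A"
    using Infinite_Sum.abs_summable_on_comparison_test' [OF Ch le] by (rule abs_summable_summable)
  have "norm (infsum f A) \<le> infsum (\<lambda>i. C * h i) A"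
    by (rule norm_infsum_le [OF has_sum_infsum [OF f] has_sum_infsum [OF Ch] le])
  also have "\<dots> = C * infsum h A" by (rule infsum_cmult_right) (use h in auto)
  finally show "norm (infsum f A) \<le> C * infsum h A" .
qed

text \<open>The index i stands for the frequency n - i, so the resonant frequencies n and - n are
  the indices 0 and 2 n, the two zeros of \<open>denom n\<close>.\<close>

definition offres :: "nat \<Rightarrow> int set" where
  "offres n = {i. i \<noteq> 0 \<and> i \<noteq> 2 * int n}"

text \<open>The reciprocal of \<open>denom\<close> without its sign and its factor 4 pi^2. Division
  by zero gives the value 0 at the two resonant indices, which is why \<open>abs_denom\<close> holds
  for all indices.\<close>

definition gap :: "nat \<Rightarrow> int \<Rightarrow> real" where
  "gap n i = 1 / \<bar>of_int i * (2 * real n - of_int i)\<bar>"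

lemma gap_nonneg [simp]: "gap n i \<ge> 0"
  by (simp add: gap_def)

lemma denom_eq: "denom n i = 4 * pi\<^sup>2 * (of_int i * (2 * real n - of_int i))"
  by (simp add: denom_def power2_eq_square algebra_simps)

lemma denom_0 [simp]: "denom n 0 = 0"
  by (simp add: denom_eq)

lemma denom_reflect: "denom n (2 * int n - i) = denom n i"
  by (simp add: denom_eq algebra_simps)

lemma offres_reflect: "i \<in> offres n \<Longrightarrow> 2 * int n - i \<in> offres n"
  by (auto simp: offres_def)

lemma abs_denom: "\<bar>denom n i\<bar> = 4 * pi\<^sup>2 / gap n i"
  by (simp add: denom_eq gap_def abs_mult)

lemma offres_prod_ge:
  assumes "n > 0" "i \<in> offres n"
  shows "real n \<le> \<bar>of_int i * (2 * real n - of_int i)\<bar>"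
proof -
  have 1: "\<bar>i\<bar> \<ge> 1" "\<bar>2 * int n - i\<bar> \<ge> 1" using assms by (auto simp: offres_def)
  have "\<bar>i\<bar> \<ge> int n \<or> \<bar>2 * int n - i\<bar> \<ge> int n" by linarith
  then have "int n \<le> \<bar>i\<bar> * \<bar>2 * int n - i\<bar>"
  proof
    assume "\<bar>i\<bar> \<ge> int n"
    then show ?thesis using mult_mono [of "int n" "\<bar>i\<bar>" 1 "\<bar>2 * int n - i\<bar>"] 1 by simp
  next
    assume "\<bar>2 * int n - i\<bar> \<ge> int n"
    then show ?thesis using mult_mono [of 1 "\<bar>i\<bar>" "int n" "\<bar>2 * int n - i\<bar>"] 1 by simp
  qed
  then have "real_of_int (int n) \<le> real_of_int (\<bar>i\<bar> * \<bar>2 * int n - i\<bar>)" by (simp only: of_int_le_iff)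
  then show ?thesis by (simp add: abs_mult)
qed

lemma gap_pos: "n > 0 \<Longrightarrow> i \<in> offres n \<Longrightarrow> gap n i > 0"
proof -
  assume "n > 0" "i \<in> offres n"
  then have "0 < \<bar>of_int i * (2 * real n - of_int i)\<bar>"
    using offres_prod_ge [of n i] of_nat_0_less_iff [of n, where 'a = real] by linarith
  then show ?thesis unfolding gap_def by (rule divide_pos_pos [OF zero_less_one])
qed

lemma denom_nonzero: "n > 0 \<Longrightarrow> i \<in> offres n \<Longrightarrow> denom n i \<noteq> 0"
  using gap_pos [of n i] abs_denom [of n i] by auto

lemma four_pi_sq: "4 * pi\<^sup>2 \<ge> 36"
  using pi_gt3 power_mono [of 3 pi 2] by simp

lemma inverse_denom_le: 
  assumes "n > 0" "i \<in> offres n"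
  shows "1 / \<bar>denom n i\<bar> \<le> gap n i"
proof -
  have "1 / \<bar>denom n i\<bar> = gap n i * (1 / (4 * pi\<^sup>2))" by (simp add: abs_denom)
  also have "\<dots> \<le> gap n i * 1" using four_pi_sq by (intro mult_left_mono) auto
  finally show ?thesis by simp
qed

text \<open>Since 4 pi^2 \<ge> 36 and i (2 n - i) has modulus at least n, a shift by |\<nu>| \<le> n
  costs at most one part in 36. The same weight \<open>gap\<close> therefore controls the
  denominators with and without \<nu>.\<close>

lemma shifted_denom_ge:
  assumes "n > 0" "i \<in> offres n" "\<bar>\<nu>\<bar> \<le> real n"
  shows "1 \<le> gap n i * \<bar>\<nu> + denom n i\<bar>"
proof -
  define P where "P = of_int i * (2 * real n - of_int i)"
  have P: "real n \<le> \<bar>P\<bar>" using offres_prod_ge [OF assms(1,2)] by (simp add: P_def)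
  have "36 * \<bar>P\<bar> \<le> 4 * pi\<^sup>2 * \<bar>P\<bar>" by (intro mult_right_mono four_pi_sq) auto
  also have "\<dots> = \<bar>denom n i\<bar>" by (simp add: denom_eq P_def abs_mult)
  finally have "\<bar>P\<bar> \<le> \<bar>\<nu> + denom n i\<bar>" using P assms(3) by linarith
  then have "gap n i * \<bar>P\<bar> \<le> gap n i * \<bar>\<nu> + denom n i\<bar>" by (intro mult_left_mono) auto
  moreover have "gap n i * \<bar>P\<bar> = 1"
    using P assms(1) unfolding gap_def P_def [symmetric] by simp
  ultimately show ?thesis by simp
qed

lemma summable_int_powr:
  fixes s :: real
  assumes "s > 1"
  shows "(\<lambda>i::int. \<bar>of_int i\<bar> powr (- s)) summable_on {i. i \<noteq> 0}"
proof -
  have "summable (\<lambda>n. real n powr (- s))" using assms by (simp add: summable_real_powr_iff)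
  then have "(\<lambda>n. real n powr (- s)) summable_on UNIV" by (subst summable_on_UNIV_nonneg_real_iff) auto
  then have N: "(\<lambda>n. real n powr (- s)) summable_on {n. n \<noteq> 0}" by (rule summable_on_subset) auto
  have "((\<lambda>i::int. \<bar>of_int i\<bar> powr (- s)) summable_on {i. i > 0}) \<longleftrightarrow> (\<lambda>n. real n powr (- s)) summable_on {n. n \<noteq> 0}"
    by (rule summable_on_reindex_bij_witness [of _ int nat]) auto
  moreover have "((\<lambda>i::int. \<bar>of_int i\<bar> powr (- s)) summable_on {i. i < 0}) \<longleftrightarrow> (\<lambda>n. real n powr (- s)) summable_on {n. n \<noteq> 0}"
    by (rule summable_on_reindex_bij_witness [of _ "\<lambda>n. - int n" "\<lambda>i. nat (- i)"]) auto
  ultimately have "(\<lambda>i::int. \<bar>of_int i\<bar> powr (- s)) summable_on ({i. i > 0} \<union> {i. i < 0})"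
    using N by (intro summable_on_Un_disjoint) auto
  moreover have "{i::int. i > 0} \<union> {i. i < 0} = {i. i \<noteq> 0}" by auto
  ultimately show ?thesis by simp
qed

text \<open>The point is uniformity in n: the reflection of i to 2 n - i preserves
  \<open>offres n\<close> and carries the second power to the first, so both sums are dominated by
  one sum over all nonzero integers.\<close>

lemma sum_offres_powr_le:
  assumes s: "s > 1" and C: "C \<ge> 0"
    and f0: "\<And>i. i \<in> offres n \<Longrightarrow> 0 \<le> f i"
    and f: "\<And>i. i \<in> offres n \<Longrightarrow> f i \<le> C * (\<bar>of_int i\<bar> powr (- s) + \<bar>2 * real n - of_int i\<bar> powr (- s))"
  shows "f summable_on offres n"
    and "infsum f (offres n) \<le> C * (2 * (\<Sum>\<^sub>\<infinity>i\<in>{i::int. i \<noteq> 0}. \<bar>of_int i\<bar> powr (- s)))"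
proof -
  let ?p = "\<lambda>i::int. \<bar>of_int i\<bar> powr (- s) :: real"
  let ?r = "\<lambda>i::int. \<bar>2 * real n - of_int i\<bar> powr (- s)"
  have sub: "offres n \<subseteq> {i. i \<noteq> 0}" by (auto simp: offres_def)
  have p: "?p summable_on offres n" by (rule summable_on_subset [OF summable_int_powr [OF s] sub])
  have "(?r summable_on offres n) \<longleftrightarrow> ?p summable_on offres n"
    by (rule summable_on_reindex_bij_witness [of _ "\<lambda>i. 2 * int n - i" "\<lambda>i. 2 * int n - i"])
      (auto simp: offres_reflect)
  with p have r: "?r summable_on offres n" by blast
  have "infsum ?r (offres n) = infsum ?p (offres n)"
    by (rule infsum_reindex_bij_witness [of _ "\<lambda>i. 2 * int n - i" "\<lambda>i. 2 * int n - i"])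
      (auto simp: offres_reflect)
  moreover have "infsum ?p (offres n) \<le> infsum ?p {i. i \<noteq> 0}"
    by (rule infsum_mono2 [OF p summable_int_powr [OF s] sub]) auto
  moreover have "infsum (\<lambda>i. ?p i + ?r i) (offres n) = infsum ?p (offres n) + infsum ?r (offres n)"
    by (rule infsum_add [OF p r])
  ultimately have le: "infsum (\<lambda>i. ?p i + ?r i) (offres n) \<le> 2 * infsum ?p {i. i \<noteq> 0}" by simp
  have pr: "(\<lambda>i. ?p i + ?r i) summable_on offres n" by (rule summable_on_add [OF p r])
  have b: "norm (f i) \<le> C * (?p i + ?r i)" if "i \<in> offres n" for i using f0 [OF that] f [OF that] by simp
  show "f summable_on offres n" by (rule infsum_norm_bound(1) [OF pr b])
  have "infsum f (offres n) \<le> C * infsum (\<lambda>i. ?p i + ?r i) (offres n)"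
    using infsum_norm_bound(2) [OF pr b] by simp
  also have "\<dots> \<le> C * (2 * infsum ?p {i. i \<noteq> 0})" by (intro mult_left_mono le C)
  finally show "infsum f (offres n) \<le> C * (2 * infsum ?p {i. i \<noteq> 0})" .
qed

text \<open>The larger factor y is at least N and at least the smaller factor x. Splitting 1 / y
  into the powers - s and - (1 - s) and using one of these bounds for each piece trades summability
  in x against decay in N.\<close>

lemma inverse_prod_le_powr:
  fixes a b N :: real
  assumes "a > 0" "b > 0" "N > 0" "a + b \<ge> 2 * N" "0 \<le> s" "s \<le> 1"
  shows "1 / (a * b) \<le> N powr (- s) * (a powr (- (2 - s)) + b powr (- (2 - s)))"
proof -
  have *: "1 / (x * y) \<le> N powr (- s) * (x powr (- (2 - s)))" if "x > 0" "y \<ge> N" "x \<le> y" for x y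
  proof -
    have "y powr (- s) * y powr (- (1 - s)) = 1 / y"
      using that \<open>N > 0\<close> powr_add [of y "- s" "- (1 - s)"] by (simp add: powr_minus_divide)
    then have "1 / (x * y) = x powr (-1) * (y powr (- s) * y powr (- (1 - s)))"
      using that by (simp add: powr_minus_divide)
    also have "\<dots> \<le> x powr (-1) * (N powr (- s) * x powr (- (1 - s)))"
      using that assms by (intro mult_left_mono mult_mono powr_mono2') auto
    also have "\<dots> = N powr (- s) * (x powr (-1) * x powr (- (1 - s)))" by simp
    also have "x powr (-1) * x powr (- (1 - s)) = x powr (- (2 - s))"
      using powr_add [of x "-1" "- (1 - s)"] by simp
    finally show ?thesis .
  qed
  show ?thesis
  proof (cases "a \<le> b")
    case True
    then have "1 / (a * b) \<le> N powr (- s) * (a powr (- (2 - s)))" using assms by (intro *) auto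
    also have "\<dots> \<le> N powr (- s) * (a powr (- (2 - s)) + b powr (- (2 - s)))"
      by (intro mult_left_mono) auto
    finally show ?thesis .
  next
    case False
    then have "1 / (b * a) \<le> N powr (- s) * (b powr (- (2 - s)))" using assms by (intro *) auto
    also have "\<dots> \<le> N powr (- s) * (a powr (- (2 - s)) + b powr (- (2 - s)))"
      by (intro mult_left_mono) auto
    finally show ?thesis by (simp add: mult.commute)
  qed
qed

lemma gap_le_powr:
  assumes "n > 0" "i \<in> offres n" "0 \<le> s" "s \<le> 1"
  shows "gap n i \<le> real n powr (- s) * (\<bar>of_int i\<bar> powr (- (2 - s)) + \<bar>2 * real n - of_int i\<bar> powr (- (2 - s)))"
proof -
  have "2 * real n - of_int i \<noteq> 0"
    using assms(2) of_int_eq_iff [of "2 * int n" i, where 'a = real] by (simp add: offres_def)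
  then show ?thesis
    unfolding gap_def abs_mult using assms
    by (intro inverse_prod_le_powr) (auto simp: offres_def)
qed

text \<open>The exponent s = 1 extracts the full factor 1 / n but leaves the nonsummable 1 / |i|;
  after squaring this is harmless, so the sum of squares has order n^-2.\<close>

lemma gap_sq_le_powr:
  assumes "n > 0" "i \<in> offres n"
  shows "(gap n i)\<^sup>2 \<le> (2 / (real n)\<^sup>2) * (\<bar>of_int i\<bar> powr (- 2) + \<bar>2 * real n - of_int i\<bar> powr (- 2))"
proof -
  define a b where "a = \<bar>real_of_int i\<bar>" and "b = \<bar>2 * real n - of_int i\<bar>"
  have "2 * real n - of_int i \<noteq> 0"
    using assms(2) of_int_eq_iff [of "2 * int n" i, where 'a = real] by (simp add: offres_def)
  then have ab: "a > 0" "b > 0" using assms by (auto simp: a_def b_def offres_def)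
  have "gap n i \<le> real n powr (- 1) * (a powr (- (2 - 1)) + b powr (- (2 - 1)))"
    using gap_le_powr [OF assms, of 1] by (simp add: a_def b_def)
  also have "\<dots> = (1 / real n) * (1 / a + 1 / b)" using assms ab by (simp add: powr_minus_divide)
  finally have "(gap n i)\<^sup>2 \<le> ((1 / real n) * (1 / a + 1 / b))\<^sup>2" by (intro power_mono) auto
  also have "\<dots> = (1 / (real n)\<^sup>2) * (1 / a + 1 / b)\<^sup>2" by (simp add: power_mult_distrib power_divide)
  also have "\<dots> \<le> (1 / (real n)\<^sup>2) * (2 * ((1 / a)\<^sup>2 + (1 / b)\<^sup>2))"
  proof (intro mult_left_mono)
    show "(1 / a + 1 / b)\<^sup>2 \<le> 2 * ((1 / a)\<^sup>2 + (1 / b)\<^sup>2)"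
      using sum_squares_bound [of "1 / a" "1 / b"] by (simp add: power2_sum)
  qed auto
  also have "\<dots> = (2 / (real n)\<^sup>2) * (a powr (- 2) + b powr (- 2))"
    using ab by (simp add: powr_minus_divide power_divide)
  finally show ?thesis by (simp add: a_def b_def)
qed

definition gap_sum :: "nat \<Rightarrow> real" where "gap_sum n = infsum (gap n) (offres n)"
definition gap_sq_sum :: "nat \<Rightarrow> real" where "gap_sq_sum n = (\<Sum>\<^sub>\<infinity>i\<in>offres n. (gap n i)\<^sup>2)"

lemma summable_gap: "n > 0 \<Longrightarrow> gap n summable_on offres n"
  using gap_le_powr [of n _ "3/4"] by (intro sum_offres_powr_le(1) [of "5/4" "real n powr (- (3/4))"]) auto

lemma summable_gap_sq: "n > 0 \<Longrightarrow> (\<lambda>i. (gap n i)\<^sup>2) summable_on offres n"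
  using gap_sq_le_powr [of n] by (intro sum_offres_powr_le(1) [of 2 "2 / (real n)\<^sup>2"]) auto

lemma gap_sum_nonneg: "gap_sum n \<ge> 0"
  unfolding gap_sum_def by (intro infsum_nonneg) auto

lemma gap_sq_sum_nonneg: "gap_sq_sum n \<ge> 0"
  unfolding gap_sq_sum_def by (intro infsum_nonneg) auto

text \<open>The exponent s = 3/4 leaves the summable power 5/4. Any s strictly between 2/3 and 1
  would serve: s < 1 for summability, and 3 s > 2 so that the cube, which measures the third
  iterate, is o(n^-2).\<close>

lemma gap_sum_le: "\<exists>C>0. \<forall>n>0. gap_sum n \<le> C * real n powr (- (3/4))"
proof -
  define P where "P = (\<Sum>\<^sub>\<infinity>i\<in>{i::int. i \<noteq> 0}. \<bar>of_int i\<bar> powr (- (5/4)) :: real)"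
  have "P \<ge> 0" unfolding P_def by (intro infsum_nonneg) auto
  have "gap_sum n \<le> (2 * P + 1) * real n powr (- (3/4))" if "n > 0" for n
  proof -
    have "gap_sum n \<le> real n powr (- (3/4)) * (2 * P)"
      unfolding gap_sum_def P_def
      using that gap_le_powr [of n _ "3/4"] by (intro sum_offres_powr_le(2)) auto
    also have "\<dots> \<le> (2 * P + 1) * real n powr (- (3/4))" by (simp add: algebra_simps)
    finally show ?thesis .
  qed
  then show ?thesis using \<open>P \<ge> 0\<close> by (intro exI [of _ "2 * P + 1"]) auto
qed

lemma gap_sq_sum_le: "\<exists>C>0. \<forall>n>0. gap_sq_sum n \<le> C / (real n)\<^sup>2"
proof -
  define P where "P = (\<Sum>\<^sub>\<infinity>i\<in>{i::int. i \<noteq> 0}. \<bar>of_int i\<bar> powr (- 2) :: real)"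
  have "P \<ge> 0" unfolding P_def by (intro infsum_nonneg) auto
  have "gap_sq_sum n \<le> (4 * P + 1) / (real n)\<^sup>2" if "n > 0" for n
  proof -
    have "gap_sq_sum n \<le> (2 / (real n)\<^sup>2) * (2 * P)"
      unfolding gap_sq_sum_def P_def
      using that gap_sq_le_powr [of n] by (intro sum_offres_powr_le(2)) auto
    also have "\<dots> \<le> (4 * P + 1) / (real n)\<^sup>2" using that by (simp add: field_simps)
    finally show ?thesis .
  qed
  then show ?thesis using \<open>P \<ge> 0\<close> by (intro exI [of _ "4 * P + 1"]) auto
qed

subsection \<open>Reduction to the two resonant modes\<close>

text \<open>For r = 0 this is the correction to the diagonal entry, for r = 2 n the one to the
  off-diagonal entry, from paths through one nonresonant mode; \<open>red2\<close> collects the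
  paths through two.\<close>

definition red1 :: "(int \<Rightarrow> complex) \<Rightarrow> nat \<Rightarrow> int \<Rightarrow> complex" where
  "red1 c n r = (\<Sum>\<^sub>\<infinity>i\<in>offres n. c i * c (r - i) / of_real (denom n i))"

definition red2 :: "(int \<Rightarrow> complex) \<Rightarrow> nat \<Rightarrow> int \<Rightarrow> complex" where
  "red2 c n r = (\<Sum>\<^sub>\<infinity>i\<in>offres n. c i / of_real (denom n i)
      * (\<Sum>\<^sub>\<infinity>l\<in>offres n. c (l - i) * c (r - l) / of_real (denom n l)))"

lemma infsum_split_offres:
  fixes f :: "int \<Rightarrow> complex"
  assumes "n > 0" "f summable_on UNIV"
  shows "infsum f UNIV = f 0 + f (2 * int n) + infsum f (offres n)"
proof -
  have "UNIV = {0, 2 * int n} \<union> offres n" by (auto simp: offres_def)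
  then have "infsum f UNIV = infsum f ({0, 2 * int n} \<union> offres n)" by simp
  also have "\<dots> = infsum f {0, 2 * int n} + infsum f (offres n)"
    using assms(2) by (intro infsum_Un_disjoint summable_on_subset [OF assms(2)]) (auto simp: offres_def)
  finally show ?thesis using assms(1) by simp
qed

lemma norm_divide_denom_le:
  assumes "n > 0" "i \<in> offres n" "cmod z \<le> B"
  shows "cmod (z / of_real (denom n i)) \<le> B * gap n i"
proof -
  have "cmod (z / of_real (denom n i)) = cmod z * (1 / \<bar>denom n i\<bar>)" by (simp add: norm_divide)
  also have "\<dots> \<le> B * gap n i"
    using assms inverse_denom_le [of n i] by (intro mult_mono) (auto intro: order_trans [OF norm_ge_zero])
  finally show ?thesis .
qed

text \<open>The elimination uses a bounded coefficient sequence, an absolutely summable solution,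
  and a total weight small enough to absorb the nonresonant part. The system is homogeneous, so all
  estimates are relative to \<open>U\<close>, the size of the two resonant entries.\<close>

locale reduction =
  fixes n :: nat and c w :: "int \<Rightarrow> complex" and \<nu> M :: real
  assumes n: "n > 0" and c_le: "\<And>k. cmod (c k) \<le> M" and c0: "c 0 = 0"
    and \<nu>_le: "\<bar>\<nu>\<bar> \<le> real n" and w: "(\<lambda>i. cmod (w i)) summable_on UNIV"
    and eq: "\<And>j. of_real (\<nu> + denom n j) * w j = (\<Sum>\<^sub>\<infinity>i. c (i - j) * w i)"
    and small: "M * gap_sum n \<le> 1 / 2"
begin

definition "U = cmod (w 0) + cmod (w (2 * int n))"
definition "V = (\<Sum>\<^sub>\<infinity>i\<in>offres n. cmod (w i))"
definition "W j = (\<Sum>\<^sub>\<infinity>i\<in>offres n. c (i - j) * w i)"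
text \<open>\<open>X\<close> is the part of w fed directly by the resonant modes and
  \<open>Y\<close> the rest. The division is by \<open>denom\<close> and not by \<nu> +
  \<open>denom\<close>, so that the reduced coefficients do not depend on \<nu>; the price is the
  term with - \<nu> w in \<open>Y\<close>, smaller than the bound for \<open>X\<close> by a factor
  of order |\<nu>| \<open>gap\<close>.\<close>

definition "X i = (c (- i) * w 0 + c (2 * int n - i) * w (2 * int n)) / of_real (denom n i)"
definition "Y i = (W i - of_real \<nu> * w i) / of_real (denom n i)"

lemma M0: "M \<ge> 0" using c_le [of 0] norm_ge_zero order_trans by blast

lemma U0: "U \<ge> 0" by (simp add: U_def)

lemma wI: "(\<lambda>i. cmod (w i)) summable_on offres n"
  by (rule summable_on_subset [OF w]) auto

lemma V0: "V \<ge> 0" unfolding V_def by (intro infsum_nonneg) auto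

lemma cw_le: "cmod (c k * w i) \<le> M * cmod (w i)"
  by (simp add: norm_mult mult_right_mono c_le)

lemma W_le: "cmod (W j) \<le> M * V"
  unfolding W_def V_def by (rule infsum_norm_bound(2) [OF wI cw_le])

lemma eqW: "of_real (\<nu> + denom n j) * w j = c (- j) * w 0 + c (2 * int n - j) * w (2 * int n) + W j"
proof -
  have "(\<lambda>i. c (i - j) * w i) summable_on UNIV" by (rule infsum_norm_bound(1) [OF w cw_le])
  from infsum_split_offres [OF n this] show ?thesis unfolding eq W_def by simp
qed

lemma res_le: "cmod (c j * w 0 + c k * w (2 * int n)) \<le> M * U"
  unfolding U_def distrib_left by (rule order_trans [OF norm_triangle_ineq add_mono]) (rule cw_le)+

lemma w_le: "i \<in> offres n \<Longrightarrow> cmod (w i) \<le> (M * (U + V)) * gap n i"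
proof -
  assume i: "i \<in> offres n"
  have "cmod (w i) \<le> (gap n i * \<bar>\<nu> + denom n i\<bar>) * cmod (w i)"
    using shifted_denom_ge [OF n i \<nu>_le] mult_right_mono [of 1 _ "cmod (w i)"] by simp
  also have "\<dots> = gap n i * cmod (of_real (\<nu> + denom n i) * w i)" by (simp add: norm_mult del: of_real_add)
  also have "\<dots> \<le> gap n i * (M * U + M * V)"
    unfolding eqW by (intro mult_left_mono order_trans [OF norm_triangle_ineq add_mono] res_le W_le) auto
  finally show "cmod (w i) \<le> (M * (U + V)) * gap n i" by (simp add: algebra_simps)
qed

text \<open>Summing \<open>w_le\<close> bounds V by U + V times a coefficient that is at most 1/2,
  and absorption gives V \<le> U. Feeding this back into the first bound recovers the factor
  \<open>gap_sum\<close>.\<close>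

lemma V_le: "V \<le> M * (U + V) * gap_sum n" "V \<le> U" "V \<le> 2 * M * gap_sum n * U"
proof -
  have "norm V \<le> M * (U + V) * gap_sum n"
    unfolding V_def gap_sum_def
    by (rule infsum_norm_bound(2) [OF summable_gap [OF n]]) (use w_le in \<open>simp add: V_def\<close>)
  then show 1: "V \<le> M * (U + V) * gap_sum n" using V0 by simp
  have "(M * gap_sum n) * (U + V) \<le> (1 / 2) * (U + V)"
    using U0 V0 small by (intro mult_right_mono) auto
  with 1 have "V \<le> (1/2) * (U + V)" by (simp add: algebra_simps)
  then show 2: "V \<le> U" by simp
  have "M * (U + V) * gap_sum n \<le> M * (U + U) * gap_sum n"
    using 2 M0 gap_sum_nonneg by (intro mult_right_mono mult_left_mono) auto
  with 1 show "V \<le> 2 * M * gap_sum n * U" by (simp add: algebra_simps)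
qed

lemma w_le': "i \<in> offres n \<Longrightarrow> cmod (w i) \<le> (2 * M * U) * gap n i"
proof -
  assume "i \<in> offres n"
  then have "cmod (w i) \<le> (M * (U + V)) * gap n i" by (rule w_le)
  also have "\<dots> \<le> (M * (U + U)) * gap n i"
    using V_le M0 by (intro mult_right_mono mult_left_mono) auto
  finally show "cmod (w i) \<le> (2 * M * U) * gap n i" by (simp add: algebra_simps)
qed

text \<open>The crude elimination. At index 0 both \<open>denom\<close> and c 0 vanish, so only the
  coupling to 2 n and the nonresonant sum remain. It serves to bound \<nu> itself.\<close>

lemma first_order: "cmod (of_real \<nu> * w 0 - c (2 * int n) * w (2 * int n)) \<le> 2 * M\<^sup>2 * gap_sum n * U"
proof -
  have "of_real \<nu> * w 0 - c (2 * int n) * w (2 * int n) = W 0" using eqW [of 0] by (simp add: c0)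
  moreover have "M * V \<le> M * (2 * M * gap_sum n * U)" using V_le M0 by (intro mult_left_mono) auto
  ultimately show ?thesis using W_le [of 0] by (simp add: power2_eq_square mult_ac)
qed

lemma w_eq: "i \<in> offres n \<Longrightarrow> w i = X i + Y i"
proof -
  assume "i \<in> offres n"
  then have d: "complex_of_real (denom n i) \<noteq> 0" using denom_nonzero [OF n] by simp
  have "c (- i) * w 0 + c (2 * int n - i) * w (2 * int n) + (W i - of_real \<nu> * w i) = of_real (denom n i) * w i"
    using eqW [of i] by (simp add: algebra_simps)
  then have "X i + Y i = of_real (denom n i) * w i / of_real (denom n i)"
    unfolding X_def Y_def by (simp flip: add_divide_distrib)
  then show ?thesis using d by simp
qed

lemma X_le: "i \<in> offres n \<Longrightarrow> cmod (X i) \<le> (M * U) * gap n i"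
  unfolding X_def by (rule norm_divide_denom_le [OF n _ res_le])

lemma Y_le: "i \<in> offres n \<Longrightarrow> cmod (Y i) \<le> (M * V) * gap n i + (\<bar>\<nu>\<bar> * (2 * M * U)) * (gap n i)\<^sup>2"
proof -
  assume i: "i \<in> offres n"
  have "cmod (W i - of_real \<nu> * w i) \<le> M * V + \<bar>\<nu>\<bar> * ((2 * M * U) * gap n i)"
    by (intro order_trans [OF norm_triangle_ineq4 add_mono] W_le)
      (use w_le' [OF i] in \<open>simp add: norm_mult mult_left_mono\<close>)
  from norm_divide_denom_le [OF n i this]
  show ?thesis by (simp add: Y_def power2_eq_square algebra_simps)
qed

lemma cgap_le: "cmod (c k * f) \<le> M * B" if "cmod f \<le> B"
  using that M0 c_le [of k] by (simp add: norm_mult mult_mono)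

text \<open>An l1 bound for \<open>Y\<close> over the nonresonant modes; with the bound for V its
  first summand becomes quadratic in \<open>gap_sum\<close>.\<close>

definition "err = M * V * gap_sum n + (\<bar>\<nu>\<bar> * (2 * M * U)) * gap_sq_sum n"

lemma Y_sum:
  "(\<lambda>i. c (k i) * Y i) summable_on offres n" "cmod (\<Sum>\<^sub>\<infinity>i\<in>offres n. c (k i) * Y i) \<le> M * err"
proof -
  let ?h = "\<lambda>i. (M * V) * gap n i + (\<bar>\<nu>\<bar> * (2 * M * U)) * (gap n i)\<^sup>2"
  have h: "?h summable_on offres n"
    by (intro summable_on_add summable_on_cmult_right summable_gap summable_gap_sq n)
  have b: "cmod (c (k i) * Y i) \<le> M * ?h i" if "i \<in> offres n" for i by (rule cgap_le [OF Y_le [OF that]])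
  show "(\<lambda>i. c (k i) * Y i) summable_on offres n" by (rule infsum_norm_bound(1) [OF h b])
  have "infsum ?h (offres n) = err"
    unfolding err_def gap_sum_def gap_sq_sum_def
    by (simp add: infsum_add infsum_cmult_right' summable_on_cmult_right summable_gap summable_gap_sq n)
  then show "cmod (\<Sum>\<^sub>\<infinity>i\<in>offres n. c (k i) * Y i) \<le> M * err"
    using infsum_norm_bound(2) [OF h b] by simp
qed

lemma X_sum: "(\<lambda>i. c (k i) * X i) summable_on offres n"
proof (rule infsum_norm_bound(1) [OF summable_gap [OF n]])
  fix i assume "i \<in> offres n"
  from cgap_le [OF X_le [OF this]] show "cmod (c (k i) * X i) \<le> (M * (M * U)) * gap n i"
    by (simp add: mult.assoc)
qed

lemma W_eq: "W j = (\<Sum>\<^sub>\<infinity>i\<in>offres n. c (i - j) * X i) + (\<Sum>\<^sub>\<infinity>i\<in>offres n. c (i - j) * Y i)"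
proof -
  have "W j = (\<Sum>\<^sub>\<infinity>i\<in>offres n. c (i - j) * X i + c (i - j) * Y i)"
    unfolding W_def by (rule infsum_cong) (simp add: w_eq distrib_left)
  also have "\<dots> = (\<Sum>\<^sub>\<infinity>i\<in>offres n. c (i - j) * X i) + (\<Sum>\<^sub>\<infinity>i\<in>offres n. c (i - j) * Y i)"
    by (rule infsum_add [OF X_sum Y_sum(1)])
  finally show ?thesis .
qed

lemma coeff_sum: "(\<lambda>l. c (k l) * c (r l) / of_real (denom n l)) summable_on offres n"
  "cmod (\<Sum>\<^sub>\<infinity>l\<in>offres n. c (k l) * c (r l) / of_real (denom n l)) \<le> M\<^sup>2 * gap_sum n"
proof -
  have b: "cmod (c (k l) * c (r l) / of_real (denom n l)) \<le> M\<^sup>2 * gap n l" if "l \<in> offres n" for l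
    by (rule norm_divide_denom_le [OF n that]) (use cgap_le [OF c_le] in \<open>simp add: power2_eq_square\<close>)
  show "(\<lambda>l. c (k l) * c (r l) / of_real (denom n l)) summable_on offres n"
    "cmod (\<Sum>\<^sub>\<infinity>l\<in>offres n. c (k l) * c (r l) / of_real (denom n l)) \<le> M\<^sup>2 * gap_sum n"
    unfolding gap_sum_def
    by (rule infsum_norm_bound(1) [OF summable_gap [OF n] b], assumption)
       (rule infsum_norm_bound(2) [OF summable_gap [OF n] b])
qed

lemma X_sum_eq: "(\<Sum>\<^sub>\<infinity>l\<in>offres n. c (l - i) * X l) =
    (\<Sum>\<^sub>\<infinity>l\<in>offres n. c (l - i) * c (- l) / of_real (denom n l)) * w 0 +
    (\<Sum>\<^sub>\<infinity>l\<in>offres n. c (l - i) * c (2 * int n - l) / of_real (denom n l)) * w (2 * int n)"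
proof -
  have "(\<Sum>\<^sub>\<infinity>l\<in>offres n. c (l - i) * X l) = (\<Sum>\<^sub>\<infinity>l\<in>offres n.
      c (l - i) * c (- l) / of_real (denom n l) * w 0 +
      c (l - i) * c (2 * int n - l) / of_real (denom n l) * w (2 * int n))"
    by (rule infsum_cong) (simp add: X_def add_divide_distrib distrib_left mult_ac)
  also have "\<dots> = (\<Sum>\<^sub>\<infinity>l\<in>offres n. c (l - i) * c (- l) / of_real (denom n l) * w 0) +
      (\<Sum>\<^sub>\<infinity>l\<in>offres n. c (l - i) * c (2 * int n - l) / of_real (denom n l) * w (2 * int n))"
    by (intro infsum_add summable_on_cmult_left coeff_sum)
  finally show ?thesis unfolding infsum_cmult_left' .
qed

lemma c_denom_sum:
  assumes "\<And>i. cmod (f i) \<le> B"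
  shows "(\<lambda>i. c i / of_real (denom n i) * f i) summable_on offres n"
    "cmod (\<Sum>\<^sub>\<infinity>i\<in>offres n. c i / of_real (denom n i) * f i) \<le> M * B * gap_sum n"
proof -
  have b: "cmod (c i / of_real (denom n i) * f i) \<le> M * B * gap n i" if "i \<in> offres n" for i
    using norm_divide_denom_le [OF n that cgap_le [OF assms]] by simp
  show "(\<lambda>i. c i / of_real (denom n i) * f i) summable_on offres n"
    "cmod (\<Sum>\<^sub>\<infinity>i\<in>offres n. c i / of_real (denom n i) * f i) \<le> M * B * gap_sum n"
    unfolding gap_sum_def
    by (rule infsum_norm_bound(1) [OF summable_gap [OF n] b], assumption)
       (rule infsum_norm_bound(2) [OF summable_gap [OF n] b])
qed

text \<open>Writing w = X + Y inside \<open>W\<close> produces \<open>red2\<close> from the X part.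
  The Y part is of size \<open>err\<close> and gains one more \<open>gap_sum\<close> from the outer
  sum.\<close>

lemma cW_sum: "\<exists>r. (\<Sum>\<^sub>\<infinity>i\<in>offres n. c i / of_real (denom n i) * W i)
    = red2 c n 0 * w 0 + red2 c n (2 * int n) * w (2 * int n) + r \<and> cmod r \<le> M\<^sup>2 * gap_sum n * err"
proof -
  define S where "S r i = (\<Sum>\<^sub>\<infinity>l\<in>offres n. c (l - i) * c (r - l) / of_real (denom n l))" for r i
  define E where "E i = (\<Sum>\<^sub>\<infinity>l\<in>offres n. c (l - i) * Y l)" for i
  have S: "cmod (S r i) \<le> M\<^sup>2 * gap_sum n" for r i unfolding S_def by (rule coeff_sum)
  have E: "cmod (E i) \<le> M * err" for i unfolding E_def by (rule Y_sum)
  let ?d = "\<lambda>i. c i / of_real (denom n i)"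
  have "(\<Sum>\<^sub>\<infinity>i\<in>offres n. ?d i * W i)
      = (\<Sum>\<^sub>\<infinity>i\<in>offres n. (?d i * S 0 i * w 0 + ?d i * S (2 * int n) i * w (2 * int n)) + ?d i * E i)"
    by (rule infsum_cong) (simp add: W_eq X_sum_eq S_def E_def algebra_simps)
  also have "\<dots> = ((\<Sum>\<^sub>\<infinity>i\<in>offres n. ?d i * S 0 i * w 0)
      + (\<Sum>\<^sub>\<infinity>i\<in>offres n. ?d i * S (2 * int n) i * w (2 * int n))) + (\<Sum>\<^sub>\<infinity>i\<in>offres n. ?d i * E i)"
    by (simp only: infsum_add summable_on_add summable_on_cmult_left c_denom_sum [OF S] c_denom_sum [OF E])
  also have "\<dots> = red2 c n 0 * w 0 + red2 c n (2 * int n) * w (2 * int n) + (\<Sum>\<^sub>\<infinity>i\<in>offres n. ?d i * E i)"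
    unfolding infsum_cmult_left' red2_def S_def by simp
  finally show ?thesis
    using c_denom_sum(2) [of E, OF E]
    by (intro exI conjI) (assumption, simp add: power2_eq_square mult_ac)
qed

lemma err_le: "err \<le> (2 * M\<^sup>2 * (gap_sum n)\<^sup>2 + 2 * M * \<bar>\<nu>\<bar> * gap_sq_sum n) * U"
proof -
  have "M * V * gap_sum n \<le> M * (2 * M * gap_sum n * U) * gap_sum n"
    using V_le M0 gap_sum_nonneg by (intro mult_right_mono mult_left_mono) auto
  then show ?thesis by (simp add: err_def power2_eq_square algebra_simps)
qed

lemma cY_sum: "\<exists>r. (\<Sum>\<^sub>\<infinity>i\<in>offres n. c i * Y i)
    = red2 c n 0 * w 0 + red2 c n (2 * int n) * w (2 * int n) + r
      \<and> cmod r \<le> M\<^sup>2 * gap_sum n * err + 2 * M\<^sup>2 * \<bar>\<nu>\<bar> * gap_sq_sum n * U"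
proof -
  let ?d = "\<lambda>i. c i / of_real (denom n i)"
  have b: "cmod (?d i * w i) \<le> (2 * M\<^sup>2 * U) * (gap n i)\<^sup>2" if "i \<in> offres n" for i
    using norm_divide_denom_le [OF n that cgap_le [OF w_le' [OF that], of i]]
    by (simp add: power2_eq_square mult_ac)
  note s = infsum_norm_bound [OF summable_gap_sq [OF n] b]
  have "(\<Sum>\<^sub>\<infinity>i\<in>offres n. c i * Y i) = (\<Sum>\<^sub>\<infinity>i\<in>offres n. ?d i * W i + (- of_real \<nu>) * (?d i * w i))"
    by (rule infsum_cong) (simp add: Y_def diff_divide_distrib right_diff_distrib mult_ac)
  also have "\<dots> = (\<Sum>\<^sub>\<infinity>i\<in>offres n. ?d i * W i) + (- of_real \<nu>) * (\<Sum>\<^sub>\<infinity>i\<in>offres n. ?d i * w i)"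
    unfolding infsum_cmult_right' [symmetric]
    by (intro infsum_add summable_on_cmult_right s(1) c_denom_sum(1) [OF W_le])
  finally have 1: "(\<Sum>\<^sub>\<infinity>i\<in>offres n. c i * Y i)
      = (\<Sum>\<^sub>\<infinity>i\<in>offres n. ?d i * W i) + (- of_real \<nu>) * (\<Sum>\<^sub>\<infinity>i\<in>offres n. ?d i * w i)" .
  obtain r where r: "(\<Sum>\<^sub>\<infinity>i\<in>offres n. ?d i * W i)
    = red2 c n 0 * w 0 + red2 c n (2 * int n) * w (2 * int n) + r" "cmod r \<le> M\<^sup>2 * gap_sum n * err"
    using cW_sum by blast
  have "cmod ((- of_real \<nu>) * (\<Sum>\<^sub>\<infinity>i\<in>offres n. ?d i * w i)) \<le> \<bar>\<nu>\<bar> * ((2 * M\<^sup>2 * U) * gap_sq_sum n)"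
    using s(2) by (simp add: norm_mult gap_sq_sum_def mult_left_mono)
  then have "cmod (r + (- of_real \<nu>) * (\<Sum>\<^sub>\<infinity>i\<in>offres n. ?d i * w i))
      \<le> M\<^sup>2 * gap_sum n * err + 2 * M\<^sup>2 * \<bar>\<nu>\<bar> * gap_sq_sum n * U"
    using norm_triangle_le [OF add_mono [OF r(2)],
        of "(- of_real \<nu>) * (\<Sum>\<^sub>\<infinity>i\<in>offres n. ?d i * w i)" "\<bar>\<nu>\<bar> * ((2 * M\<^sup>2 * U) * gap_sq_sum n)"]
    by (simp only: mult_ac)
  then show ?thesis using 1 r(1) by (intro exI [of _ "r + (- of_real \<nu>) * (\<Sum>\<^sub>\<infinity>i\<in>offres n. ?d i * w i)"]) simp
qed

text \<open>The bound consists of the third iterate, cubic in \<open>gap_sum\<close>, and of the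
  cost of keeping \<nu> out of the denominators, which carries |\<nu>| \<open>gap_sq_sum\<close>.
  The latter is o(n^-2) once \<nu> is known to tend to 0.\<close>

lemma second_order:
  "cmod (of_real \<nu> * w 0 - (red1 c n 0 + red2 c n 0) * w 0
      - (c (2 * int n) + red1 c n (2 * int n) + red2 c n (2 * int n)) * w (2 * int n))
   \<le> (2 * M ^ 4 * gap_sum n ^ 3 + 2 * M\<^sup>2 * gap_sq_sum n * (1 + M * gap_sum n) * \<bar>\<nu>\<bar>) * U"
proof -
  have "of_real \<nu> * w 0 = c (2 * int n) * w (2 * int n) + W 0" using eqW [of 0] by (simp add: c0)
  moreover have "W 0 = red1 c n 0 * w 0 + red1 c n (2 * int n) * w (2 * int n) + (\<Sum>\<^sub>\<infinity>i\<in>offres n. c i * Y i)"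
    using W_eq [of 0] X_sum_eq [of 0] by (simp add: red1_def)
  moreover obtain r where r: "(\<Sum>\<^sub>\<infinity>i\<in>offres n. c i * Y i)
    = red2 c n 0 * w 0 + red2 c n (2 * int n) * w (2 * int n) + r"
    and r_le: "cmod r \<le> M\<^sup>2 * gap_sum n * err + 2 * M\<^sup>2 * \<bar>\<nu>\<bar> * gap_sq_sum n * U"
    using cY_sum by blast
  ultimately have *: "of_real \<nu> * w 0 - (red1 c n 0 + red2 c n 0) * w 0
      - (c (2 * int n) + red1 c n (2 * int n) + red2 c n (2 * int n)) * w (2 * int n) = r"
    by (simp add: algebra_simps)
  have "M\<^sup>2 * gap_sum n * err
      \<le> M\<^sup>2 * gap_sum n * ((2 * M\<^sup>2 * (gap_sum n)\<^sup>2 + 2 * M * \<bar>\<nu>\<bar> * gap_sq_sum n) * U)"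
    using err_le gap_sum_nonneg by (intro mult_left_mono) auto
  with r_le show ?thesis unfolding * by (simp add: algebra_simps power2_eq_square power3_eq_cube power4_eq_xxxx)
qed

end

subsection \<open>Coefficients of the reduced system\<close>

lemma fc_mult_series:
  assumes f: "integrable LI f" and a: "(\<lambda>i. cmod (a i)) summable_on A"
  shows "((\<lambda>i. a i * fc f (k - i)) has_sum fc (\<lambda>x. f x * (\<Sum>\<^sub>\<infinity>i\<in>A. a i * chr i x)) k) A"
proof -
  have "((\<lambda>i. \<integral>x. (f x * chr (- k) x) * (a i * chr i x) \<partial>LI) has_sum
      (\<integral>x. (f x * chr (- k) x) * (\<Sum>\<^sub>\<infinity>i\<in>A. a i * chr i x) \<partial>LI)) A"
    by (rule has_sum_integral [OF integrable_mult_chr [OF f] a])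
      (auto simp: norm_mult intro!: continuous_intros)
  moreover have "(\<integral>x. (f x * chr (- k) x) * (a i * chr i x) \<partial>LI) = a i * fc f (k - i)" for i
  proof -
    have "(f x * chr (- k) x) * (a i * chr i x) = a i * (f x * chr (- (k - i)) x)" for x
      using chr_add [of "-k" i x] by (simp add: algebra_simps)
    then show ?thesis unfolding fc_def by (simp only: integral_mult_right_zero)
  qed
  moreover have "(\<integral>x. (f x * chr (- k) x) * (\<Sum>\<^sub>\<infinity>i\<in>A. a i * chr i x) \<partial>LI)
      = fc (\<lambda>x. f x * (\<Sum>\<^sub>\<infinity>i\<in>A. a i * chr i x)) k"
    unfolding fc_def by (rule Bochner_Integration.integral_cong) auto
  ultimately show ?thesis by (simp only:)
qed

lemma series_continuous:
  assumes "(\<lambda>i. cmod (a i)) summable_on A"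
  shows "continuous_on S (\<lambda>x. \<Sum>\<^sub>\<infinity>i\<in>A. a i * chr i x)"
  by (rule continuous_on_infsum [OF assms]) (auto simp: norm_mult intro!: continuous_intros)

lemma fc_series:
  assumes a: "(\<lambda>i. cmod (a i)) summable_on A"
  shows "fc (\<lambda>x. \<Sum>\<^sub>\<infinity>i\<in>A. a i * chr i x) k = (if k \<in> A then a k else 0)"
proof -
  have "integrable LI (\<lambda>x. 1::complex)" by (intro integrable_LI_continuous continuous_intros)
  from fc_mult_series [OF this a, of k]
  have "((\<lambda>i. a i * fc (\<lambda>x. 1) (k - i)) has_sum fc (\<lambda>x. \<Sum>\<^sub>\<infinity>i\<in>A. a i * chr i x) k) A" by simp
  then have "fc (\<lambda>x. \<Sum>\<^sub>\<infinity>i\<in>A. a i * chr i x) k = (\<Sum>\<^sub>\<infinity>i\<in>A. a i * fc (\<lambda>x. 1) (k - i))"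
    by (simp add: has_sum_iff)
  also have "\<dots> = (\<Sum>\<^sub>\<infinity>i\<in>A \<inter> {k}. a i)"
    by (rule infsum_cong_neutral) (auto simp: fc_const)
  also have "\<dots> = (if k \<in> A then a k else 0)" by simp
  finally show ?thesis .
qed

section \<open>Closed form and sup norm of the kernel with coefficients
  \<open>1 / denom\<close>\<close>

lemma fc_sawtooth: "fc (\<lambda>x. of_real (1 / 2 - x)) k = (if k = 0 then 0 else 1 / (2 * pi * \<i> * of_int k))"
proof -
  have cont: "continuous_on {0..1} (\<lambda>x. complex_of_real (1 / 2 - x) * chr (- k) x)"
    by (intro continuous_intros)
  have I: "fc (\<lambda>x. of_real (1 / 2 - x)) k = integral {0..1} (\<lambda>x. complex_of_real (1 / 2 - x) * chr (- k) x)"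
    unfolding fc_def by (rule integral_LI_eq [OF integrable_LI_continuous [OF cont]])
  show ?thesis
  proof (cases "k = 0")
    case True
    have "((\<lambda>x. complex_of_real (1 / 2 - x)) has_integral
        complex_of_real (1 / 2 - 1\<^sup>2 / 2) - complex_of_real (0 / 2 - 0\<^sup>2 / 2)) {0..1}"
      by (intro fundamental_theorem_of_calculus [where f = "\<lambda>x. complex_of_real (x / 2 - x\<^sup>2 / 2)"])
        (auto intro!: derivative_eq_intros
          simp: has_vector_derivative_def scaleR_conv_of_real fun_eq_iff algebra_simps)
    then show ?thesis using True unfolding I by (simp add: integral_unique)
  next
    case False
    define m where "m = 2 * pi * \<i> * of_int (- k)"
    have m: "m \<noteq> 0" using False by (simp add: m_def)
    define P where "P x = (complex_of_real (1 / 2 - x) / m + 1 / m\<^sup>2) * chr (- k) x" for x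
    have "((\<lambda>x. complex_of_real (1 / 2 - x) * chr (- k) x) has_integral P 1 - P 0) {0..1}"
    proof (rule fundamental_theorem_of_calculus)
      fix x :: real
      have 1: "((\<lambda>x. complex_of_real (1 / 2 - x) / m + 1 / m\<^sup>2) has_vector_derivative - (1 / m)) (at x within {0..1})"
        unfolding has_vector_derivative_def
        using m by (auto intro!: derivative_eq_intros simp: scaleR_conv_of_real)
      have 2: "(chr (- k) has_vector_derivative m * chr (- k) x) (at x within {0..1})"
        unfolding m_def by (rule has_vector_derivative_chr)
      have "(P has_vector_derivative
          (complex_of_real (1 / 2 - x) / m + 1 / m\<^sup>2) * (m * chr (- k) x) + (- (1 / m)) * chr (- k) x) (at x within {0..1})"
        unfolding P_def by (rule has_vector_derivative_mult [OF 1 2])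
      moreover have "(complex_of_real (1 / 2 - x) / m + 1 / m\<^sup>2) * (m * chr (- k) x) + (- (1 / m)) * chr (- k) x
          = complex_of_real (1 / 2 - x) * chr (- k) x"
        using m by (simp add: field_simps power2_eq_square)
      ultimately show "(P has_vector_derivative complex_of_real (1 / 2 - x) * chr (- k) x) (at x within {0..1})"
        by simp
    qed simp
    moreover have "P 1 - P 0 = - 1 / m" by (simp add: P_def flip: diff_divide_distrib)
    ultimately show ?thesis using False unfolding I by (simp add: integral_unique m_def)
  qed
qed

lemma abs_summable_inverse_denom:
  assumes "n > 0" "\<And>i. i \<in> offres n \<Longrightarrow> cmod (a i) \<le> B"
  shows "(\<lambda>i. cmod (a i / of_real (denom n i))) summable_on offres n"
  using infsum_norm_bound(1) [OF summable_gap [OF assms(1)], of "\<lambda>i. cmod (a i / of_real (denom n i))" B]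
    norm_divide_denom_le [OF assms(1) _ assms(2)] by simp

definition kernel :: "nat \<Rightarrow> real \<Rightarrow> complex" where
  "kernel n x = (\<Sum>\<^sub>\<infinity>i\<in>offres n. 1 / of_real (denom n i) * chr i x)"

lemma summable_inverse_denom: "n > 0 \<Longrightarrow> (\<lambda>i. cmod (1 / of_real (denom n i))) summable_on offres n"
  by (rule abs_summable_inverse_denom [where B = 1]) auto

text \<open>Partial fractions: 1 / (i (2 n - i)) is 1 / (2 n) times 1 / i + 1 / (2 n - i), and up to
  constants these are the coefficients of the sawtooth 1/2 - x and of its modulation by
  \<open>chr (2 * int n)\<close>. The last bracket removes the coefficients at the two resonant
  indices. The sawtooth jumps at the end points, but its product with
  \<open>1 - chr (2 * int n) x\<close> vanishes there, so uniqueness for continuous periodic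
  functions applies.\<close>

lemma kernel_eq:
  assumes n: "n > 0" and x: "x \<in> {0..1}"
  shows "kernel n x = of_real (1 / (8 * pi\<^sup>2 * real n)) * (2 * pi * \<i> * (of_real (1 / 2 - x) - of_real (1 / 2 - x) * chr (2 * int n) x)
      - 1 / (2 * of_nat n) * (1 + chr (2 * int n) x))"
    (is "_ = ?E x")
proof (rule fourier_unique [OF _ _ _ _ _ x])
  show "continuous_on {0..1} (kernel n)"
    unfolding kernel_def by (rule series_continuous [OF summable_inverse_denom [OF n]])
  show "kernel n 1 = kernel n 0" by (simp add: kernel_def)
  show "continuous_on {0..1} ?E" by (intro continuous_intros)
  show "?E 1 = ?E 0" by simp
  fix k
  let ?w = "\<lambda>x. complex_of_real (1 / 2 - x)"
  have i1: "integrable LI ?w" by (intro integrable_LI_continuous continuous_intros)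
  have i2: "integrable LI (\<lambda>x. ?w x * chr (2 * int n) x)" by (rule integrable_mult_chr [OF i1])
  have i3: "integrable LI (\<lambda>x. 1::complex)" "integrable LI (chr (2 * int n))"
    by (intro integrable_LI_continuous continuous_intros)+
  have E: "fc ?E k = of_real (1 / (8 * pi\<^sup>2 * real n)) * (2 * pi * \<i> * (fc ?w k - fc ?w (k - 2 * int n))
      - 1 / (2 * of_nat n) * (fc (\<lambda>x. 1) k + fc (chr (2 * int n)) k))"
    by (subst fc_cmult, subst fc_diff, use i1 i2 i3 in simp, use i1 i2 i3 in simp,
        subst fc_cmult, subst fc_diff [OF i1 i2], subst fc_cmult, subst fc_add [OF i3],
        subst fc_mult_chr) (rule refl)
  have K: "fc (kernel n) k = (if k \<in> offres n then 1 / of_real (denom n k) else 0)"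
    unfolding kernel_def by (rule fc_series [OF summable_inverse_denom [OF n]])
  consider "k = 0" | "k = 2 * int n" | "k \<in> offres n" by (auto simp: offres_def)
  then show "fc (kernel n) k = fc ?E k"
  proof cases
    case 1
    then show ?thesis using n unfolding K E fc_sawtooth fc_const fc_chr by (simp add: offres_def)
  next
    case 2
    then show ?thesis using n unfolding K E fc_sawtooth fc_const fc_chr by (simp add: offres_def)
  next
    case 3
    then have k: "k \<noteq> 0" "k - 2 * int n \<noteq> 0" "k \<noteq> 2 * int n" by (auto simp: offres_def)
    have z: "complex_of_int k \<noteq> 0" "complex_of_int (k - 2 * int n) \<noteq> 0" using k by (simp_all only: of_int_eq_0_iff not_False_eq_True)
    define a b where "a = complex_of_int k" and "b = complex_of_int (k - 2 * int n)"
    have ab: "a \<noteq> 0" "b \<noteq> 0" "2 * of_nat n - a = - b" "a - b = 2 * of_nat n" using z by (simp_all add: a_def b_def)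
    have "fc ?E k = of_real (1 / (8 * pi\<^sup>2 * real n)) * (2 * pi * \<i> * (1 / (2 * pi * \<i> * a) - 1 / (2 * pi * \<i> * b)))"
      unfolding E fc_sawtooth fc_const fc_chr using k by (simp add: a_def b_def)
    also have "2 * pi * \<i> * (1 / (2 * pi * \<i> * a) - 1 / (2 * pi * \<i> * b)) = 1 / a - 1 / b"
      using ab by (simp add: right_diff_distrib)
    also have "1 / a - 1 / b = (b - a) / (a * b)" using ab by (simp add: field_simps)
    also have "b - a = - (2 * of_nat n)" using ab(4) by (simp add: algebra_simps)
    finally have "fc ?E k = of_real (1 / (8 * pi\<^sup>2 * real n)) * (- (2 * of_nat n) / (a * b))" .
    also have "\<dots> = 1 / (4 * pi\<^sup>2 * (a * (- b)))"
    proof -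
      have "1 / (8 * P * N) * (- (2 * N) / (a * b)) = 1 / (4 * P * (a * (- b)))"
        if "P \<noteq> 0" "N \<noteq> 0" for P N :: complex
        using that ab(1,2) by (simp add: divide_simps)
      from this [of "of_real (pi\<^sup>2)" "of_nat n"] show ?thesis using n by simp
    qed
    also have "\<dots> = 1 / of_real (denom n k)" unfolding ab(3) [symmetric] by (simp add: denom_eq a_def)
    finally show ?thesis using 3 by (simp add: K)
  qed
qed

lemma chr_frac: "chr k (frac x) = chr k x"
proof -
  have "chr k (frac x) = chr k x * cis (2 * pi * of_int (- (k * \<lfloor>x\<rfloor>)))"
    by (simp add: chr_def frac_def cis_mult algebra_simps)
  also have "cis (2 * pi * of_int (- (k * \<lfloor>x\<rfloor>))) = 1" by (rule cis_multiple_2pi) simp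
  finally show ?thesis by simp
qed

text \<open>In closed form everything besides the prefactor 1 / (8 pi^2 n) is bounded by 8 pi^2,
  whereas absolute summation of the series would lose a logarithm. The convolution evaluates the
  kernel outside the unit interval too, hence the passage to \<open>frac\<close>.\<close>

lemma kernel_le:
  assumes n: "n > 0"
  shows "cmod (kernel n x) \<le> 1 / real n"
proof -
  define y where "y = frac x"
  have y: "y \<in> {0..1}" using frac_ge_0 [of x] frac_lt_1 [of x] by (simp add: y_def)
  have "kernel n x = kernel n y" by (simp add: kernel_def y_def chr_frac)
  also have "kernel n y = of_real (1 / (8 * pi\<^sup>2 * real n)) *
      (2 * pi * \<i> * (of_real (1 / 2 - y) * (1 - chr (2 * int n) y)) - 1 / (2 * of_nat n) * (1 + chr (2 * int n) y))"
    unfolding kernel_eq [OF n y] by (simp only: right_diff_distrib mult_1_right)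
  also have "cmod \<dots> = 1 / (8 * pi\<^sup>2 * n) * cmod (2 * pi * \<i> * (of_real (1 / 2 - y) * (1 - chr (2 * int n) y))
      - 1 / (2 * of_nat n) * (1 + chr (2 * int n) y))"
    unfolding norm_mult [of "of_real (1 / (8 * pi\<^sup>2 * real n))"] norm_of_real by simp
  also have "\<dots> \<le> 1 / (8 * pi\<^sup>2 * n) * (2 * pi * (1 / 2 * 2) + 1 / (2 * n) * 2)"
  proof (intro mult_left_mono)
    have 1: "cmod (1 - chr (2 * int n) y) \<le> 2" "cmod (1 + chr (2 * int n) y) \<le> 2"
      using norm_triangle_ineq4 [of 1 "chr (2 * int n) y"] norm_triangle_ineq [of 1 "chr (2 * int n) y"] by simp_all
    have 2: "cmod (of_real (1 / 2 - y)) \<le> 1 / 2" using y unfolding norm_of_real atLeastAtMost_iff abs_le_iff by linarith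
    have a: "cmod (2 * pi * \<i> * (of_real (1 / 2 - y) * (1 - chr (2 * int n) y))) \<le> 2 * pi * (1 / 2 * 2)"
    proof -
      have "cmod (2 * pi * \<i> * (of_real (1 / 2 - y) * (1 - chr (2 * int n) y)))
          = 2 * pi * (cmod (of_real (1 / 2 - y)) * cmod (1 - chr (2 * int n) y))"
        by (simp only: norm_mult norm_of_real norm_ii) simp
      also have "\<dots> \<le> 2 * pi * (1 / 2 * 2)" by (intro mult_left_mono mult_mono 1 2) auto
      finally show ?thesis .
    qed
    have b: "cmod (1 / (2 * of_nat n) * (1 + chr (2 * int n) y)) \<le> 1 / (2 * n) * 2"
      unfolding norm_mult by (intro mult_mono 1) (auto simp: norm_divide norm_mult)
    show "cmod (2 * pi * \<i> * (of_real (1 / 2 - y) * (1 - chr (2 * int n) y))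
      - 1 / (2 * of_nat n) * (1 + chr (2 * int n) y)) \<le> 2 * pi * (1 / 2 * 2) + 1 / (2 * n) * 2"
      by (rule order_trans [OF norm_triangle_ineq4 add_mono [OF a b]])
  qed simp
  also have "\<dots> \<le> 1 / (8 * pi\<^sup>2 * n) * (8 * pi\<^sup>2)"
  proof (intro mult_left_mono)
    have "1 / (2 * n) * 2 \<le> (1::real)" using n by (simp add: field_simps)
    moreover have "pi * 3 \<le> pi * pi" using pi_gt3 by (intro mult_left_mono) auto
    ultimately show "2 * pi * (1 / 2 * 2) + 1 / (2 * n) * 2 \<le> 8 * pi\<^sup>2"
      using pi_gt3 unfolding power2_eq_square by linarith
  qed simp
  also have "\<dots> = 1 / real n" by simp
  finally show ?thesis .
qed

lemma kernel_continuous: "n > 0 \<Longrightarrow> continuous_on S (kernel n)"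
  unfolding kernel_def by (rule series_continuous [OF summable_inverse_denom])

section \<open>Convolution with the kernel and the trilinear form\<close>

definition smooth :: "nat \<Rightarrow> (real \<Rightarrow> complex) \<Rightarrow> real \<Rightarrow> complex" where
  "smooth n f x = (\<integral>t. f t * kernel n (x - t) \<partial>LI)"

lemma kernel_shift_continuous: "n > 0 \<Longrightarrow> continuous_on S (\<lambda>t. kernel n (x - t))"
  using continuous_on_compose [of S "\<lambda>t. x - t" "kernel n"] kernel_continuous [of n]
  by (simp add: o_def continuous_on_diff)

lemma smooth_le:
  assumes "n > 0" "integrable LI f"
  shows "cmod (smooth n f x) \<le> 1 / real n * (\<integral>t. cmod (f t) \<partial>LI)"
  unfolding smooth_def using assms
  by (intro integral_LI_mult_bound measurable_LI_continuous kernel_shift_continuous kernel_le)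

lemma smooth_diff:
  assumes "n > 0" "integrable LI f" "integrable LI g"
  shows "smooth n (\<lambda>x. f x - g x) x = smooth n f x - smooth n g x"
  unfolding smooth_def left_diff_distrib using assms
  by (intro Bochner_Integration.integral_diff integrable_LI_mult_continuous kernel_shift_continuous)

lemma summable_fc_denom:
  assumes "n > 0" "integrable LI f"
  shows "(\<lambda>i. cmod (fc f i / of_real (denom n i))) summable_on offres n"
  using fc_bound [OF assms(2)] by (rule abs_summable_inverse_denom [OF assms(1)])

lemma smooth_series:
  assumes n: "n > 0" and f: "integrable LI f"
  shows "smooth n f x = (\<Sum>\<^sub>\<infinity>i\<in>offres n. fc f i / of_real (denom n i) * chr i x)"
proof -
  have "((\<lambda>i. \<integral>t. f t * (1 / of_real (denom n i) * chr i (x - t)) \<partial>LI) has_sum smooth n f x) (offres n)"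
    unfolding smooth_def kernel_def
    by (rule has_sum_integral [OF f summable_inverse_denom [OF n]])
      (auto simp: norm_mult norm_divide chr_diff_arg denom_nonzero [OF n] intro!: continuous_intros)
  moreover have "(\<integral>t. f t * (1 / of_real (denom n i) * chr i (x - t)) \<partial>LI) = fc f i / of_real (denom n i) * chr i x" for i
  proof -
    have "f t * (1 / of_real (denom n i) * chr i (x - t)) = (chr i x / of_real (denom n i)) * (f t * chr (- i) t)" for t
      by (simp add: chr_diff_arg)
    then show ?thesis unfolding fc_def by (simp only: integral_mult_right_zero) (simp add: mult_ac)
  qed
  ultimately have "((\<lambda>i. fc f i / of_real (denom n i) * chr i x) has_sum smooth n f x) (offres n)"
    by (simp only:)
  then show ?thesis by (simp only: has_sum_iff)
qed

lemma smooth_continuous: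
  assumes "n > 0" "integrable LI f"
  shows "continuous_on S (smooth n f)"
  unfolding smooth_series [OF assms] by (rule series_continuous [OF summable_fc_denom [OF assms]])

text \<open>The off-diagonal \<open>red2\<close> with the three occurrences of q made independent,
  so that they can be approximated one at a time.\<close>

definition trilinear :: "nat \<Rightarrow> (real \<Rightarrow> complex) \<Rightarrow> (real \<Rightarrow> complex) \<Rightarrow> (real \<Rightarrow> complex) \<Rightarrow> complex" where
  "trilinear n f g h = fc (\<lambda>x. g x * smooth n h x * smooth n f x) (2 * int n)"

lemma integrable_trilinear:
  assumes "n > 0" "integrable LI f" "integrable LI g" "integrable LI h"
  shows "integrable LI (\<lambda>x. g x * smooth n h x)" "integrable LI (\<lambda>x. g x * smooth n h x * smooth n f x)"
proof -
  show "integrable LI (\<lambda>x. g x * smooth n h x)"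
    by (intro integrable_LI_mult_continuous smooth_continuous assms)
  then show "integrable LI (\<lambda>x. g x * smooth n h x * smooth n f x)"
    by (intro integrable_LI_mult_continuous smooth_continuous assms)
qed

text \<open>Each multiplication by a smoothed function becomes one of the nested sums. The inner
  product naturally runs over j = 2 n - l, and \<open>denom\<close> is invariant under this
  reflection.\<close>

lemma trilinear_series:
  assumes n: "n > 0" and f: "integrable LI f" and g: "integrable LI g" and h: "integrable LI h"
  shows "trilinear n f g h = (\<Sum>\<^sub>\<infinity>i\<in>offres n. fc f i / of_real (denom n i)
      * (\<Sum>\<^sub>\<infinity>l\<in>offres n. fc g (l - i) * fc h (2 * int n - l) / of_real (denom n l)))"
proof -
  have inner: "fc (\<lambda>x. g x * smooth n h x) (2 * int n - i)
      = (\<Sum>\<^sub>\<infinity>l\<in>offres n. fc g (l - i) * fc h (2 * int n - l) / of_real (denom n l))" for i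
  proof -
    have "fc (\<lambda>x. g x * smooth n h x) (2 * int n - i)
        = (\<Sum>\<^sub>\<infinity>j\<in>offres n. fc h j / of_real (denom n j) * fc g (2 * int n - i - j))"
      using fc_mult_series [OF g summable_fc_denom [OF n h], of "2 * int n - i"]
      by (simp add: has_sum_iff smooth_series [OF n h])
    also have "\<dots> = (\<Sum>\<^sub>\<infinity>j\<in>offres n. fc h j / of_real (denom n j) * fc g (2 * int n - j - i))"
      by (rule infsum_cong) (simp add: diff_diff_eq add.commute)
    also have "\<dots> = (\<Sum>\<^sub>\<infinity>l\<in>offres n. fc g (l - i) * fc h (2 * int n - l) / of_real (denom n l))"
      by (rule infsum_reindex_bij_witness [of _ "\<lambda>l. 2 * int n - l" "\<lambda>l. 2 * int n - l"])
        (auto simp: offres_reflect denom_reflect)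
    finally show ?thesis .
  qed
  show ?thesis
    using fc_mult_series [OF integrable_trilinear(1) [OF n f g h] summable_fc_denom [OF n f], of "2 * int n"]
    by (simp add: has_sum_iff smooth_series [OF n f] trilinear_def inner)
qed

lemma trilinear_le:
  assumes n: "n > 0" and f: "integrable LI f" and g: "integrable LI g" and h: "integrable LI h"
  shows "cmod (trilinear n f g h)
    \<le> (\<integral>t. cmod (f t) \<partial>LI) * (\<integral>t. cmod (g t) \<partial>LI) * (\<integral>t. cmod (h t) \<partial>LI) / (real n)\<^sup>2"
proof -
  let ?N = "\<lambda>f. \<integral>t. cmod (f t :: complex) \<partial>LI"
  have "cmod (\<integral>x. g x * (smooth n h x * smooth n f x * chr (- (2 * int n)) x) \<partial>LI)
      \<le> ((1 / real n * ?N h) * (1 / real n * ?N f)) * ?N g"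
  proof (rule integral_LI_mult_bound [OF g])
    show "(\<lambda>x. smooth n h x * smooth n f x * chr (- (2 * int n)) x) \<in> borel_measurable LI"
      using n f h by (intro measurable_LI_continuous continuous_intros smooth_continuous)
    show "cmod (smooth n h x * smooth n f x * chr (- (2 * int n)) x) \<le> (1 / real n * ?N h) * (1 / real n * ?N f)" for x
      using smooth_le [OF n h, of x] smooth_le [OF n f, of x]
      by (simp add: norm_mult del: times_divide_eq_left) (intro mult_mono, auto)
  qed
  then show ?thesis by (simp add: trilinear_def fc_def mult_ac power2_eq_square)
qed

lemma trilinear_diff:
  assumes n: "n > 0" and f: "integrable LI f" and g: "integrable LI g" and h: "integrable LI h"
    and p: "integrable LI p"
  shows "trilinear n (\<lambda>x. f x - p x) g h = trilinear n f g h - trilinear n p g h"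
    and "trilinear n f (\<lambda>x. g x - p x) h = trilinear n f g h - trilinear n f p h"
    and "trilinear n f g (\<lambda>x. h x - p x) = trilinear n f g h - trilinear n f g p"
  using integrable_trilinear(2) [OF n] assms
  by (simp_all add: trilinear_def smooth_diff right_diff_distrib left_diff_distrib fc_diff)

text \<open>The three frequencies i, l - i and 2 n - l add up to 2 n > 3 d, so at least one of them
  lies outside the spectrum of p and every term vanishes.\<close>

lemma trilinear_trig_poly_0:
  assumes n: "n > 0" and p: "integrable LI p" and d: "\<And>k. \<bar>k\<bar> > d \<Longrightarrow> fc p k = 0" and nd: "2 * int n > 3 * d"
  shows "trilinear n p p p = 0"
proof -
  have "fc p i * (fc p (l - i) * fc p (2 * int n - l)) = 0" for i l
  proof -
    have "\<bar>i\<bar> > d \<or> \<bar>l - i\<bar> > d \<or> \<bar>2 * int n - l\<bar> > d" using nd by linarith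
    then show ?thesis using d by auto
  qed
  then have z: "fc p i = 0 \<or> (\<forall>l. fc p (l - i) * fc p (2 * int n - l) = 0)" for i
    using mult_eq_0_iff by blast
  have "fc p i / of_real (denom n i) * (\<Sum>\<^sub>\<infinity>l\<in>offres n. fc p (l - i) * fc p (2 * int n - l) / of_real (denom n l)) = 0" for i
    using z [of i]
  proof
    assume "\<forall>l. fc p (l - i) * fc p (2 * int n - l) = 0"
    then have "(\<Sum>\<^sub>\<infinity>l\<in>offres n. fc p (l - i) * fc p (2 * int n - l) / of_real (denom n l)) = 0"
      by (intro infsum_0) (simp only: div_0)
    then show ?thesis by (simp only: mult_zero_right)
  qed simp
  then show ?thesis unfolding trilinear_series [OF n p p p] by (intro infsum_0) auto
qed

section \<open>The integrable real potential of mean zero\<close>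

locale potential =
  fixes q :: "real \<Rightarrow> real"
  assumes q_int: "integrable LI q" and q_mean: "integral\<^sup>L LI q = 0"
begin

abbreviation qc :: "real \<Rightarrow> complex" where "qc x \<equiv> of_real (q x)"
definition c :: "int \<Rightarrow> complex" where "c k = fc qc k"
definition M :: real where "M = (\<integral>x. \<bar>q x\<bar> \<partial>LI)"

lemma qc_int: "integrable LI qc" using q_int by simp

lemma c_le: "cmod (c k) \<le> M"
  using fc_bound [OF qc_int, of k] by (simp add: c_def M_def)

lemma M_nonneg: "M \<ge> 0" by (simp add: M_def)

lemma c_0: "c 0 = 0"
  using q_mean by (simp add: c_def fc_def integral_complex_of_real)

lemma c_uminus: "c (- k) = cnj (c k)"
  using fc_cnj [of qc "-k"] by (simp add: c_def)

lemma red2_eq_trilinear: "n > 0 \<Longrightarrow> red2 c n (2 * int n) = trilinear n qc qc qc"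
  by (simp add: trilinear_series qc_int red2_def c_def)

text \<open>The trilinear form is bounded by the product of the \<open>L\<^sub>1\<close> norms over \<open>n\<^sup>2\<close> and vanishes for
  large \<open>n\<close> on trigonometric polynomials, which are dense.\<close>

lemma red2_small: "(\<lambda>n. (real n)\<^sup>2 * cmod (red2 c n (2 * int n))) \<longlonglongrightarrow> 0"
proof (rule tendstoI)
  fix e :: real assume "e > 0"
  \<comment> \<open>The minimum with 1 keeps the L1 norm of p at most M + 1; the 4 against the three
    differences below leaves room for the strict inequality.\<close>
  define \<delta> where "\<delta> = min 1 (e / (4 * (M + 1)\<^sup>2))"
  have "\<delta> > 0" using \<open>e > 0\<close> M_nonneg by (simp add: \<delta>_def)
  obtain p where p: "trig_poly p" "(\<integral>x. cmod (qc x - p x) \<partial>LI) < \<delta>"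
    using L1_approx_trig_poly [OF q_int \<open>\<delta> > 0\<close>] by blast
  have pint: "integrable LI p" by (intro integrable_LI_continuous trig_poly_continuous p)
  obtain d where d: "\<And>k. \<bar>k\<bar> > d \<Longrightarrow> fc p k = 0" using trig_poly_fc_eventually_0 [OF p(1)] by blast
  let ?N = "\<lambda>f. \<integral>t. cmod (f t :: complex) \<partial>LI"
  have Nq: "?N qc = M" by (simp add: M_def)
  have "?N p \<le> (\<integral>x. cmod (qc x) + cmod (qc x - p x) \<partial>LI)"
  proof (rule integral_mono)
    show "cmod (p x) \<le> cmod (qc x) + cmod (qc x - p x)" for x
      using norm_triangle_ineq4 [of "qc x" "qc x - p x"] by simp
  qed (use pint q_int in auto)
  also have "\<dots> = M + ?N (\<lambda>x. qc x - p x)"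
    using pint q_int by (subst Bochner_Integration.integral_add) (auto simp: M_def)
  also have "\<dots> \<le> M + 1" using p(2) by (simp add: \<delta>_def)
  finally have Np: "?N p \<le> M + 1" .
  have Nd: "?N (\<lambda>x. qc x - p x) \<le> \<delta>" using p(2) by simp
  have dint: "integrable LI (\<lambda>x. qc x - p x)" using pint qc_int by simp
  have N0: "?N f \<ge> 0" for f by simp
  show "\<forall>\<^sub>F n in sequentially. dist ((real n)\<^sup>2 * cmod (red2 c n (2 * int n))) 0 < e"
    using eventually_gt_at_top [of "nat (2 * \<bar>d\<bar>)"] eventually_gt_at_top [of 0]
  proof eventually_elim
    case (elim n)
    then have n: "n > 0" and nd: "2 * int n > 3 * d" by auto
    have b: "(real n)\<^sup>2 * cmod (trilinear n f g h) \<le> \<delta> * (M + 1)\<^sup>2"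
      if "integrable LI f" "integrable LI g" "integrable LI h" "?N f * ?N g * ?N h \<le> \<delta> * (M + 1)\<^sup>2" for f g h
    proof -
      have "(real n)\<^sup>2 * cmod (trilinear n f g h) \<le> ?N f * ?N g * ?N h"
        using mult_left_mono [OF trilinear_le [OF n that(1-3)], of "(real n)\<^sup>2"] n by simp
      with that(4) show ?thesis by linarith
    qed
    have P: "x * y \<le> (M + 1)\<^sup>2" if "0 \<le> x" "x \<le> M + 1" "0 \<le> y" "y \<le> M + 1" for x y
      using that unfolding power2_eq_square by (intro mult_mono) auto
    have Nq': "?N qc \<le> M + 1" using Nq by linarith
    have 1: "(real n)\<^sup>2 * cmod (trilinear n (\<lambda>x. qc x - p x) qc qc) \<le> \<delta> * (M + 1)\<^sup>2"
      using \<open>\<delta> > 0\<close> mult_mono [OF Nd P [OF N0 Nq' N0 Nq']] by (intro b dint qc_int) (simp add: mult.assoc)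
    have 2: "(real n)\<^sup>2 * cmod (trilinear n p (\<lambda>x. qc x - p x) qc) \<le> \<delta> * (M + 1)\<^sup>2"
      using \<open>\<delta> > 0\<close> mult_mono [OF Nd P [OF N0 Np N0 Nq']] by (intro b dint pint qc_int) (simp add: mult_ac)
    have 3: "(real n)\<^sup>2 * cmod (trilinear n p p (\<lambda>x. qc x - p x)) \<le> \<delta> * (M + 1)\<^sup>2"
      using \<open>\<delta> > 0\<close> mult_mono [OF Nd P [OF N0 Np N0 Np]] by (intro b dint pint) (simp add: mult_ac)
    \<comment> \<open>Telescoping: q is replaced by p in one argument at a time, and the final term,
      with p in all three places, is zero.\<close>
    have "trilinear n qc qc qc = trilinear n (\<lambda>x. qc x - p x) qc qc + trilinear n p (\<lambda>x. qc x - p x) qc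
        + trilinear n p p (\<lambda>x. qc x - p x)"
      using trilinear_trig_poly_0 [OF n pint d nd]
      by (simp add: trilinear_diff [OF n] qc_int pint)
    then have "cmod (trilinear n qc qc qc) \<le> cmod (trilinear n (\<lambda>x. qc x - p x) qc qc)
        + cmod (trilinear n p (\<lambda>x. qc x - p x) qc) + cmod (trilinear n p p (\<lambda>x. qc x - p x))"
      by (simp only:) (intro norm_triangle_le add_mono order_refl norm_triangle_ineq)
    then have "(real n)\<^sup>2 * cmod (trilinear n qc qc qc) \<le> (real n)\<^sup>2 * (cmod (trilinear n (\<lambda>x. qc x - p x) qc qc)
        + cmod (trilinear n p (\<lambda>x. qc x - p x) qc) + cmod (trilinear n p p (\<lambda>x. qc x - p x)))"
      by (intro mult_left_mono) auto
    also have "\<dots> \<le> 3 * (\<delta> * (M + 1)\<^sup>2)" using 1 2 3 unfolding distrib_left by linarith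
    also have "\<dots> < 4 * (\<delta> * (M + 1)\<^sup>2)" using \<open>\<delta> > 0\<close> M_nonneg by simp
    also have "\<dots> \<le> 4 * (e / (4 * (M + 1)\<^sup>2) * (M + 1)\<^sup>2)"
      by (intro mult_left_mono mult_right_mono) (auto simp: \<delta>_def)
    also have "\<dots> = e" using M_nonneg by simp
    finally show ?case by (simp add: red2_eq_trilinear [OF n])
  qed
qed

section \<open>The off-diagonal first order term through the antiderivative of the potential\<close>

definition Q :: "real \<Rightarrow> complex" where "Q x = set_lebesgue_integral lebesgue {0..x} qc"

lemma Q_eq: "Q x = of_real (primitive q x)"
  unfolding Q_def primitive_def set_lebesgue_integral_def
  by (simp add: scaleR_conv_of_real flip: of_real_mult integral_complex_of_real)

lemma Q_cont: "continuous_on {0..1} Q"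
  unfolding Q_def using continuous_on_primitive [OF qc_int] .

lemma c_Q: "c k = 2 * pi * \<i> * of_int k * fc Q k"
  unfolding c_def by (rule fc_primitive [OF qc_int _ , where C = 0])
    (use q_mean in \<open>auto simp: Q_def integral_complex_of_real\<close>)

text \<open>The smoothed potential times \<open>chr (- 2 n)\<close> is an explicit indefinite integral of \<open>Q\<close>, so that
  the sum becomes an integral over \<open>Q\<^sup>2\<close> after integration by parts.\<close>

lemma red1_eq: 
  assumes n: "n > 0"
  shows "red1 c n (2 * int n) = - fc (\<lambda>x. (Q x)\<^sup>2) (2 * int n) + 2 * fc Q 0 * fc Q (2 * int n)"
proof -
  let ?m = "2 * int n"
  \<comment> \<open>By \<open>c_Q\<close>, the coefficient of \<open>\<Psi>\<close> at a nonresonant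
    k is that of Q at k + 2 n divided by 2 pi i k, so \<open>\<Psi>\<close> should integrate Q times
    \<open>chr (- ?m)\<close>. The terms subtracted in \<open>\<psi>\<close> delete the two resonant
    indices, where the smoothed potential has no coefficient.\<close>
  define \<Psi> where "\<Psi> x = smooth n qc x * chr (- ?m) x" for x
  define \<psi> where "\<psi> x = (Q x - fc Q 0 - fc Q ?m * chr ?m x) * chr (- ?m) x" for x
  define R where "R x = set_lebesgue_integral lebesgue {0..x} \<psi>" for x
  have Qi: "integrable LI Q" by (rule integrable_LI_continuous [OF Q_cont])
  have ci: "integrable LI (\<lambda>x. a)" for a :: complex by (intro integrable_LI_continuous continuous_intros)
  have mi: "integrable LI (\<lambda>x. fc Q ?m * chr ?m x)" by (intro integrable_LI_continuous continuous_intros)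
  have \<psi>c: "continuous_on {0..1} \<psi>" unfolding \<psi>_def by (intro continuous_intros Q_cont)
  then have \<psi>i: "integrable LI \<psi>" by (rule integrable_LI_continuous)
  have \<Psi>c: "continuous_on {0..1} \<Psi>"
    unfolding \<Psi>_def by (intro continuous_intros smooth_continuous n qc_int)
  have Rc: "continuous_on {0..1} R" unfolding R_def by (rule continuous_on_primitive [OF \<psi>i])
  have fc\<psi>: "fc \<psi> k = fc Q (k + ?m) - (if k + ?m = 0 then fc Q 0 else 0) - (if k = 0 then fc Q ?m else 0)" for k
    unfolding \<psi>_def fc_mult_chr using Qi ci mi
    by (simp add: fc_diff fc_const fc_cmult fc_chr)
  have \<psi>0: "integral\<^sup>L LI \<psi> = 0" using fc\<psi> [of 0] n by (simp add: fc_def)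
  then have R1: "R 1 = 0" by (simp add: R_def LINT_set_eq)
  have "R 0 = (\<integral>t. of_bool (t \<le> 0) *\<^sub>R \<psi> t \<partial>LI)"
    unfolding R_def by (rule set_integral_initial_segment) simp
  moreover have "AE t in LI. of_bool (t \<le> 0) *\<^sub>R \<psi> t = 0"
    using AE_LI_neq [of 0] AE_space by eventually_elim auto
  ultimately have R0: "R 0 = 0" by (simp add: integral_eq_zero_AE)
  have fcR: "fc \<psi> k = 2 * pi * \<i> * of_int k * fc R k" for k
    by (rule fc_primitive [OF \<psi>i \<psi>0, where C = 0]) (simp add: R_def)
  have fc\<Psi>: "fc \<Psi> k = (if k + ?m \<in> offres n then c (k + ?m) / of_real (denom n (k + ?m)) else 0)" for k
    unfolding \<Psi>_def fc_mult_chr smooth_series [OF n qc_int]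
    by (subst fc_series [OF summable_fc_denom [OF n qc_int]]) (simp add: c_def)
  have eqk: "fc \<Psi> k = fc R k" if "k \<noteq> 0" for k
  proof -
    have z: "2 * pi * \<i> * complex_of_int k \<noteq> 0" using that by simp
    have "2 * pi * \<i> * of_int k * fc \<Psi> k = fc \<psi> k"
    proof (cases "k + ?m = 0")
      case True
      then show ?thesis using that unfolding fc\<Psi> fc\<psi> by (simp add: offres_def)
    next
      case False
      then have o: "k + ?m \<in> offres n" using that by (simp add: offres_def)
      have d: "complex_of_real (denom n (k + ?m)) = - (4 * pi\<^sup>2 * of_int (k + ?m) * of_int k)"
        by (simp add: denom_eq algebra_simps)
      have nz: "complex_of_int (k + ?m) \<noteq> 0" "complex_of_int k \<noteq> 0" using False that by (simp_all only: of_int_eq_0_iff not_False_eq_True)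
      have "2 * pi * \<i> * of_int k * fc \<Psi> k
          = 2 * pi * \<i> * of_int k * ((2 * pi * \<i> * of_int (k + ?m) * fc Q (k + ?m)) / - (4 * pi\<^sup>2 * of_int (k + ?m) * of_int k))"
        unfolding fc\<Psi> d [symmetric] c_Q [symmetric] using o by simp
      also have "\<dots> = fc Q (k + ?m)"
        using nz by (simp add: field_simps power2_eq_square del: of_int_add)
      finally show ?thesis using that False by (simp add: fc\<psi>)
    qed
    then show ?thesis using z unfolding fcR by (metis mult_left_cancel)
  qed
  define C where "C = fc \<Psi> 0 - fc R 0"
  have \<Psi>R: "\<Psi> x = R x + C" if "x \<in> {0..1}" for x
  proof (rule fourier_unique [OF \<Psi>c _ _ _ _ that])
    show "\<Psi> 1 = \<Psi> 0" by (simp add: \<Psi>_def smooth_series [OF n qc_int])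
    show "continuous_on {0..1} (\<lambda>x. R x + C)" by (intro continuous_intros Rc)
    show "R 1 + C = R 0 + C" by (simp add: R0 R1)
    show "fc \<Psi> k = fc (\<lambda>x. R x + C) k" for k
      using eqk [of k] integrable_LI_continuous [OF Rc] ci by (auto simp: fc_add fc_const C_def)
  qed
  have "red1 c n ?m = fc (\<lambda>x. qc x * smooth n qc x) ?m"
    using fc_mult_series [OF qc_int summable_fc_denom [OF n qc_int], of ?m]
    by (simp add: has_sum_iff smooth_series [OF n qc_int] red1_def c_def)
  also have "\<dots> = (\<integral>x. qc x * R x + qc x * C \<partial>LI)"
    unfolding fc_def by (rule Bochner_Integration.integral_cong) (auto simp: \<Psi>_def \<Psi>R [symmetric] distrib_left [symmetric])
  also have "\<dots> = (\<integral>x. qc x * R x \<partial>LI) + (\<integral>x. qc x * C \<partial>LI)"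
    using q_int by (intro Bochner_Integration.integral_add integrable_LI_mult_continuous Rc) auto
  \<comment> \<open>The constant of integration is invisible because q has mean zero.\<close>
  also have "(\<integral>x. qc x * C \<partial>LI) = 0"
    using q_mean by (simp add: integral_complex_of_real)
  also have "(\<integral>x. qc x * R x \<partial>LI) = - (\<integral>x. Q x * \<psi> x \<partial>LI)"
    using integration_by_parts_L1 [OF qc_int \<psi>i, of Q R] R1 by (simp add: Q_def R_def add_eq_0_iff)
  also have "(\<integral>x. Q x * \<psi> x \<partial>LI) = fc (\<lambda>x. Q x * Q x - fc Q 0 * Q x - fc Q ?m * (Q x * chr ?m x)) ?m"
    unfolding fc_def [of "\<lambda>x. Q x * Q x - fc Q 0 * Q x - fc Q ?m * (Q x * chr ?m x)"]
    by (rule Bochner_Integration.integral_cong) (auto simp: \<psi>_def algebra_simps)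
  also have "\<dots> = fc (\<lambda>x. Q x * Q x) ?m - fc Q 0 * fc Q ?m - fc Q ?m * fc Q 0"
    using integrable_LI_mult_continuous [OF Qi Q_cont] Qi integrable_mult_chr [OF Qi, of ?m]
    by (simp add: fc_diff fc_cmult fc_mult_chr)
  finally show ?thesis by (simp add: power2_eq_square algebra_simps)
qed

lemma splitting_eq:
  assumes "n > 0"
  shows "splitting q n = cmod (c (2 * int n) + red1 c n (2 * int n))"
proof -
  have "(\<lambda>x. complex_of_real (primitive_sq q x)) = (\<lambda>x. (Q x)\<^sup>2)"
    by (simp add: primitive_sq_def Q_eq fun_eq_iff)
  then show ?thesis
    unfolding splitting_def red1_eq [OF assms] fourier_coeff_eq_fc
    by (simp add: c_def Q_eq [abs_def] algebra_simps)
qed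

end

subsection \<open>The two-dimensional system\<close>

lemma summable_pair_gap:
  assumes n: "n > 0"
  shows "(\<lambda>(k, m). gap n k * gap n m) summable_on (offres n \<times> offres n)"
proof (rule summable_on_SigmaI [where g = "\<lambda>k. gap n k * gap_sum n"])
  show "((\<lambda>m. case (k, m) of (k, m) \<Rightarrow> gap n k * gap n m) has_sum gap n k * gap_sum n) (offres n)" for k
    unfolding gap_sum_def prod.case by (intro has_sum_cmult_right has_sum_infsum summable_gap n)
  show "(\<lambda>k. gap n k * gap_sum n) summable_on offres n"
    by (intro summable_on_cmult_left summable_gap n)
qed auto

text \<open>If \<open>\<beta> = \<theta> s\<close> with \<open>|\<theta>| = 1\<close> and \<open>s\<close> real, then \<open>\<theta> (cnj \<beta>) = s\<close>, so \<open>x + \<theta> y\<close> and \<open>x - \<theta> y\<close>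
  diagonalise the system.\<close>

lemma two_by_two:
  fixes A \<beta> \<theta> x y :: complex and \<nu> \<sigma> s r :: real
  assumes \<theta>: "cmod \<theta> = 1" "\<beta> = \<theta> * of_real s" and \<sigma>: "\<sigma> = 1 \<or> \<sigma> = -1"
    and 1: "cmod (of_real \<nu> * x - A * x - \<beta> * y) \<le> r"
    and 2: "cmod (of_real \<nu> * y - A * y - cnj \<beta> * x) \<le> r"
  shows "cmod (of_real \<nu> - A - of_real (\<sigma> * s)) * cmod (x + of_real \<sigma> * \<theta> * y) \<le> 2 * r"
proof -
  have t: "\<theta> * cnj \<theta> = 1" using \<theta>(1) complex_norm_square [of \<theta>] by simp
  then have t': "\<theta> * (cnj \<theta> * z) = z" for z by (metis mult.assoc mult_1)
  have ss: "of_real \<sigma> * of_real \<sigma> = (1::complex)" using \<sigma> by auto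
  have "(of_real \<nu> - A - of_real (\<sigma> * s)) * (x + of_real \<sigma> * \<theta> * y)
     = (of_real \<nu> - A) * x - of_real \<sigma> * of_real s * x
       + of_real \<sigma> * \<theta> * ((of_real \<nu> - A) * y) - (of_real \<sigma> * of_real \<sigma>) * (\<theta> * of_real s) * y"
    by (simp add: algebra_simps)
  also have "\<dots> = (of_real \<nu> * x - A * x - \<beta> * y)
      + of_real \<sigma> * \<theta> * (of_real \<nu> * y - A * y - cnj \<beta> * x)"
    unfolding \<theta>(2) ss by (simp add: algebra_simps t')
  finally have "cmod ((of_real \<nu> - A - of_real (\<sigma> * s)) * (x + of_real \<sigma> * \<theta> * y))
    = cmod ((of_real \<nu> * x - A * x - \<beta> * y) + of_real \<sigma> * \<theta> * (of_real \<nu> * y - A * y - cnj \<beta> * x))"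
    by simp
  also have "\<dots> \<le> r + cmod (of_real \<sigma> * \<theta> * (of_real \<nu> * y - A * y - cnj \<beta> * x))"
    by (rule order_trans [OF norm_triangle_ineq add_right_mono [OF 1]])
  also have "cmod (of_real \<sigma> * \<theta> * (of_real \<nu> * y - A * y - cnj \<beta> * x)) = cmod (of_real \<nu> * y - A * y - cnj \<beta> * x)"
    using \<sigma> \<theta>(1) by (auto simp: norm_mult)
  finally show ?thesis using 2 by (simp add: norm_mult del: of_real_mult)
qed

context potential
begin

section \<open>The diagonal entry: identification with \<open>A2\<close> and reality\<close>

lemma red1_0_eq:
  assumes n: "n > 0"
  shows "red1 c n 0 = of_real (a1 q n)"
proof -
  have b: "norm ((cmod (c k))\<^sup>2 / denom n k) \<le> M\<^sup>2 * gap n k" if "k \<in> offres n" for k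
  proof -
    have "cmod (c k * c (- k) / of_real (denom n k)) \<le> (M * M) * gap n k"
      by (rule norm_divide_denom_le [OF n that]) (simp add: norm_mult mult_mono c_le M_nonneg)
    then show ?thesis by (simp add: c_uminus norm_mult norm_divide power2_eq_square)
  qed
  have s: "(\<lambda>k. (cmod (c k))\<^sup>2 / denom n k) summable_on offres n"
    by (rule infsum_norm_bound(1) [OF summable_gap [OF n] b])
  have "a1 q n = (\<Sum>\<^sub>\<infinity>k\<in>offres n. (cmod (c k))\<^sup>2 / denom n k)"
    by (simp add: a1_def offres_def fourier_coeff_eq_fc c_def)
  then have "((\<lambda>k. complex_of_real ((cmod (c k))\<^sup>2 / denom n k)) has_sum of_real (a1 q n)) (offres n)"
    using s by (intro has_sum_of_real) simp
  moreover have "complex_of_real ((cmod (c k))\<^sup>2 / denom n k) = c k * c (0 - k) / of_real (denom n k)" for k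
    using complex_norm_square [of "c k"] by (simp add: c_uminus)
  ultimately have "((\<lambda>k. c k * c (0 - k) / of_real (denom n k)) has_sum of_real (a1 q n)) (offres n)"
    by (simp only:)
  then show ?thesis by (simp only: red1_def has_sum_iff)
qed

text \<open>The index m = k + l takes the place of l. This makes the summation domain a product and
  lets the exchange of k and m act as conjugation.\<close>

definition pair_term :: "nat \<Rightarrow> int \<times> int \<Rightarrow> complex" where
  "pair_term n = (\<lambda>(k, m). c k * c (m - k) * c (- m) / of_real (denom n k * denom n m))"

lemma pair_term_summable:
  assumes n: "n > 0"
  shows "pair_term n summable_on (offres n \<times> offres n)"
proof (rule infsum_norm_bound(1) [OF summable_pair_gap [OF n]])
  fix z assume "z \<in> offres n \<times> offres n"
  then obtain k m where z: "z = (k, m)" "k \<in> offres n" "m \<in> offres n" by auto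
  have "cmod (c (m - k) * c (- m) / of_real (denom n m)) \<le> (M * M) * gap n m"
    by (rule norm_divide_denom_le [OF n z(3)]) (simp add: norm_mult mult_mono c_le M_nonneg)
  then have "cmod (c k * (c (m - k) * c (- m) / of_real (denom n m))) \<le> M * ((M * M) * gap n m)"
    unfolding norm_mult [of "c k"] by (intro mult_mono c_le) (auto simp: M_nonneg)
  from norm_divide_denom_le [OF n z(2) this]
  show "cmod (pair_term n z) \<le> (M * M * M) * (case z of (k, m) \<Rightarrow> gap n k * gap n m)"
    by (simp add: pair_term_def z(1) mult_ac)
qed

lemma red2_0_eq_pair: "n > 0 \<Longrightarrow> red2 c n 0 = infsum (pair_term n) (offres n \<times> offres n)"
  using infsum_Sigma_banach [OF pair_term_summable]
  by (simp add: red2_def pair_term_def mult_ac flip: infsum_cmult_right')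

text \<open>The condition l \<noteq> 0 in \<open>a2\<close> excludes m = k, where the terms contain
  the factor c 0 = 0; restoring them completes the product domain.\<close>

lemma red2_0_eq:
  assumes n: "n > 0"
  shows "red2 c n 0 = a2 q n"
proof -
  let ?P = "{(k::int, l::int). l \<noteq> 0 \<and> k \<noteq> 0 \<and> k \<noteq> 2 * int n \<and> k + l \<noteq> 0 \<and> k + l \<noteq> 2 * int n}"
  let ?D = "{(k, m). k \<in> offres n \<and> m \<in> offres n \<and> m \<noteq> k}"
  have "a2 q n = (\<Sum>\<^sub>\<infinity>(k, l)\<in>?P. c k * c l * c (- k - l) / of_real (denom n k * denom n (k + l)))"
    by (simp add: a2_def fourier_coeff_eq_fc c_def)
  also have "\<dots> = infsum (pair_term n) ?D"
    by (rule infsum_reindex_bij_witness [of _ "\<lambda>(k, m). (k, m - k)" "\<lambda>(k, l). (k, k + l)"])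
      (auto simp: offres_def pair_term_def)
  also have "\<dots> = infsum (pair_term n) (offres n \<times> offres n)"
    by (rule infsum_cong_neutral) (auto simp: pair_term_def c_0)
  finally show ?thesis using red2_0_eq_pair [OF n] by simp
qed

text \<open>Exchanging k and m conjugates every term because q is real. Reality of the diagonal
  ensures that the equation obtained by conjugation has the same diagonal entry.\<close>

lemma cnj_red2_0:
  assumes n: "n > 0"
  shows "cnj (red2 c n 0) = red2 c n 0"
proof -
  have "cnj (infsum (pair_term n) (offres n \<times> offres n)) = infsum (\<lambda>z. cnj (pair_term n z)) (offres n \<times> offres n)"
    by simp
  also have "\<dots> = infsum (pair_term n) (offres n \<times> offres n)"
  proof (rule infsum_reindex_bij_witness [of _ prod.swap prod.swap])
    show "pair_term n (prod.swap z) = cnj (pair_term n z)" for z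
      using c_uminus [of "snd z - fst z"]
      by (cases z) (simp add: pair_term_def c_uminus mult_ac)
  qed auto
  finally show ?thesis using red2_0_eq_pair [OF n] by simp
qed

definition A :: "nat \<Rightarrow> complex" where "A n = red1 c n 0 + red2 c n 0"
definition \<beta> :: "nat \<Rightarrow> complex" where "\<beta> n = c (2 * int n) + red1 c n (2 * int n)"

lemma A_eq: "n > 0 \<Longrightarrow> A n = A2 q n"
  by (simp add: A_def A2_def red1_0_eq red2_0_eq)

lemma cnj_A: "n > 0 \<Longrightarrow> cnj (A n) = A n"
  by (simp add: A_def cnj_red2_0 red1_0_eq)

lemma cmod_\<beta>: "n > 0 \<Longrightarrow> cmod (\<beta> n) = splitting q n"
  by (simp add: \<beta>_def splitting_eq)

text \<open>Bounds |\<nu>|. It comes from adding the first order estimates at both resonant modes,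
  which doubles the constant of \<open>first_order\<close>.\<close>

definition shift_bound :: "nat \<Rightarrow> real" where
  "shift_bound n = cmod (c (2 * int n)) + 4 * M\<^sup>2 * gap_sum n"

text \<open>The constant of \<open>second_order\<close> with |\<nu>| replaced by its bound. The last
  summand is the off-diagonal second order term, which counts as error whereas its diagonal
  counterpart is kept.\<close>

definition rho :: "nat \<Rightarrow> real" where
  "rho n = 2 * M ^ 4 * gap_sum n ^ 3 + 2 * M\<^sup>2 * gap_sq_sum n * (1 + M * gap_sum n) * shift_bound n
    + cmod (red2 c n (2 * int n))"

lemma rho_nonneg: "rho n \<ge> 0"
  unfolding rho_def shift_bound_def
  by (intro add_nonneg_nonneg mult_nonneg_nonneg zero_le_power gap_sum_nonneg gap_sq_sum_nonneg M_nonneg) auto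

text \<open>The Fourier coefficients \<open>u\<close> of an eigenfunction for the eigenvalue \<open>(2 \<pi> n)\<^sup>2 + \<nu>\<close>, recentred as
  \<open>w j = u (n - j)\<close>, so that the resonant modes \<open>n\<close> and \<open>- n\<close> become \<open>0\<close> and \<open>2 n\<close>.\<close>

definition eigseq :: "nat \<Rightarrow> real \<Rightarrow> (int \<Rightarrow> complex) \<Rightarrow> bool" where
  "eigseq n \<nu> w \<longleftrightarrow> (\<lambda>i. cmod (w i)) summable_on UNIV \<and>
     (\<forall>j. of_real (\<nu> + denom n j) * w j = (\<Sum>\<^sub>\<infinity>i. c (i - j) * w i))"

section \<open>Conjugation symmetry and orthogonality of the solution sequences\<close>

lemma eigseq_summable:
  assumes "eigseq n \<nu> w"
  shows "(\<lambda>i. c (i - j) * w i) summable_on UNIV"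
proof (rule infsum_norm_bound(1))
  show "(\<lambda>i. cmod (w i)) summable_on UNIV" using assms by (simp add: eigseq_def)
  show "cmod (c (i - j) * w i) \<le> M * cmod (w i)" for i by (simp add: norm_mult mult_right_mono c_le)
qed

text \<open>This is the sequence of the complex conjugate eigenfunction; the denominators are
  symmetric under j to 2 n - j, and the indices 0 and 2 n change places.\<close>

lemma eigseq_cnj:
  assumes e: "eigseq n \<nu> w"
  shows "eigseq n \<nu> (\<lambda>j. cnj (w (2 * int n - j)))"
  unfolding eigseq_def
proof (intro conjI allI)
  have "((\<lambda>i. cmod (cnj (w (2 * int n - i)))) summable_on UNIV) \<longleftrightarrow> (\<lambda>i. cmod (w i)) summable_on UNIV"
    by (rule summable_on_reindex_bij_witness [of _ "\<lambda>l. 2 * int n - l" "\<lambda>l. 2 * int n - l"]) auto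
  then show "(\<lambda>i. cmod (cnj (w (2 * int n - i)))) summable_on UNIV" using e by (simp add: eigseq_def)
  fix j
  have "of_real (\<nu> + denom n j) * cnj (w (2 * int n - j))
      = cnj (of_real (\<nu> + denom n (2 * int n - j)) * w (2 * int n - j))"
    by (simp add: denom_reflect)
  also have "\<dots> = cnj (\<Sum>\<^sub>\<infinity>i. c (i - (2 * int n - j)) * w i)"
    using e by (simp only: eigseq_def)
  also have "\<dots> = (\<Sum>\<^sub>\<infinity>i. cnj (c (i - (2 * int n - j)) * w i))"
    by (rule infsum_cnj [symmetric])
  also have "\<dots> = (\<Sum>\<^sub>\<infinity>i. c (i - j) * cnj (w (2 * int n - i)))"
  proof (rule infsum_reindex_bij_witness [of _ "\<lambda>l. 2 * int n - l" "\<lambda>l. 2 * int n - l"])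
    fix i
    show "c (2 * int n - i - j) * cnj (w (2 * int n - (2 * int n - i))) = cnj (c (i - (2 * int n - j)) * w i)"
      using c_uminus [of "i - (2 * int n - j)"] by (simp add: algebra_simps)
  qed auto
  finally show "of_real (\<nu> + denom n j) * cnj (w (2 * int n - j)) = (\<Sum>\<^sub>\<infinity>i. c (i - j) * cnj (w (2 * int n - i)))" .
qed

lemma eigseq_lincomb:
  assumes 1: "eigseq n \<nu> w" and 2: "eigseq n \<nu> v"
  shows "eigseq n \<nu> (\<lambda>j. a * w j + b * v j)"
  unfolding eigseq_def
proof (intro conjI allI)
  have s: "(\<lambda>i. cmod a * cmod (w i) + cmod b * cmod (v i)) summable_on UNIV"
    using 1 2 by (intro summable_on_add summable_on_cmult_right) (auto simp: eigseq_def)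
  show "(\<lambda>i. cmod (a * w i + b * v i)) summable_on UNIV"
    by (rule Infinite_Sum.abs_summable_on_comparison_test' [OF s]) (metis norm_mult norm_triangle_ineq)
  fix j
  have "(\<Sum>\<^sub>\<infinity>i. c (i - j) * (a * w i + b * v i)) = (\<Sum>\<^sub>\<infinity>i. a * (c (i - j) * w i) + b * (c (i - j) * v i))"
    by (rule infsum_cong) (simp add: algebra_simps)
  also have "\<dots> = a * (\<Sum>\<^sub>\<infinity>i. c (i - j) * w i) + b * (\<Sum>\<^sub>\<infinity>i. c (i - j) * v i)"
    unfolding infsum_cmult_right' [symmetric]
    by (intro infsum_add summable_on_cmult_right eigseq_summable [OF 1] eigseq_summable [OF 2])
  also have "\<dots> = of_real (\<nu> + denom n j) * (a * w j + b * v j)"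
    using 1 2 by (simp only: eigseq_def [of n \<nu>]) (simp add: algebra_simps flip: of_real_add)
  finally show "of_real (\<nu> + denom n j) * (a * w j + b * v j) = (\<Sum>\<^sub>\<infinity>i. c (i - j) * (a * w i + b * v i))" by simp
qed

text \<open>Self-adjointness on the sequence side: the double series with terms c (i - j) w i cnj (v
  j) converges absolutely, and its two iterated sums are the two sides of the symmetry identity. It
  also yields the summability of \<open>denom\<close> times w cnj v, which is not immediate because
  \<open>denom\<close> is unbounded.\<close>

lemma eigseq_orthogonal:
  assumes 1: "eigseq n \<nu> w" and 2: "eigseq n \<nu>' v" and ne: "\<nu> \<noteq> \<nu>'"
  shows "(\<Sum>\<^sub>\<infinity>j. w j * cnj (v j)) = 0"
proof -
  define h where "h = (\<lambda>(j, i). c (i - j) * w i * cnj (v j))"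
  have sw: "(\<lambda>i. cmod (w i)) summable_on UNIV" and sv: "(\<lambda>i. cmod (v i)) summable_on UNIV"
    using 1 2 by (auto simp: eigseq_def)
  have "(\<lambda>(j, i). cmod (v j) * cmod (w i)) summable_on UNIV \<times> UNIV"
  proof (rule summable_on_SigmaI [where g = "\<lambda>j. cmod (v j) * (\<Sum>\<^sub>\<infinity>i. cmod (w i))"])
    show "((\<lambda>i. case (j, i) of (j, i) \<Rightarrow> cmod (v j) * cmod (w i)) has_sum cmod (v j) * (\<Sum>\<^sub>\<infinity>i. cmod (w i))) UNIV" for j
      unfolding prod.case by (intro has_sum_cmult_right has_sum_infsum sw)
    show "(\<lambda>j. cmod (v j) * (\<Sum>\<^sub>\<infinity>i. cmod (w i))) summable_on UNIV"
      by (intro summable_on_cmult_left sv)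
  qed auto
  then have hs: "(\<lambda>(j, i). c (i - j) * w i * cnj (v j)) summable_on UNIV \<times> UNIV"
  proof (rule infsum_norm_bound(1))
    fix z show "cmod (case z of (j, i) \<Rightarrow> c (i - j) * w i * cnj (v j)) \<le> M * (case z of (j, i) \<Rightarrow> cmod (v j) * cmod (w i))"
      using mult_right_mono [OF c_le, of "cmod (w (snd z)) * cmod (v (fst z))"]
      by (cases z) (simp add: norm_mult mult_ac)
  qed
  have sp: "(\<lambda>j. w j * cnj (v j)) summable_on UNIV"
  proof -
    have "(\<lambda>(j, i). cmod (v j) * cmod (w i)) summable_on (\<lambda>j. (j, j)) ` UNIV"
      by (rule summable_on_subset [OF \<open>(\<lambda>(j, i). cmod (v j) * cmod (w i)) summable_on UNIV \<times> UNIV\<close>]) auto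
    then have "(\<lambda>j. cmod (v j) * cmod (w j)) summable_on UNIV"
      by (subst (asm) summable_on_reindex) (auto simp: inj_on_def o_def)
    then show ?thesis
      by (rule infsum_norm_bound(1) [where C = 1]) (simp add: norm_mult mult.commute)
  qed
  have L: "of_real (\<nu> + denom n j) * (w j * cnj (v j)) = (\<Sum>\<^sub>\<infinity>i. c (i - j) * w i * cnj (v j))" for j
  proof -
    have "of_real (\<nu> + denom n j) * w j = (\<Sum>\<^sub>\<infinity>i. c (i - j) * w i)" using 1 by (simp only: eigseq_def)
    then have "of_real (\<nu> + denom n j) * w j * cnj (v j) = (\<Sum>\<^sub>\<infinity>i. c (i - j) * w i * cnj (v j))"
      by (simp only: infsum_cmult_left')
    then show ?thesis by (simp only: mult.assoc)
  qed
  have R: "of_real (\<nu>' + denom n i) * (w i * cnj (v i)) = (\<Sum>\<^sub>\<infinity>j. c (i - j) * w i * cnj (v j))" for i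
  proof -
    have "of_real (\<nu>' + denom n i) * v i = (\<Sum>\<^sub>\<infinity>j. c (j - i) * v j)" using 2 by (simp only: eigseq_def)
    then have "cnj (of_real (\<nu>' + denom n i) * v i) = (\<Sum>\<^sub>\<infinity>j. cnj (c (j - i) * v j))"
      by (simp only: infsum_cnj)
    then have "w i * cnj (of_real (\<nu>' + denom n i) * v i) = (\<Sum>\<^sub>\<infinity>j. w i * cnj (c (j - i) * v j))"
      by (simp only: infsum_cmult_right')
    also have "(\<lambda>j. w i * cnj (c (j - i) * v j)) = (\<lambda>j. c (i - j) * w i * cnj (v j))"
    proof
      fix j show "w i * cnj (c (j - i) * v j) = c (i - j) * w i * cnj (v j)"
        using c_uminus [of "j - i"] by simp
    qed
    finally show ?thesis by (simp add: mult_ac)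
  qed
  have "(\<Sum>\<^sub>\<infinity>j. of_real (\<nu> + denom n j) * (w j * cnj (v j))) = (\<Sum>\<^sub>\<infinity>i. of_real (\<nu>' + denom n i) * (w i * cnj (v i)))"
    unfolding L R by (rule infsum_swap_banach [OF hs])
  moreover have sL: "(\<lambda>j. of_real (\<nu> + denom n j) * (w j * cnj (v j))) summable_on UNIV"
    unfolding L by (rule summable_on_Sigma_banach [OF hs])
  moreover have "(\<Sum>\<^sub>\<infinity>i. of_real (\<nu>' + denom n i) * (w i * cnj (v i)))
      = (\<Sum>\<^sub>\<infinity>i. of_real (\<nu> + denom n i) * (w i * cnj (v i)) + of_real (\<nu>' - \<nu>) * (w i * cnj (v i)))"
    by (rule infsum_cong) (simp add: algebra_simps)
  moreover have "\<dots> = (\<Sum>\<^sub>\<infinity>i. of_real (\<nu> + denom n i) * (w i * cnj (v i))) + of_real (\<nu>' - \<nu>) * (\<Sum>\<^sub>\<infinity>i. w i * cnj (v i))"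
    unfolding infsum_cmult_right' [symmetric] by (intro infsum_add sL summable_on_cmult_right sp)
  ultimately have "of_real (\<nu>' - \<nu>) * (\<Sum>\<^sub>\<infinity>i. w i * cnj (v i)) = 0" by simp
  then show ?thesis using ne by simp
qed

definition res_norm :: "nat \<Rightarrow> (int \<Rightarrow> complex) \<Rightarrow> real" where
  "res_norm n w = cmod (w 0) + cmod (w (2 * int n))"

lemma res_norm_nonneg: "res_norm n w \<ge> 0" by (simp add: res_norm_def)

text \<open>The constant 1/4, stricter than the 1/2 of the locale \<open>reduction\<close>, makes
  the nonresonant part at most half of the resonant one, as the orthogonality argument in
  \<open>near_distinct\<close> demands.\<close>

definition admissible :: "nat \<Rightarrow> real \<Rightarrow> bool" where
  "admissible n \<nu> \<longleftrightarrow> n > 0 \<and> \<bar>\<nu>\<bar> \<le> real n \<and> M * gap_sum n \<le> 1 / 4"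

lemma eigseq_reduction:
  assumes "eigseq n \<nu> w" "admissible n \<nu>"
  shows "reduction n c w \<nu> M"
  using assms c_le c_0 by unfold_locales (auto simp: eigseq_def admissible_def)

lemma off_norm_le:
  assumes e: "eigseq n \<nu> w" and ad: "admissible n \<nu>"
  shows "(\<Sum>\<^sub>\<infinity>i\<in>offres n. cmod (w i)) \<le> res_norm n w / 2"
proof -
  interpret reduction n c w \<nu> M by (rule eigseq_reduction [OF e ad])
  have "V \<le> (M * gap_sum n) * (2 * U)" using V_le(3) by (simp add: mult_ac)
  also have "\<dots> \<le> 1 / 4 * (2 * U)" using ad U0 by (intro mult_right_mono) (auto simp: admissible_def)
  finally show ?thesis by (simp add: V_def U_def res_norm_def)
qed

text \<open>The nonresonant entries are bounded by a multiple of the resonant size, so a solution is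
  determined by its two resonant entries.\<close>

lemma eigseq_eq_0:
  assumes e: "eigseq n \<nu> w" and ad: "admissible n \<nu>" and 0: "res_norm n w = 0"
  shows "w j = 0"
proof (cases "j \<in> offres n")
  case True
  interpret reduction n c w \<nu> M by (rule eigseq_reduction [OF e ad])
  have "U = 0" using 0 by (simp add: U_def res_norm_def)
  then show ?thesis using w_le' [OF True] by simp
next
  case False
  then have "j = 0 \<or> j = 2 * int n" by (auto simp: offres_def)
  then show ?thesis using 0 unfolding res_norm_def by (auto simp: add_nonneg_eq_0_iff)
qed

lemma res_norm_cnj: "res_norm n (\<lambda>j. cnj (w (2 * int n - j))) = res_norm n w"
  by (simp add: res_norm_def)

lemma eigseq_\<nu>_le:
  assumes e: "eigseq n \<nu> w" and ad: "admissible n \<nu>" and pos: "res_norm n w > 0"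
  shows "\<bar>\<nu>\<bar> \<le> shift_bound n"
proof -
  let ?U = "res_norm n w"
  have fo: "cmod (of_real \<nu> * w 0 - c (2 * int n) * w (2 * int n)) \<le> 2 * M\<^sup>2 * gap_sum n * res_norm n w"
    if "eigseq n \<nu> w" for w
    using reduction.first_order [OF eigseq_reduction [OF that ad]]
    by (simp add: res_norm_def reduction.U_def [OF eigseq_reduction [OF that ad]])
  have tri: "\<bar>\<nu>\<bar> * cmod x \<le> cmod (c (2 * int n)) * cmod y + cmod (of_real \<nu> * x - c (2 * int n) * y)" for x y
    using norm_triangle_ineq [of "of_real \<nu> * x - c (2 * int n) * y" "c (2 * int n) * y"]
    by (simp add: norm_mult)
  have 1: "\<bar>\<nu>\<bar> * cmod (w 0) \<le> cmod (c (2 * int n)) * cmod (w (2 * int n)) + 2 * M\<^sup>2 * gap_sum n * ?U"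
    using tri [of "w 0" "w (2 * int n)"] fo [OF e] by linarith
  have 2: "\<bar>\<nu>\<bar> * cmod (w (2 * int n)) \<le> cmod (c (2 * int n)) * cmod (w 0) + 2 * M\<^sup>2 * gap_sum n * ?U"
    using tri [of "cnj (w (2 * int n))" "cnj (w 0)"] fo [OF eigseq_cnj [OF e]] unfolding res_norm_cnj by simp
  have "\<bar>\<nu>\<bar> * ?U \<le> shift_bound n * ?U"
    using add_mono [OF 1 2] by (simp add: res_norm_def shift_bound_def algebra_simps)
  then show ?thesis using pos by simp
qed

lemma eigseq_second_order:
  assumes e: "eigseq n \<nu> w" and ad: "admissible n \<nu>"
  shows "cmod (of_real \<nu> * w 0 - A n * w 0 - \<beta> n * w (2 * int n)) \<le> rho n * res_norm n w"
proof (cases "res_norm n w = 0")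
  case True
  then show ?thesis by (simp add: eigseq_eq_0 [OF e ad])
next
  case False
  then have pos: "res_norm n w > 0" using res_norm_nonneg [of n w] by linarith
  interpret reduction n c w \<nu> M by (rule eigseq_reduction [OF e ad])
  have U: "U = res_norm n w" by (simp add: U_def res_norm_def)
  let ?G = "of_real \<nu> * w 0 - (red1 c n 0 + red2 c n 0) * w 0
      - (c (2 * int n) + red1 c n (2 * int n) + red2 c n (2 * int n)) * w (2 * int n)"
  have "of_real \<nu> * w 0 - A n * w 0 - \<beta> n * w (2 * int n) = ?G + red2 c n (2 * int n) * w (2 * int n)"
    by (simp add: A_def \<beta>_def algebra_simps)
  then have "cmod (of_real \<nu> * w 0 - A n * w 0 - \<beta> n * w (2 * int n))
      \<le> cmod ?G + cmod (red2 c n (2 * int n) * w (2 * int n))"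
    using norm_triangle_ineq by metis
  also have "\<dots> \<le> (2 * M ^ 4 * gap_sum n ^ 3 + 2 * M\<^sup>2 * gap_sq_sum n * (1 + M * gap_sum n) * \<bar>\<nu>\<bar>) * res_norm n w
      + cmod (red2 c n (2 * int n)) * res_norm n w"
    unfolding norm_mult [of "red2 c n (2 * int n)"] U [symmetric]
    by (intro add_mono second_order mult_left_mono) (simp_all add: U_def)
  also have "\<dots> \<le> (2 * M ^ 4 * gap_sum n ^ 3 + 2 * M\<^sup>2 * gap_sq_sum n * (1 + M * gap_sum n) * shift_bound n) * res_norm n w
      + cmod (red2 c n (2 * int n)) * res_norm n w"
    using gap_sum_nonneg gap_sq_sum_nonneg M_nonneg eigseq_\<nu>_le [OF e ad pos] pos
    by (intro add_mono mult_right_mono mult_left_mono order_refl) auto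
  also have "\<dots> = rho n * res_norm n w" by (simp add: rho_def algebra_simps)
  finally show ?thesis .
qed

section \<open>Eigencoordinates of the limit system and closeness to its eigenvalues\<close>

definition \<theta> :: "nat \<Rightarrow> complex" where "\<theta> n = (if \<beta> n = 0 then 1 else sgn (\<beta> n))"

lemma \<theta>: "cmod (\<theta> n) = 1" "\<beta> n = \<theta> n * of_real (cmod (\<beta> n))"
  by (auto simp: \<theta>_def norm_sgn) (simp add: sgn_eq)

text \<open>For \<sigma> = 1 and \<sigma> = -1 these are, up to scale, the coordinates along the
  eigenvectors of the Hermitian limit matrix for the eigenvalues A + \<sigma> |\<beta>|.\<close>

definition mode :: "nat \<Rightarrow> real \<Rightarrow> (int \<Rightarrow> complex) \<Rightarrow> complex" where
  "mode n \<sigma> w = w 0 + of_real \<sigma> * \<theta> n * w (2 * int n)"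

lemma mode_eq:
  assumes e: "eigseq n \<nu> w" and ad: "admissible n \<nu>" and \<sigma>: "\<sigma> = 1 \<or> \<sigma> = -1"
  shows "cmod (of_real \<nu> - A n - of_real (\<sigma> * cmod (\<beta> n))) * cmod (mode n \<sigma> w) \<le> 2 * (rho n * res_norm n w)"
  unfolding mode_def
proof (rule two_by_two [OF \<theta> \<sigma>])
  show "cmod (of_real \<nu> * w 0 - A n * w 0 - \<beta> n * w (2 * int n)) \<le> rho n * res_norm n w"
    by (rule eigseq_second_order [OF e ad])
  have n: "n > 0" using ad by (simp add: admissible_def)
  have "cmod (cnj (of_real \<nu> * cnj (w (2 * int n)) - A n * cnj (w (2 * int n)) - \<beta> n * cnj (w 0))) \<le> rho n * res_norm n w"
    using eigseq_second_order [OF eigseq_cnj [OF e] ad] unfolding res_norm_cnj complex_mod_cnj by simp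
  then show "cmod (of_real \<nu> * w (2 * int n) - A n * w (2 * int n) - cnj (\<beta> n) * w 0) \<le> rho n * res_norm n w"
    by (simp add: cnj_A [OF n])
qed

lemma res_norm_le_mode: "res_norm n w \<le> cmod (mode n 1 w) + cmod (mode n (-1) w)"
proof -
  have "2 * cmod (w 0) = cmod (mode n 1 w + mode n (-1) w)" by (simp add: mode_def norm_mult flip: mult_2)
  moreover have "2 * cmod (w (2 * int n)) = cmod (mode n 1 w - mode n (-1) w)"
  proof -
    have "mode n 1 w - mode n (-1) w = 2 * (\<theta> n * w (2 * int n))" by (simp add: mode_def)
    then show ?thesis by (simp add: norm_mult \<theta>)
  qed
  ultimately show ?thesis
    using norm_triangle_ineq [of "mode n 1 w" "mode n (-1) w"] norm_triangle_ineq4 [of "mode n 1 w" "mode n (-1) w"]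
    unfolding res_norm_def by linarith
qed

lemma mode_lincomb: "mode n \<sigma> (\<lambda>j. a * w j + b * v j) = a * mode n \<sigma> w + b * mode n \<sigma> v"
  by (simp add: mode_def algebra_simps)

definition near :: "nat \<Rightarrow> real \<Rightarrow> real \<Rightarrow> bool" where
  "near n \<nu> \<sigma> \<longleftrightarrow> cmod (of_real \<nu> - A n - of_real (\<sigma> * cmod (\<beta> n))) \<le> 4 * rho n"

text \<open>A mode carrying half of the resonant size turns the factor 2 of \<open>mode_eq\<close>
  into the 4 of \<open>near\<close>; by \<open>res_norm_le_mode\<close> at least one mode does
  so.\<close>

lemma near_if_mode:
  assumes e: "eigseq n \<nu> w" and ad: "admissible n \<nu>" and \<sigma>: "\<sigma> = 1 \<or> \<sigma> = -1" and pos: "res_norm n w > 0"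
    and c: "cmod (mode n \<sigma> w) \<ge> res_norm n w / 2"
  shows "near n \<nu> \<sigma>"
proof -
  have "cmod (of_real \<nu> - A n - of_real (\<sigma> * cmod (\<beta> n))) * (res_norm n w / 2)
      \<le> cmod (of_real \<nu> - A n - of_real (\<sigma> * cmod (\<beta> n))) * cmod (mode n \<sigma> w)"
    by (intro mult_left_mono c) auto
  also have "\<dots> \<le> 2 * (rho n * res_norm n w)" by (rule mode_eq [OF e ad \<sigma>])
  finally show ?thesis using pos by (simp add: near_def field_simps)
qed

lemma near_cases:
  assumes e: "eigseq n \<nu> w" and ad: "admissible n \<nu>" and pos: "res_norm n w > 0"
  shows "near n \<nu> 1 \<or> near n \<nu> (-1)"
  using near_if_mode [OF e ad _ pos, of 1] near_if_mode [OF e ad _ pos, of "-1"] res_norm_le_mode [of n w]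
  by force

lemma not_near_both:
  assumes "near n \<nu> 1" "near n \<nu> (-1)"
  shows "cmod (\<beta> n) \<le> 4 * rho n"
proof -
  let ?p = "of_real \<nu> - A n - of_real (1 * cmod (\<beta> n))" and ?m = "of_real \<nu> - A n - of_real (-1 * cmod (\<beta> n))"
  have "?m - ?p = 2 * of_real (cmod (\<beta> n))" by simp
  then have "cmod (?m - ?p) = 2 * cmod (\<beta> n)" by (simp only: norm_mult norm_of_real) simp
  then show ?thesis
    using norm_triangle_ineq4 [of ?m ?p] assms unfolding near_def by linarith
qed

text \<open>The opposite limit eigenvalue is at distance at least 2 |\<beta>| - 4 rho, which exceeds
  (5/3) |\<beta>| or equals it, while the right-hand side of \<open>mode_eq\<close> is at most
  |\<beta>| / 6 times the resonant size. The quotient is 1/10; the 12 in the hypothesis produces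
  these fractions.\<close>

lemma other_mode_small:
  assumes e: "eigseq n \<nu> w" and ad: "admissible n \<nu>" and \<sigma>: "\<sigma> = 1 \<or> \<sigma> = -1"
    and near: "near n \<nu> \<sigma>" and gap: "cmod (\<beta> n) > 12 * rho n"
  shows "cmod (mode n (- \<sigma>) w) \<le> res_norm n w / 10"
proof -
  let ?p = "of_real \<nu> - A n - of_real (\<sigma> * cmod (\<beta> n))" and ?m = "of_real \<nu> - A n - of_real (- \<sigma> * cmod (\<beta> n))"
  have "?m - ?p = 2 * of_real \<sigma> * of_real (cmod (\<beta> n))" by simp
  then have "cmod (?m - ?p) = 2 * cmod (\<beta> n)" using \<sigma> by (auto simp only: norm_mult norm_of_real) auto
  then have m: "cmod ?m \<ge> 2 * cmod (\<beta> n) - 4 * rho n"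
    using norm_triangle_ineq4 [of ?m ?p] near unfolding near_def by linarith
  define t where "t = cmod (mode n (- \<sigma>) w)"
  have "cmod ?m * t \<le> 2 * (rho n * res_norm n w)"
    unfolding t_def using \<sigma> by (intro mode_eq [OF e ad]) auto
  moreover have "(2 * cmod (\<beta> n) - 4 * rho n) * t \<le> cmod ?m * t" by (intro mult_right_mono m) (simp add: t_def)
  moreover have "(5 / 3 * cmod (\<beta> n)) * t \<le> (2 * cmod (\<beta> n) - 4 * rho n) * t"
    using gap by (intro mult_right_mono) (auto simp: t_def)
  moreover have "2 * (rho n * res_norm n w) \<le> 2 * ((cmod (\<beta> n) / 12) * res_norm n w)"
    using gap res_norm_nonneg by (intro mult_left_mono mult_right_mono) auto
  ultimately have "(5 / 3 * cmod (\<beta> n)) * t \<le> 2 * ((cmod (\<beta> n) / 12) * res_norm n w)" by linarith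
  then have "cmod (\<beta> n) * t \<le> cmod (\<beta> n) * (res_norm n w / 10)" by (simp add: field_simps)
  moreover have "cmod (\<beta> n) > 0" using gap rho_nonneg [of n] by linarith
  ultimately show ?thesis by (simp add: t_def)
qed

text \<open>Both solutions are concentrated on the same mode, so their inner product cannot vanish.
  With U and V the resonant sizes, the dominant product has modulus at least 0.81 U V, whereas
  orthogonality allows at most U V / 2 from the nonresonant entries plus U V / 100 from the other
  mode.\<close>

lemma near_distinct:
  assumes e: "eigseq n \<nu> w" and ad: "admissible n \<nu>" and pos: "res_norm n w > 0"
    and e': "eigseq n \<nu>' v" and ad': "admissible n \<nu>'" and pos': "res_norm n v > 0"
    and \<sigma>: "\<sigma> = 1 \<or> \<sigma> = -1" and near: "near n \<nu> \<sigma>" "near n \<nu>' \<sigma>" and gap: "cmod (\<beta> n) > 12 * rho n"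
  shows "\<nu> = \<nu>'"
proof (rule ccontr)
  assume "\<nu> \<noteq> \<nu>'"
  let ?U = "res_norm n w" and ?V = "res_norm n v"
  have n: "n > 0" using ad by (simp add: admissible_def)
  let ?p = "mode n \<sigma> w" and ?p' = "mode n \<sigma> v" and ?m = "mode n (- \<sigma>) w" and ?m' = "mode n (- \<sigma>) v"
  have m: "cmod ?m \<le> ?U / 10" "cmod ?m' \<le> ?V / 10"
    using other_mode_small [OF e ad \<sigma> near(1) gap] other_mode_small [OF e' ad' \<sigma> near(2) gap] by auto
  have "?U \<le> cmod ?p + cmod ?m" "?V \<le> cmod ?p' + cmod ?m'"
    using \<sigma> res_norm_le_mode [of n w] res_norm_le_mode [of n v] by auto
  then have p: "cmod ?p \<ge> 9 / 10 * ?U" "cmod ?p' \<ge> 9 / 10 * ?V" using m by auto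
  have t: "\<theta> n * cnj (\<theta> n) = 1" using \<theta>(1) [of n] complex_norm_square [of "\<theta> n"] by simp
  have "?p * cnj ?p' + ?m * cnj ?m' = 2 * (w 0 * cnj (v 0)) + 2 * (of_real \<sigma> * of_real \<sigma>) * (\<theta> n * cnj (\<theta> n)) * (w (2 * int n) * cnj (v (2 * int n)))"
    by (simp add: mode_def algebra_simps)
  also have "\<dots> = 2 * (w 0 * cnj (v 0) + w (2 * int n) * cnj (v (2 * int n)))"
    unfolding t using \<sigma> by auto
  finally have res: "?p * cnj ?p' + ?m * cnj ?m' = 2 * (w 0 * cnj (v 0) + w (2 * int n) * cnj (v (2 * int n)))" .
  have sw: "(\<lambda>i. cmod (w i)) summable_on UNIV" and sv: "(\<lambda>i. cmod (v i)) summable_on UNIV"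
    using e e' by (auto simp: eigseq_def)
  have swo: "(\<lambda>i. cmod (w i)) summable_on offres n" and svo: "(\<lambda>i. cmod (v i)) summable_on offres n"
    using sw sv summable_on_subset by blast+
  have wi: "cmod (w i) \<le> ?U / 2" if "i \<in> offres n" for i
    using finite_sum_le_infsum [OF swo, of "{i}"] off_norm_le [OF e ad] that by auto
  have b: "cmod (w i * cnj (v i)) \<le> ?U / 2 * cmod (v i)" if "i \<in> offres n" for i
    unfolding norm_mult complex_mod_cnj by (intro mult_right_mono wi that) auto
  have off: "cmod (\<Sum>\<^sub>\<infinity>i\<in>offres n. w i * cnj (v i)) \<le> ?U / 2 * (?V / 2)"
  proof -
    have "cmod (\<Sum>\<^sub>\<infinity>i\<in>offres n. w i * cnj (v i)) \<le> ?U / 2 * (\<Sum>\<^sub>\<infinity>i\<in>offres n. cmod (v i))"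
      by (rule infsum_norm_bound(2) [OF svo b])
    also have "\<dots> \<le> ?U / 2 * (?V / 2)"
      using pos by (intro mult_left_mono off_norm_le [OF e' ad']) auto
    finally show ?thesis .
  qed
  have sp: "(\<lambda>j. w j * cnj (v j)) summable_on UNIV"
  proof (rule infsum_norm_bound(1) [OF sv])
    fix i show "cmod (w i * cnj (v i)) \<le> (\<Sum>\<^sub>\<infinity>i. cmod (w i)) * cmod (v i)"
      using finite_sum_le_infsum [OF sw, of "{i}"] by (simp add: norm_mult mult_right_mono)
  qed
  have "w 0 * cnj (v 0) + w (2 * int n) * cnj (v (2 * int n)) = - (\<Sum>\<^sub>\<infinity>i\<in>offres n. w i * cnj (v i))"
    using infsum_split_offres [OF n sp] eigseq_orthogonal [OF e e' \<open>\<nu> \<noteq> \<nu>'\<close>] by (simp add: add_eq_0_iff2)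
  then have "cmod (?p * cnj ?p' + ?m * cnj ?m') \<le> 2 * (?U / 2 * (?V / 2))"
    unfolding res using off by (simp add: norm_mult mult.commute)
  moreover have "cmod (?p * cnj ?p') \<le> cmod (?p * cnj ?p' + ?m * cnj ?m') + cmod (?m * cnj ?m')"
    using norm_triangle_ineq4 [of "?p * cnj ?p' + ?m * cnj ?m'" "?m * cnj ?m'"] by simp
  moreover have "(9 / 10 * ?U) * (9 / 10 * ?V) \<le> cmod (?p * cnj ?p')"
    unfolding norm_mult complex_mod_cnj using pos pos' by (intro mult_mono p) auto
  moreover have "cmod (?m * cnj ?m') \<le> (?U / 10) * (?V / 10)"
    unfolding norm_mult complex_mod_cnj using pos pos' by (intro mult_mono m) auto
  moreover have "?U * ?V > 0" using pos pos' by simp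
  ultimately show False by (simp add: field_simps)
qed

end

subsection \<open>Eigenfunctions and their Fourier coefficients\<close>

lemma tendsto_0_le_pos:
  fixes f g :: "nat \<Rightarrow> real"
  assumes "\<And>n. 0 \<le> f n" "\<And>n. n > 0 \<Longrightarrow> f n \<le> g n" "g \<longlonglongrightarrow> 0"
  shows "f \<longlonglongrightarrow> 0"
  by (rule tendsto_sandwich [OF _ _ tendsto_const assms(3)])
    (use assms(1,2) in \<open>auto intro!: eventually_sequentiallyI [of 1]\<close>)

context potential
begin

text \<open>Two applications of \<open>fc_primitive\<close>, one for each periodic boundary
  condition, give the coefficients of the second derivative. Their boundedness makes those of y
  decay like k^-2, hence sum absolutely, and this permits the termwise expansion of q y for a merely
  integrable q.\<close>

lemma eigenfunction_coeffs:
  assumes y: "hill_graph q y (\<lambda>x. \<mu> * y x)"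
  shows "(\<lambda>k. cmod (fc y k)) summable_on UNIV"
    and "\<And>k. (\<mu> - (2 * pi * of_int k)\<^sup>2) * fc y k = (\<Sum>\<^sub>\<infinity>m. fc y m * c (k - m))"
    and "\<And>x. x \<in> {0..1} \<Longrightarrow> y x = (\<Sum>\<^sub>\<infinity>k. fc y k * chr k x)"
    and "integrable LI y"
proof -
  obtain d d2 where d: "\<And>x. x \<in> {0..1} \<Longrightarrow> (y has_vector_derivative d x) (at x within {0..1})"
    and d2: "d2 absolutely_integrable_on {0..1}"
    and dx: "\<And>x. x \<in> {0..1} \<Longrightarrow> d x = d 0 + (LINT t:{0..x}|lebesgue. d2 t)"
    and per: "y 1 = y 0" "d 1 = d 0"
    and ae: "AE x in LI. \<mu> * y x = - d2 x + of_real (q x) * y x"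
    using y unfolding hill_graph_def by blast
  have d2i: "integrable LI d2" using d2 by (simp add: set_integrable_eq_LI)
  have yc: "continuous_on {0..1} y"
    using d by (meson continuous_on_eq_continuous_within has_vector_derivative_continuous)
  show yi: "integrable LI y" by (rule integrable_LI_continuous [OF yc])
  have "continuous_on {0..1} (\<lambda>x. d 0 + (LINT t:{0..x}|lebesgue. d2 t))"
    by (intro continuous_intros continuous_on_primitive [OF d2i])
  then have dc: "continuous_on {0..1} d" by (rule continuous_on_eq) (rule dx [symmetric])
  have di: "integrable LI d" by (rule integrable_LI_continuous [OF dc])
  have d20: "integral\<^sup>L LI d2 = 0" using dx [of 1] per(2) by (simp add: LINT_set_eq)
  have yd: "y x = y 0 + (LINT t:{0..x}|lebesgue. d t)" if "x \<in> {0..1}" for x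
    using set_integral_vector_derivative [OF d dc that] by simp
  have d0: "integral\<^sup>L LI d = 0" using yd [of 1] per(1) by (simp add: LINT_set_eq)
  have f1: "fc d2 k = 2 * pi * \<i> * of_int k * fc d k" for k by (rule fc_primitive [OF d2i d20 dx])
  have f2: "fc d k = 2 * pi * \<i> * of_int k * fc y k" for k by (rule fc_primitive [OF di d0 yd])
  have f: "fc d2 k = - ((2 * pi * of_int k)\<^sup>2 * fc y k)" for k
  proof -
    have "fc d2 k = (\<i> * \<i>) * ((2 * pi * of_int k)\<^sup>2 * fc y k)"
      unfolding f1 f2 by (simp add: power2_eq_square mult_ac)
    then show ?thesis by simp
  qed
  have qy: "integrable LI (\<lambda>x. of_real (q x) * y x)" by (rule integrable_LI_mult_continuous [OF qc_int yc])
  have eqn: "\<mu> * fc y k = (2 * pi * of_int k)\<^sup>2 * fc y k + fc (\<lambda>x. of_real (q x) * y x) k" for k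
  proof -
    have "fc (\<lambda>x. \<mu> * y x) k = fc (\<lambda>x. of_real (q x) * y x - d2 x) k"
      unfolding fc_def
    proof (rule integral_cong_AE)
      show "(\<lambda>x. \<mu> * y x * chr (- k) x) \<in> borel_measurable LI"
        by (intro measurable_LI_continuous continuous_intros yc)
      have "integrable LI (\<lambda>x. (of_real (q x) * y x - d2 x) * chr (- k) x)"
        by (intro integrable_mult_chr Bochner_Integration.integrable_diff qy d2i)
      then show "(\<lambda>x. (of_real (q x) * y x - d2 x) * chr (- k) x) \<in> borel_measurable LI" by auto
      show "AE x in LI. \<mu> * y x * chr (- k) x = (of_real (q x) * y x - d2 x) * chr (- k) x"
        using ae by eventually_elim simp
    qed
    then show ?thesis by (simp add: fc_cmult fc_diff [OF qy d2i] f)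
  qed
  let ?D = "\<integral>x. cmod (d2 x) \<partial>LI"
  have "cmod (fc y k) \<le> ?D * \<bar>of_int k\<bar> powr (- 2)" if "k \<in> {k. k \<noteq> 0}" for k
  proof -
    have k: "\<bar>of_int k\<bar> > (0::real)" using that by simp
    have "(2 * pi * of_int k)\<^sup>2 * cmod (fc y k) = cmod (fc d2 k)"
      unfolding f by (simp add: norm_mult norm_power power_mult_distrib)
    also have "\<dots> \<le> ?D" by (rule fc_bound [OF d2i])
    finally have 1: "(2 * pi * of_int k)\<^sup>2 * cmod (fc y k) \<le> ?D" .
    have "1 * (of_int k)\<^sup>2 * cmod (fc y k) \<le> (4 * pi\<^sup>2) * (of_int k)\<^sup>2 * cmod (fc y k)"
      using four_pi_sq by (intro mult_right_mono) auto
    with 1 have "(of_int k)\<^sup>2 * cmod (fc y k) \<le> ?D" by (simp add: power_mult_distrib)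
    then have "cmod (fc y k) \<le> ?D * (1 / (of_int k)\<^sup>2)" using k by (simp add: pos_le_divide_eq mult.commute)
    moreover have "\<bar>real_of_int k\<bar> powr (- 2) = 1 / (of_int k)\<^sup>2"
      using k by (simp add: powr_minus_divide)
    ultimately show ?thesis by (simp only:)
  qed
  then have "(\<lambda>k. cmod (fc y k)) summable_on {k. k \<noteq> 0}"
    by (intro Infinite_Sum.abs_summable_on_comparison_test' [OF summable_on_cmult_right [OF summable_int_powr [of 2]], of _ ?D]) auto
  then have "(\<lambda>k. cmod (fc y k)) summable_on insert 0 {k. k \<noteq> 0}" by (simp only: summable_on_insert_iff)
  moreover have "insert 0 {k::int. k \<noteq> 0} = UNIV" by auto
  ultimately show s: "(\<lambda>k. cmod (fc y k)) summable_on UNIV" by simp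
  show ser: "y x = (\<Sum>\<^sub>\<infinity>k. fc y k * chr k x)" if "x \<in> {0..1}" for x
    by (rule fourier_unique [OF yc per(1) series_continuous [OF s] _ _ that])
      (simp_all add: fc_series [OF s])
  show "(\<mu> - (2 * pi * of_int k)\<^sup>2) * fc y k = (\<Sum>\<^sub>\<infinity>m. fc y m * c (k - m))" for k
  proof -
    have "fc (\<lambda>x. of_real (q x) * y x) k = fc (\<lambda>x. of_real (q x) * (\<Sum>\<^sub>\<infinity>i. fc y i * chr i x)) k"
      unfolding fc_def [of "\<lambda>x. of_real (q x) * y x"] fc_def [of "\<lambda>x. of_real (q x) * (\<Sum>\<^sub>\<infinity>i. fc y i * chr i x)"]
      by (rule Bochner_Integration.integral_cong) (simp_all add: ser)
    also have "\<dots> = (\<Sum>\<^sub>\<infinity>m. fc y m * c (k - m))"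
      using fc_mult_series [OF qc_int s, of k] by (simp add: has_sum_iff c_def)
    finally show ?thesis using eqn [of k] by (simp add: algebra_simps)
  qed
qed

definition recentre :: "nat \<Rightarrow> (real \<Rightarrow> complex) \<Rightarrow> int \<Rightarrow> complex" where
  "recentre n y j = fc y (int n - j)"

lemma eigseq_recentre:
  assumes y: "y \<in> eigenspace q (of_real lam)"
  shows "eigseq n (lam - (2 * pi * real n)\<^sup>2) (recentre n y)"
proof -
  have h: "hill_graph q y (\<lambda>x. of_real lam * y x)" using y by (simp add: eigenspace_def)
  note E = eigenfunction_coeffs [OF h]
  show ?thesis
    unfolding eigseq_def
  proof (intro conjI allI)
    have "((\<lambda>i. cmod (recentre n y i)) summable_on UNIV) \<longleftrightarrow> (\<lambda>i. cmod (fc y i)) summable_on UNIV"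
      unfolding recentre_def
      by (rule summable_on_reindex_bij_witness [of _ "\<lambda>l. int n - l" "\<lambda>l. int n - l"]) auto
    then show "(\<lambda>i. cmod (recentre n y i)) summable_on UNIV" using E(1) by simp
    fix j
    have 1: "(\<Sum>\<^sub>\<infinity>m. fc y m * c (int n - j - m)) = (\<Sum>\<^sub>\<infinity>i. c (i - j) * recentre n y i)"
      unfolding recentre_def
      by (rule infsum_reindex_bij_witness [of _ "\<lambda>l. int n - l" "\<lambda>l. int n - l"]) (auto simp: algebra_simps)
    have 2: "of_real (lam - (2 * pi * real n)\<^sup>2 + denom n j) = complex_of_real lam - (2 * pi * of_int (int n - j))\<^sup>2"
      by (simp add: denom_def)
    show "of_real (lam - (2 * pi * real n)\<^sup>2 + denom n j) * recentre n y j
        = (\<Sum>\<^sub>\<infinity>i. c (i - j) * recentre n y i)"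
      unfolding 2 1 [symmetric] unfolding recentre_def by (rule E(2))
  qed
qed

lemma eigenfunction_eq_0:
  assumes y: "y \<in> eigenspace q \<mu>" and y': "y' \<in> eigenspace q \<mu>"
    and 0: "\<And>k. a * recentre n y k + b * recentre n y' k = 0"
  shows "a * y x + b * y' x = 0"
proof (cases "x \<in> {0..1}")
  case True
  have h: "hill_graph q y (\<lambda>x. \<mu> * y x)" "hill_graph q y' (\<lambda>x. \<mu> * y' x)"
    using y y' by (auto simp: eigenspace_def)
  note E = eigenfunction_coeffs [OF h(1)] and E' = eigenfunction_coeffs [OF h(2)]
  have s: "(\<lambda>k. fc y k * chr k x) summable_on UNIV" "(\<lambda>k. fc y' k * chr k x) summable_on UNIV"
    by (rule infsum_norm_bound(1) [OF E(1), where C = 1], simp add: norm_mult,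
        rule infsum_norm_bound(1) [OF E'(1), where C = 1], simp add: norm_mult)
  have "a * y x + b * y' x = (\<Sum>\<^sub>\<infinity>k. a * (fc y k * chr k x)) + (\<Sum>\<^sub>\<infinity>k. b * (fc y' k * chr k x))"
    unfolding infsum_cmult_right' E(3) [OF True, symmetric] E'(3) [OF True, symmetric] ..
  also have "\<dots> = (\<Sum>\<^sub>\<infinity>k. a * (fc y k * chr k x) + b * (fc y' k * chr k x))"
    by (intro infsum_add [symmetric] summable_on_cmult_right s)
  also have "\<dots> = 0"
  proof (rule infsum_0)
    fix k
    have "a * fc y k + b * fc y' k = 0" using 0 [of "int n - k"] by (simp add: recentre_def)
    then show "a * (fc y k * chr k x) + b * (fc y' k * chr k x) = 0"
      by (metis distrib_right mult.assoc mult_zero_left)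
  qed
  finally show ?thesis .
next
  case False
  then show ?thesis using y y' by (auto simp: eigenspace_def)
qed

text \<open>A nonzero combination of two independent eigenfunctions can be made to have no component
  in the mode - \<sigma>. The sign is arbitrary, so a double eigenvalue is close to both
  limits.\<close>

lemma near_if_dim_ge_2:
  assumes y: "y \<in> eigenspace q (of_real lam)" and y': "y' \<in> eigenspace q (of_real lam)"
    and ind: "\<And>a b. (\<forall>x. a * y x + b * y' x = 0) \<Longrightarrow> a = 0 \<and> b = 0"
    and ad: "admissible n (lam - (2 * pi * real n)\<^sup>2)" and \<sigma>: "\<sigma> = 1 \<or> \<sigma> = -1"
  shows "near n (lam - (2 * pi * real n)\<^sup>2) \<sigma>"
proof -
  let ?w = "recentre n y" and ?v = "recentre n y'" and ?\<nu> = "lam - (2 * pi * real n)\<^sup>2"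
  \<comment> \<open>A kernel vector of the functional \<open>mode n (- \<sigma>)\<close> on the
    span; (1, 0) is taken if the functional vanishes on both generators.\<close>
  define a where "a = (if mode n (- \<sigma>) ?w = 0 \<and> mode n (- \<sigma>) ?v = 0 then 1 else mode n (- \<sigma>) ?v)"
  define b where "b = (if mode n (- \<sigma>) ?w = 0 \<and> mode n (- \<sigma>) ?v = 0 then 0 else - mode n (- \<sigma>) ?w)"
  have ab: "\<not> (a = 0 \<and> b = 0)" by (auto simp: a_def b_def)
  define z where "z j = a * ?w j + b * ?v j" for j
  have e: "eigseq n ?\<nu> z" unfolding z_def by (intro eigseq_lincomb eigseq_recentre y y')
  have 0: "mode n (- \<sigma>) z = 0" unfolding z_def mode_lincomb by (auto simp: a_def b_def)
  have pos: "res_norm n z > 0"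
  proof (rule ccontr)
    assume "\<not> res_norm n z > 0"
    then have "res_norm n z = 0" using res_norm_nonneg [of n z] by linarith
    then have "z j = 0" for j by (rule eigseq_eq_0 [OF e ad])
    then have "\<forall>x. a * y x + b * y' x = 0"
      using eigenfunction_eq_0 [OF y y', of a n b] by (simp add: z_def)
    then show False using ind ab by blast
  qed
  have "res_norm n z \<le> cmod (mode n \<sigma> z)"
    using res_norm_le_mode [of n z] \<sigma> 0 by auto
  then show ?thesis using res_norm_nonneg [of n z] by (intro near_if_mode [OF e ad \<sigma> pos]) linarith
qed

lemma eigenfunction_res_norm_pos:
  assumes y: "y \<in> eigenspace q (of_real lam)" "y \<noteq> 0" and ad: "admissible n (lam - (2 * pi * real n)\<^sup>2)"
  shows "res_norm n (recentre n y) > 0"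
proof (rule ccontr)
  assume "\<not> ?thesis"
  then have "res_norm n (recentre n y) = 0" using res_norm_nonneg [of n "recentre n y"] by linarith
  then have "recentre n y j = 0" for j by (rule eigseq_eq_0 [OF eigseq_recentre [OF y(1)] ad])
  then have "1 * y x + 0 * y x = 0" for x by (intro eigenfunction_eq_0 [OF y(1) y(1), of _ n]) simp
  then show False using y(2) by (simp add: fun_eq_iff)
qed

section \<open>Eigenfunctions extracted from multiplicities\<close>

lemma multiplicity_basis:
  obtains B where "B \<subseteq> eigenspace q \<mu>" "cfun.independent B" "card B = multiplicity_of q \<mu>"
  unfolding multiplicity_of_def using cfun.basis_exists by metis

lemma multiplicity_pos:
  assumes "multiplicity_of q \<mu> \<ge> 1"
  obtains y where "y \<in> eigenspace q \<mu>" "y \<noteq> 0"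
proof -
  obtain B where B: "B \<subseteq> eigenspace q \<mu>" "cfun.independent B" "card B = multiplicity_of q \<mu>"
    by (rule multiplicity_basis)
  then have "B \<noteq> {}" using assms by auto
  then obtain y where "y \<in> B" by blast
  moreover have "y \<noteq> 0" using cfun.dependent_zero [of B] B(2) \<open>y \<in> B\<close> by blast
  ultimately show ?thesis using that B(1) by blast
qed

lemma multiplicity_ge_2:
  assumes "multiplicity_of q \<mu> \<ge> 2"
  obtains y y' where "y \<in> eigenspace q \<mu>" "y' \<in> eigenspace q \<mu>"
    "\<And>a b. (\<forall>x. a * y x + b * y' x = 0) \<Longrightarrow> a = 0 \<and> b = 0"
proof -
  obtain B where B: "B \<subseteq> eigenspace q \<mu>" "cfun.independent B" "card B = multiplicity_of q \<mu>"
    by (rule multiplicity_basis)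
  then have "2 \<le> card B" using assms by simp
  then obtain T where T: "T \<subseteq> B" "card T = 2" using obtain_subset_with_card_n by metis
  then obtain y y' where yy: "T = {y, y'}" "y \<noteq> y'" by (auto simp: card_2_iff)
  have "a = 0 \<and> b = 0" if 0: "\<forall>x. a * y x + b * y' x = 0" for a b
  proof -
    define u where "u v = (if v = y then a else b)" for v
    have uy: "u y = a" "u y' = b" using yy(2) by (auto simp: u_def)
    have "(\<Sum>v\<in>T. (\<lambda>x. u v * v x)) = (\<lambda>x. u y * y x) + (\<lambda>x. u y' * y' x)"
      using yy by simp
    also have "\<dots> = 0" unfolding uy using 0 by (auto simp: fun_eq_iff)
    finally have "(\<Sum>v\<in>T. (\<lambda>x. u v * v x)) = 0" .
    then have "u v = 0" if "v \<in> T" for v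
      using cfun.independentD [OF B(2) _ T(1), of u v] that yy by auto
    then show ?thesis using yy uy by auto
  qed
  then show ?thesis using that T(1) B(1) yy(1) by blast
qed

section \<open>Decay rates of the error terms\<close>

lemma gap_sum_tendsto: "gap_sum \<longlonglongrightarrow> 0" and cube_gap_sum_tendsto: "(\<lambda>n. (real n)\<^sup>2 * gap_sum n ^ 3) \<longlonglongrightarrow> 0"
proof -
  obtain C where C: "C > 0" "\<And>n. n > 0 \<Longrightarrow> gap_sum n \<le> C * real n powr (- (3/4))"
    using gap_sum_le by blast
  have "(\<lambda>n. C * real n powr (- (3/4))) \<longlonglongrightarrow> C * 0"
    by (intro tendsto_mult tendsto_const tendsto_neg_powr filterlim_real_sequentially) auto
  then show "gap_sum \<longlonglongrightarrow> 0"
    by (intro tendsto_0_le_pos [OF gap_sum_nonneg C(2)]) auto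
  have lim: "(\<lambda>n. C ^ 3 * real n powr (- (1/4))) \<longlonglongrightarrow> C ^ 3 * 0"
    by (intro tendsto_mult tendsto_const tendsto_neg_powr filterlim_real_sequentially) auto
  have nonneg: "0 \<le> (real n)\<^sup>2 * gap_sum n ^ 3" for n
    by (intro mult_nonneg_nonneg zero_le_power gap_sum_nonneg) auto
  have le: "(real n)\<^sup>2 * gap_sum n ^ 3 \<le> C ^ 3 * real n powr (- (1/4))" if "n > 0" for n
  proof -
    have "(real n)\<^sup>2 * gap_sum n ^ 3 \<le> (real n)\<^sup>2 * (C * real n powr (- (3/4))) ^ 3"
      using C(2) [OF that] gap_sum_nonneg by (intro mult_left_mono power_mono) auto
    also have "\<dots> = C ^ 3 * (real n powr 2 * (real n powr (- (3/4))) ^ 3)"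
      using that by (simp add: power_mult_distrib)
    also have "(real n powr (- (3/4))) ^ 3 = real n powr (- (9/4))"
      by (simp add: power3_eq_cube flip: powr_add)
    also have "real n powr 2 * real n powr (- (9/4)) = real n powr (- (1/4))"
      using powr_add [of "real n" 2 "- (9/4)"] by simp
    finally show ?thesis .
  qed
  show "(\<lambda>n. (real n)\<^sup>2 * gap_sum n ^ 3) \<longlonglongrightarrow> 0"
    using lim by (intro tendsto_0_le_pos [OF nonneg le]) auto
qed

lemma shift_bound_tendsto: "shift_bound \<longlonglongrightarrow> 0"
proof -
  have "(\<lambda>n. cmod (c (2 * int n)) + 4 * M\<^sup>2 * gap_sum n) \<longlonglongrightarrow> 0 + 4 * M\<^sup>2 * 0"
    using tendsto_norm [OF Riemann_Lebesgue [OF q_int]] gap_sum_tendsto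
    by (intro tendsto_add tendsto_mult tendsto_const) (auto simp: c_def)
  then show ?thesis by (simp add: shift_bound_def [abs_def])
qed

text \<open>After multiplication by n^2, the cube of \<open>gap_sum\<close> tends to 0 at the rate n
  powr (-1/4), \<open>gap_sq_sum\<close> stays bounded but is multiplied by
  \<open>shift_bound\<close>, and the off-diagonal \<open>red2\<close> is covered by
  \<open>red2_small\<close>.\<close>

lemma rho_small: "(\<lambda>n. (real n)\<^sup>2 * rho n) \<longlonglongrightarrow> 0"
proof -
  obtain K where K: "K > 0" "\<And>n. n > 0 \<Longrightarrow> gap_sq_sum n \<le> K / (real n)\<^sup>2"
    using gap_sq_sum_le by blast
  have sb0: "shift_bound n \<ge> 0" for n
    by (simp add: shift_bound_def gap_sum_nonneg)
  let ?f = "\<lambda>n. 2 * M ^ 4 * ((real n)\<^sup>2 * gap_sum n ^ 3) + 2 * M\<^sup>2 * K * (1 + M * gap_sum n) * shift_bound n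
      + (real n)\<^sup>2 * cmod (red2 c n (2 * int n))"
  have "?f \<longlonglongrightarrow> 2 * M ^ 4 * 0 + 2 * M\<^sup>2 * K * (1 + M * 0) * 0 + 0"
    by (intro tendsto_intros cube_gap_sum_tendsto gap_sum_tendsto shift_bound_tendsto red2_small)
  then have f: "?f \<longlonglongrightarrow> 0" by simp
  have le: "(real n)\<^sup>2 * rho n \<le> ?f n" if "n > 0" for n
  proof -
    have "(real n)\<^sup>2 * gap_sq_sum n \<le> K" using K(2) [OF that] that by (simp add: field_simps)
    then have "(2 * M\<^sup>2 * (1 + M * gap_sum n) * shift_bound n) * ((real n)\<^sup>2 * gap_sq_sum n)
        \<le> (2 * M\<^sup>2 * (1 + M * gap_sum n) * shift_bound n) * K"
      using M_nonneg gap_sum_nonneg sb0 by (intro mult_left_mono) auto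
    then show ?thesis by (simp add: rho_def algebra_simps)
  qed
  show ?thesis by (rule tendsto_0_le_pos [OF _ le f]) (simp_all add: rho_nonneg)
qed

lemma multiplicity_le_1:
  assumes ad: "admissible n (lam - (2 * pi * real n)\<^sup>2)" and gap: "cmod (\<beta> n) > 12 * rho n"
  shows "multiplicity_of q (of_real lam) \<le> 1"
proof (rule ccontr)
  assume "\<not> ?thesis"
  then have "multiplicity_of q (of_real lam) \<ge> 2" by simp
  then obtain y y' where y: "y \<in> eigenspace q (of_real lam)" "y' \<in> eigenspace q (of_real lam)"
    and ind: "\<And>a b. (\<forall>x. a * y x + b * y' x = 0) \<Longrightarrow> a = 0 \<and> b = 0"
    by (rule multiplicity_ge_2) blast
  have "near n (lam - (2 * pi * real n)\<^sup>2) 1" "near n (lam - (2 * pi * real n)\<^sup>2) (-1)"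
    using near_if_dim_ge_2 [OF y ind ad] by blast+
  from not_near_both [OF this] show False using gap rho_nonneg [of n] by linarith
qed

text \<open>Of the four possible assignments, equal signs contradict \<open>near_distinct\<close>.
  The crossed one is impossible because l2 - l1 + 2 |\<beta>| would be at most 8 rho although l2 >
  l1.\<close>

lemma eigenvalue_pair:
  fixes l1 l2 :: real
  assumes ad: "admissible n (l1 - (2 * pi * real n)\<^sup>2)" "admissible n (l2 - (2 * pi * real n)\<^sup>2)"
    and gap: "cmod (\<beta> n) > 12 * rho n" and lt: "l1 < l2"
    and m: "multiplicity_of q (of_real l1) \<ge> 1" "multiplicity_of q (of_real l2) \<ge> 1"
  shows "near n (l1 - (2 * pi * real n)\<^sup>2) (-1)" "near n (l2 - (2 * pi * real n)\<^sup>2) 1"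
proof -
  let ?\<nu> = "\<lambda>l. l - (2 * pi * real n)\<^sup>2"
  have ex: "\<exists>w. eigseq n (?\<nu> l) w \<and> res_norm n w > 0"
    if l: "multiplicity_of q (of_real l) \<ge> 1" and "admissible n (?\<nu> l)" for l
  proof -
    obtain y where "y \<in> eigenspace q (of_real l)" "y \<noteq> 0" using multiplicity_pos [OF l] .
    then show ?thesis using eigseq_recentre eigenfunction_res_norm_pos that(2) by blast
  qed
  obtain w where w: "eigseq n (?\<nu> l1) w" "res_norm n w > 0" using ex [OF m(1) ad(1)] by blast
  obtain v where v: "eigseq n (?\<nu> l2) v" "res_norm n v > 0" using ex [OF m(2) ad(2)] by blast
  have excl: "\<not> (near n (?\<nu> l1) \<sigma> \<and> near n (?\<nu> l2) \<sigma>)" if "\<sigma> = 1 \<or> \<sigma> = -1" for \<sigma>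
    using near_distinct [OF w(1) ad(1) w(2) v(1) ad(2) v(2) that _ _ gap] lt by auto
  have "\<not> (near n (?\<nu> l1) 1 \<and> near n (?\<nu> l2) (-1))"
  proof
    assume *: "near n (?\<nu> l1) 1 \<and> near n (?\<nu> l2) (-1)"
    let ?p = "of_real (?\<nu> l1) - A n - of_real (1 * cmod (\<beta> n))"
    let ?m = "of_real (?\<nu> l2) - A n - of_real (-1 * cmod (\<beta> n))"
    have "?m - ?p = of_real (l2 - l1 + 2 * cmod (\<beta> n))" by simp
    then have "cmod (?m - ?p) = l2 - l1 + 2 * cmod (\<beta> n)" using lt by (simp only: norm_of_real) simp
    then show False
      using norm_triangle_ineq4 [of ?m ?p] * lt gap rho_nonneg [of n] unfolding near_def by linarith
  qed
  then show "near n (?\<nu> l1) (-1)" "near n (?\<nu> l2) 1"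
    using near_cases [OF w(1) ad(1) w(2)] near_cases [OF v(1) ad(2) v(2)] excl [of 1] excl [of "-1"] by auto
qed

section \<open>Consequences of the labelling of the large eigenvalues\<close>

lemma large_eigenvalues_window:
  assumes L: "large_eigenvalues q N0 lam"
  shows "\<forall>\<^sub>F n in sequentially. \<forall>j\<in>{1, 2}. \<bar>lam n j - (2 * pi * real n)\<^sup>2\<bar> \<le> real n"
proof -
  have "\<forall>\<^sub>F n in sequentially. \<bar>lam n j - (2 * pi * real n)\<^sup>2\<bar> \<le> real n" if j: "j \<in> {1, 2}" for j
  proof -
    have "(\<lambda>n. lam n j - (2 * pi * real n)\<^sup>2) \<in> O(\<lambda>n. sqrt (real n))"
      using L j unfolding large_eigenvalues_def by blast
    then obtain C where "C > 0" and C: "\<forall>\<^sub>F n in sequentially. norm (lam n j - (2 * pi * real n)\<^sup>2) \<le> C * norm (sqrt (real n))"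
      by (rule landau_o.bigE)
    show ?thesis
      using C eventually_ge_at_top [of "nat \<lceil>C\<^sup>2\<rceil>"]
    proof eventually_elim
      case (elim n)
      then have "C\<^sup>2 \<le> real n" by linarith
      then have "C \<le> sqrt (real n)" by (rule real_le_rsqrt)
      then have "C * sqrt (real n) \<le> sqrt (real n) * sqrt (real n)" by (intro mult_right_mono) auto
      then show ?case using elim by simp
    qed
  qed
  then show ?thesis by (simp add: eventually_conj_iff)
qed

lemma large_eigenvalues_multiplicity:
  assumes L: "large_eigenvalues q N0 lam"
  shows "\<forall>\<^sub>F n in sequentially. \<forall>j\<in>{1, 2}. multiplicity_of q (of_real (lam n j)) \<ge> 1 \<and>
    (lam n 1 = lam n 2 \<longrightarrow> multiplicity_of q (of_real (lam n j)) \<ge> 2)"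
proof -
  obtain N1 where N1: "\<And>n j. n \<ge> N1 \<Longrightarrow> j \<in> {1, 2} \<Longrightarrow> \<bar>lam n j - (2 * pi * real n)\<^sup>2\<bar> \<le> real n"
    using large_eigenvalues_window [OF L] unfolding eventually_sequentially by blast
  have grow: "lam n j \<ge> real n" if "n \<ge> N1" "j \<in> {1, 2}" for n j
  proof -
    have "36 * (real n)\<^sup>2 \<le> 4 * pi\<^sup>2 * (real n)\<^sup>2" using four_pi_sq by (intro mult_right_mono) auto
    then have "36 * (real n)\<^sup>2 \<le> (2 * pi * real n)\<^sup>2" by (simp add: power_mult_distrib)
    moreover have "real n \<le> (real n)\<^sup>2" by (cases "n = 0") (auto simp: power2_eq_square)
    moreover have "0 \<le> (real n)\<^sup>2" by simp
    ultimately show ?thesis using N1 [OF that] by linarith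
  qed
  obtain R where R: "\<And>\<mu>. cmod \<mu> > R \<Longrightarrow>
      multiplicity_of q \<mu> = card {(n, j). n \<ge> N0 \<and> j \<in> {1, 2} \<and> of_real (lam n j) = \<mu>}"
    using L unfolding large_eigenvalues_def by blast
  show ?thesis
    using eventually_ge_at_top [of N1] eventually_ge_at_top [of N0] eventually_gt_at_top [of "nat \<lceil>\<bar>R\<bar>\<rceil>"]
  proof eventually_elim
    case (elim n)
    show ?case
    proof (intro ballI)
      fix j :: nat assume j: "j \<in> {1, 2}"
      let ?S = "{(n', j'). n' \<ge> N0 \<and> j' \<in> {1, 2} \<and> complex_of_real (lam n' j') = of_real (lam n j)}"
      have "real n > R" using elim(3) by linarith
      then have "cmod (of_real (lam n j)) > R" using grow [OF elim(1) j] by simp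
      then have mult: "multiplicity_of q (of_real (lam n j)) = card ?S" by (rule R)
      \<comment> \<open>The cardinality of an infinite set is 0, so the counting formula gives lower
        bounds only if the index set is finite. This follows from the growth of \<open>lam\<close>,
        which confines n'.\<close>
      have "?S \<subseteq> {..max N1 (nat \<lceil>lam n j\<rceil>)} \<times> {1, 2}"
      proof (rule subsetI)
        fix z assume z: "z \<in> ?S"
        obtain n' j' where z': "z = (n', j')" by (cases z)
        have j': "j' \<in> {1, 2}" and eq: "lam n' j' = lam n j" using z by (auto simp: z')
        have "n' \<le> max N1 (nat \<lceil>lam n j\<rceil>)"
        proof (cases "n' \<ge> N1")
          case True
          then have "real n' \<le> lam n j" using grow [OF True j'] eq by simp
          then have "n' \<le> nat \<lceil>lam n j\<rceil>" by linarith
          then show ?thesis by simp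
        qed simp
        then show "z \<in> {..max N1 (nat \<lceil>lam n j\<rceil>)} \<times> {1, 2}" using j' by (simp add: z')
      qed
      then have fin: "finite ?S" by (rule finite_subset) auto
      have in1: "(n, j) \<in> ?S" using elim j by auto
      have "card {(n, j)} \<le> card ?S" by (rule card_mono [OF fin]) (use in1 in blast)
      then have "card ?S \<ge> 1" by simp
      moreover have "card ?S \<ge> 2" if "lam n 1 = lam n 2"
      proof -
        have "{(n, 1), (n, 2)} \<subseteq> ?S" using elim j that by auto
        then have "card {(n, 1::nat), (n, 2)} \<le> card ?S" by (rule card_mono [OF fin])
        then show ?thesis by simp
      qed
      ultimately show "multiplicity_of q (of_real (lam n j)) \<ge> 1 \<and>
        (lam n 1 = lam n 2 \<longrightarrow> multiplicity_of q (of_real (lam n j)) \<ge> 2)" by (simp add: mult)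
    qed
  qed
qed

text \<open>Since n^2 \<open>rho\<close> tends to 0, the threshold \<epsilon> / n^2 eventually
  exceeds 12 \<open>rho\<close>, the separation assumed by the preceding arguments. Simplicity in
  turn excludes lam n 1 = lam n 2, because equal labels count twice in the multiplicity.\<close>

lemma eigenvalue_asymptotics:
  assumes L: "large_eigenvalues q N0 lam" and "\<epsilon> > 0"
  shows "\<forall>\<^sub>F n in sequentially. splitting q n \<ge> \<epsilon> / (real n)\<^sup>2 \<longrightarrow>
    (\<forall>j\<in>{1, 2}. simple_eigenvalue q (of_real (lam n j)) \<and>
      cmod (of_real (lam n j) - (of_real ((2 * pi * real n)\<^sup>2) + A2 q n + (- 1) ^ j * of_real (splitting q n)))
        \<le> 4 * rho n)"
proof -
  have g: "\<forall>\<^sub>F n in sequentially. M * gap_sum n < 1 / 4"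
  proof -
    have "(\<lambda>n. M * gap_sum n) \<longlonglongrightarrow> M * 0" by (intro tendsto_intros gap_sum_tendsto)
    then show ?thesis by (intro order_tendstoD(2)) auto
  qed
  have r: "\<forall>\<^sub>F n in sequentially. (real n)\<^sup>2 * rho n < \<epsilon> / 12"
    using rho_small \<open>\<epsilon> > 0\<close> by (intro order_tendstoD(2)) auto
  have le: "\<forall>\<^sub>F n in sequentially. lam n 1 \<le> lam n 2"
    using L unfolding large_eigenvalues_def eventually_sequentially by blast
  show ?thesis
    using large_eigenvalues_window [OF L] large_eigenvalues_multiplicity [OF L] g r le eventually_gt_at_top [of 0]
  proof eventually_elim
    case (elim n)
    show ?case
    proof
      assume S: "splitting q n \<ge> \<epsilon> / (real n)\<^sup>2"
      have n: "n > 0" using elim by simp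
      then have n2: "(real n)\<^sup>2 > 0" by simp
      have "12 * rho n < \<epsilon> / (real n)\<^sup>2" using elim(4) n2 by (simp add: field_simps)
      then have gap: "cmod (\<beta> n) > 12 * rho n" using S cmod_\<beta> [OF n] by simp
      have ad: "admissible n (lam n j - (2 * pi * real n)\<^sup>2)" if "j \<in> {1, 2}" for j
        unfolding admissible_def using elim(1,3) that n by (metis less_imp_le)
      have le1: "multiplicity_of q (of_real (lam n j)) \<le> 1" if "j \<in> {1, 2}" for j
        by (rule multiplicity_le_1 [OF ad [OF that] gap])
      then have simple: "simple_eigenvalue q (of_real (lam n j))" if "j \<in> {1, 2}" for j
        using elim(2) that unfolding simple_eigenvalue_def by (meson le_antisym)
      have "lam n 1 \<noteq> lam n 2" using elim(2) le1 [of 1] by fastforce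
      then have lt: "lam n 1 < lam n 2" using elim(5) by simp
      have near: "near n (lam n 1 - (2 * pi * real n)\<^sup>2) (-1)" "near n (lam n 2 - (2 * pi * real n)\<^sup>2) 1"
        using eigenvalue_pair [OF ad ad gap lt] elim(2) by auto
      have "cmod (of_real (lam n j) - (of_real ((2 * pi * real n)\<^sup>2) + A2 q n + (- 1) ^ j * of_real (splitting q n)))
        \<le> 4 * rho n" if "j \<in> {1, 2}" for j
      proof -
        have eq: "of_real (lam n j) - (of_real ((2 * pi * real n)\<^sup>2) + A2 q n + (- 1) ^ j * of_real (splitting q n))
          = of_real (lam n j - (2 * pi * real n)\<^sup>2) - A n - of_real ((- 1) ^ j * cmod (\<beta> n))"
          unfolding A_eq [OF n] cmod_\<beta> [OF n] by simp
        show ?thesis unfolding eq using near that unfolding near_def by auto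
      qed
      then show "\<forall>j\<in>{1, 2}. simple_eigenvalue q (of_real (lam n j)) \<and>
        cmod (of_real (lam n j) - (of_real ((2 * pi * real n)\<^sup>2) + A2 q n + (- 1) ^ j * of_real (splitting q n)))
        \<le> 4 * rho n" using simple by blast
    qed
  qed
qed

end

theorem theorem6:
  fixes q :: "real \<Rightarrow> real" and \<epsilon> :: real and N0 :: nat and lam :: "nat \<Rightarrow> nat \<Rightarrow> real"
  assumes "q absolutely_integrable_on {0..1}"
    and "\<And>x. q (x + 1) = q x"
    and "(LINT x:{0..1}|lebesgue. q x) = 0"
    and "large_eigenvalues q N0 lam"
    and "\<epsilon> > 0"
  shows "\<forall>\<^sub>F N in sequentially.
           (\<forall>n\<in>N3 q \<epsilon> N. \<forall>j\<in>{1, 2}. simple_eigenvalue q (of_real (lam n j))) \<and>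
           (\<forall>j\<in>{1, 2}.
              (\<lambda>n. of_real (lam n j)
                   - (of_real ((2 * pi * real n)\<^sup>2) + A2 q n + (- 1) ^ j * of_real (splitting q n)))
              \<in> o[inf at_top (principal (N3 q \<epsilon> N))](\<lambda>n. 1 / (of_nat n)\<^sup>2))"
proof -
  interpret potential q
    using assms(1,3) by unfold_locales (simp_all add: set_integrable_eq_LI LINT_set_eq)
  note ev = eigenvalue_asymptotics [OF assms(4,5)]
  then obtain N1 where N1: "\<And>n j. n \<ge> N1 \<Longrightarrow> splitting q n \<ge> \<epsilon> / (real n)\<^sup>2 \<Longrightarrow> j \<in> {1, 2}
      \<Longrightarrow> simple_eigenvalue q (of_real (lam n j))"
    unfolding eventually_sequentially by blast
  show ?thesis
    using eventually_ge_at_top [of N1]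
  proof eventually_elim
    case (elim N)
    have "simple_eigenvalue q (of_real (lam n j))" if "n \<in> N3 q \<epsilon> N" "j \<in> {1, 2}" for n j
      using that elim by (intro N1) (auto simp: N3_def)
    moreover have "(\<lambda>n. of_real (lam n j)
          - (of_real ((2 * pi * real n)\<^sup>2) + A2 q n + (- 1) ^ j * of_real (splitting q n)))
        \<in> o[inf at_top (principal (N3 q \<epsilon> N))](\<lambda>n. 1 / (of_nat n)\<^sup>2)" if j: "j \<in> {1, 2}" for j
    proof (rule landau_o.smallI)
      fix e :: real assume "e > 0"
      \<comment> \<open>This rate holds along all n; membership in \<open>N3\<close> enters through
        the separation that makes \<open>4 * rho n\<close> an error bound.\<close>
      have "\<forall>\<^sub>F n in sequentially. (real n)\<^sup>2 * rho n < e / 4"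
        using rho_small \<open>e > 0\<close> by (intro order_tendstoD(2)) auto
      then have "\<forall>\<^sub>F n in sequentially. n \<in> N3 q \<epsilon> N \<longrightarrow>
          cmod (of_real (lam n j) - (of_real ((2 * pi * real n)\<^sup>2) + A2 q n + (- 1) ^ j * of_real (splitting q n)))
            \<le> e * cmod (1 / (of_nat n)\<^sup>2)"
        using ev eventually_gt_at_top [of 0]
      proof eventually_elim
        case (elim n)
        have "4 * rho n \<le> e * cmod (1 / (of_nat n)\<^sup>2)"
          using elim(1,3) by (simp add: norm_divide norm_power field_simps)
        then show ?case using elim(2) j by (auto simp: N3_def)
      qed
      then show "\<forall>\<^sub>F n in inf at_top (principal (N3 q \<epsilon> N)).
          cmod (of_real (lam n j) - (of_real ((2 * pi * real n)\<^sup>2) + A2 q n + (- 1) ^ j * of_real (splitting q n)))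
            \<le> e * cmod (1 / (of_nat n)\<^sup>2)"
        by (simp add: eventually_inf_principal)
    qed
    ultimately show ?case by blast
  qed
qed

end
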